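(* Let $k\ge2$ and $p>0$ be integers with $\gcd(p,k)=1$, and let $$F(z)= z^{p}e^{Az^k}\,\frac{\prod_{\nu=1}^{\omega_1}\left(1+\frac{z^k}{a_\nu}\right)}{\prod_{\mu=1}^{\omega_2}\left(1-\frac{z^k}{b_\mu}\right)},\qquad F(z)\not\equiv z^p,$$ where $0<\omega_1,\omega_2\le+\infty$, $A\ge0$ and $a_\nu,b_\mu>0$ for all $\nu,\mu$. Let $\alpha\in\mathbb{C}\setminus\{0\}$ be such that the $\alpha$-set of $F$ is nonempty. Let $q\in\{0,\dots,k-1\}$ and $\varkappa\in\{0,1\}$ be chosen so that $\alpha\in\widetilde Q_{2q-\varkappa}$, and let the integer $m$ be such that $pm\equiv q\pmod k$. If $\alpha^k\not<0$ (i.e. $\alpha^k$ is not a negative real number), then the $\alpha$-point $z_*$ of $F$ closest to the origin is simple and distinct in argument and absolute value from the succeeding $\alpha$-points. Moreover, $\alpha\in Q_{2q-\varkappa}$ implies $z_*\in Q_{2m-\varkappa}$. If $\alpha e_{-2q}>0$, then $z_*e_{-2m}>0$. If $\alpha^k<0$, that is $\alpha e_{-2q+1}>0$, then the two zeros of $F(z)-\alpha$ closest to the origin (counting double zeros as two) are equal in absolute value or in argument. The latter case (equal argument, including the case of one double zero) is possible only when $p=1$; if it occurs, both zeros belong to the ray $\{z: ze_{-2m+1}>0\}$. In the former case (two distinct zeros of equal absolute value), one of them belongs to $Q_{2m-1}$ and the other belongs to $Q_{2\widetilde m}=Q_{-2m-2s}$, where $\widetilde m$ satisfies $p\widetilde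 m\equiv q-1\pmod k$ and $s$ is an integer such that $\Im(\alpha e_{ps})=0$.
   Context: $e_m:=\exp\left(i\frac{m}{k}\pi\right)$; for $s\in\mathbb{Z}$, $Q_s:=\{z\ne0:0<\operatorname{Arg}(ze_{-s})<\frac{\pi}{k}\}$ and $\widetilde Q_s:=\{z\ne0:0\le\operatorname{Arg}(ze_{-s})<\frac{\pi}{k}\}$ ($\operatorname{Arg}$ the principal argument); indices are taken modulo $2k$. The products are absolutely convergent. An $\alpha$-point of $F$ is a $z$ with $F(z)=\alpha$ (the $\alpha$-set is the set of all of them), simple if $F'(z)\ne0$. "The succeeding $\alpha$-points" are the $\alpha$-points having the next smallest absolute value (if any). "$x>0$" for a complex expression means it is real and positive. *)

theory Defs
  imports
    "HOL-Complex_Analysis.Complex_Analysis"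
    "HOL-Number_Theory.Cong"
    "HOL-Library.Extended_Nat"
    "HOL-Library.Multiset"
    "HOL-Library.Complex_Order"
begin

(* In the order of Complex_Order, 0 < x (x < 0) for complex x says that x is a positive (negative)
   real number. *)

definition unit_root :: "nat \<Rightarrow> int \<Rightarrow> complex" where
  "unit_root k m = exp (\<i> * (of_int m / of_nat k) * of_real pi)"

definition sector :: "nat \<Rightarrow> int \<Rightarrow> complex set" where
  "sector k s = {z. z \<noteq> 0 \<and> 0 < Arg (z * unit_root k (- s))
                        \<and> Arg (z * unit_root k (- s)) < pi / real k}"

definition half_closed_sector :: "nat \<Rightarrow> int \<Rightarrow> complex set" where
  "half_closed_sector k s = {z. z \<noteq> 0 \<and> 0 \<le> Arg (z * unit_root k (- s))
                        \<and> Arg (z * unit_root k (- s)) < pi / real k}"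

definition eprod :: "enat \<Rightarrow> (nat \<Rightarrow> complex) \<Rightarrow> complex" where
  "eprod \<omega> f = (case \<omega> of enat n \<Rightarrow> (\<Prod>\<nu><n. f \<nu>) | \<infinity> \<Rightarrow> prodinf f)"

definition abs_convergent_eprod :: "enat \<Rightarrow> (nat \<Rightarrow> complex) \<Rightarrow> bool" where
  "abs_convergent_eprod \<omega> f \<longleftrightarrow> (\<omega> = \<infinity> \<longrightarrow> abs_convergent_prod f)"

(* The factors are indexed from 0, i.e. by the naturals below \<omega>1 (resp. \<omega>2).  At a pole
   (z ^ k = b \<mu>) the value is 0 because division by zero gives 0, so poles never count as
   \<alpha>-points when \<alpha> is nonzero. *)
definition Ffun ::
  "nat \<Rightarrow> nat \<Rightarrow> real \<Rightarrow> enat \<Rightarrow> (nat \<Rightarrow> real) \<Rightarrow> enat \<Rightarrow> (nat \<Rightarrow> real) \<Rightarrow> complex \<Rightarrow> complex" where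
  "Ffun k p A \<omega>1 a \<omega>2 b z =
     z ^ p * exp (of_real A * z ^ k)
       * (eprod \<omega>1 (\<lambda>\<nu>. 1 + z ^ k / of_real (a \<nu>)) / eprod \<omega>2 (\<lambda>\<mu>. 1 - z ^ k / of_real (b \<mu>)))"

definition alpha_set :: "(complex \<Rightarrow> complex) \<Rightarrow> complex \<Rightarrow> complex set" where
  "alpha_set f \<alpha> = {z. f z = \<alpha>}"

definition simple_point :: "(complex \<Rightarrow> complex) \<Rightarrow> complex \<Rightarrow> bool" where
  "simple_point f z \<longleftrightarrow> deriv f z \<noteq> 0"

definition nearest_points :: "complex set \<Rightarrow> complex set" where
  "nearest_points S = {z \<in> S. \<forall>w\<in>S. cmod z \<le> cmod w}"

(* When z is nearest to the origin, these are the points coming right after z.  Equality of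
   absolute value with z is not excluded by the definition. *)
definition succeeding_points :: "complex set \<Rightarrow> complex \<Rightarrow> complex set" where
  "succeeding_points S z = nearest_points (S - {z})"

(* M consists of n zeros of f, each repeated at most as often as its multiplicity allows, and no
   zero that still has unused multiplicity is closer to the origin than a member of M. *)
definition nearest_zeros :: "(complex \<Rightarrow> complex) \<Rightarrow> nat \<Rightarrow> complex multiset \<Rightarrow> bool" where
  "nearest_zeros f n M \<longleftrightarrow>
     size M = n \<and>
     (\<forall>z\<in>#M. f z = 0 \<and> int (count M z) \<le> zorder f z) \<and>
     (\<forall>z\<in>#M. \<forall>w. f w = 0 \<and> int (count M w) < zorder f w \<longrightarrow> cmod z \<le> cmod w)"

end

theory Submission
  imports Defs
begin

text \<open>Put w = z ^ k and t = log w. On the closed strip 0 \<le> Im t \<le> pi, a branch of log F is a sum of a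
  linear term and of functions whose derivative has nonnegative imaginary part, so that
  Im ((log F t - log F s) * cnj (t - s)) > 0 for any two distinct points not on the same edge. On a
  level set of the modulus of F this says that arg F strictly increases with the modulus of z.
  Let beta be the angular distance of \<alpha> to the ray of argument 2 * pi * q / k, so that
  beta \<le> pi / k. By the rotational symmetry of F, arg F takes at the \<alpha>-points (brought to the strip) values
  congruent to beta or - beta modulo 2 * pi / k; hence the \<alpha>-point closest to the origin is the
  point of the level set with arg F = beta, and the next possible value is 2 * pi / k - beta. Each of
  these values is attained, because the modulus of F takes every positive value on the curve where
  arg F has the given value (together with the parts of the edges where it has this value).
  For beta = pi / k both values coincide. Either they are attained at an interior point of the strip,
  which gives two zeros symmetric about a ray, or on the edge Im t = pi, which requires p = 1; there the
  logarithmic derivative of F is strictly decreasing, which leaves two simple zeros or a double one.\<close>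

section \<open>Products of genus zero\<close>

text \<open>One closed strip suffices: conjugation commutes with \<open>F\<close>, and rotation by 2
  * pi / k multiplies \<open>F\<close> by a root of unity. Writing \<open>logF\<close> = U + i * V
  and t = x + i * y, the increment product is dV * dx - dU * dy. Constant U thus orders points by V,
  while constant y shows that V increases along horizontal lines, so that V = \<gamma> is a graph
  over y. The obstacle is the edges, which carry the poles (lower) and the zeros (upper): V is a
  step function there, the inequality is only weak, and a curve V = \<gamma> can run into an edge.
  Hence \<open>regular\<close>, \<open>same_edge\<close> and separate arguments for each edge.
  Values \<gamma> in [0, pi] suffice, since 2 * pi / k - \<beta> \<le> pi for k \<ge> 2. The
  ordering alone does not separate the argument of the closest \<alpha>-point from those of its
  successors. An \<alpha>-point further out on the same ray has V larger by at least 2 * pi, and the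
  existing point with V = 2 * pi / k - \<beta> comes strictly before it.\<close>

definition gprod :: "(nat \<Rightarrow> real) \<Rightarrow> complex \<Rightarrow> complex" where
  "gprod c w = (\<Prod>\<nu>. 1 + of_real (c \<nu>) * w)"

text \<open>The coefficients are to be the reciprocals of the a_\<nu> or b_\<mu>, so that
  summability is absolute convergence of the product.\<close>

locale nonneg_summable =
  fixes c :: "nat \<Rightarrow> real"
  assumes nonneg: "c \<nu> \<ge> 0"
    and summable_c: "summable c"
begin

lemma convergent_factors: "convergent_prod (\<lambda>\<nu>. 1 + of_real (c \<nu>) * w :: complex)"
proof -
  have "summable (\<lambda>\<nu>. norm ((1 + of_real (c \<nu>) * w) - 1))"
    using summable_mult2[OF summable_c, of "norm w"] nonneg
    by (simp add: norm_mult)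
  then have "abs_convergent_prod (\<lambda>\<nu>. 1 + of_real (c \<nu>) * w)"
    by (rule summable_imp_abs_convergent_prod)
  then show ?thesis
    by (rule abs_convergent_prod_imp_convergent_prod)
qed

lemma gprod_eq_0_iff: "gprod c w = 0 \<longleftrightarrow> (\<exists>\<nu>. 1 + of_real (c \<nu>) * w = 0)"
proof -
  have "(\<lambda>\<nu>. 1 + of_real (c \<nu>) * w) has_prod gprod c w"
    unfolding gprod_def using convergent_factors by blast
  then show ?thesis
    by (subst has_prod_eq_0_iff) (auto simp: image_iff eq_commute[of 0])
qed

lemma gprod_nonzeroD: "gprod c w \<noteq> 0 \<Longrightarrow> 1 + of_real (c \<nu>) * w \<noteq> 0"
  using gprod_eq_0_iff by blast

lemma gprod_limit: "(\<lambda>n. \<Prod>\<nu><n. 1 + of_real (c \<nu>) * w) \<longlonglongrightarrow> gprod c w"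
  using convergent_prod_LIMSEQ[OF convergent_factors[of w]]
  by (simp add: gprod_def LIMSEQ_lessThan_iff_atMost)

text \<open>M-test on each disc, with majorant \<open>c n * R\<close>. It makes \<open>gprod\<close>
  entire and allows its logarithmic derivative to be formed termwise.\<close>

lemma gprod_uniform_limit:
  "uniform_limit (cball 0 R) (\<lambda>n w. \<Prod>\<nu><n. 1 + of_real (c \<nu>) * w) (gprod c) sequentially"
proof -
  have "uniformly_convergent_on (cball 0 R) (\<lambda>n (w::complex). \<Prod>\<nu><n. 1 + of_real (c \<nu>) * w)"
  proof (rule uniformly_convergent_on_prod')
    show "uniformly_convergent_on (cball 0 R)
      (\<lambda>N w. \<Sum>n<N. norm (1 + complex_of_real (c n) * w - 1))"
    proof (rule Weierstrass_m_test'_ev)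
      show "\<forall>\<^sub>F n in sequentially. \<forall>w\<in>cball 0 R.
          norm (norm (1 + complex_of_real (c n) * w - 1)) \<le> c n * R"
        using nonneg by (auto intro!: always_eventually mult_left_mono simp: norm_mult)
      show "summable (\<lambda>n. c n * R)"
        by (rule summable_mult2[OF summable_c])
    qed
  qed (rule compact_cball continuous_intros)+
  then obtain g where g:
    "uniform_limit (cball 0 R) (\<lambda>n (w::complex). \<Prod>\<nu><n. 1 + of_real (c \<nu>) * w) g sequentially"
    by (auto simp: uniformly_convergent_on_def)
  have eq: "g w = gprod c w" if "w \<in> cball 0 R" for w
    by (rule LIMSEQ_unique[OF tendsto_uniform_limitI[OF g that] gprod_limit])
  show ?thesis
    by (rule iffD1[OF uniform_limit_cong'[OF refl eq] g])
qed

lemma gprod_holomorphic [holomorphic_intros]: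
  assumes "f holomorphic_on S"
  shows "(\<lambda>z. gprod c (f z)) holomorphic_on S"
proof -
  have "gprod c holomorphic_on ball 0 R" for R
  proof (rule holomorphic_uniform_sequence
      [where f = "\<lambda>n w. \<Prod>\<nu><n. 1 + of_real (c \<nu>) * w"])
    fix x :: complex
    assume "x \<in> ball 0 R"
    then obtain e where "e > 0" "cball x e \<subseteq> ball 0 R"
      using open_contains_cball by blast
    moreover have "uniform_limit (cball x e) (\<lambda>n w. \<Prod>\<nu><n. 1 + of_real (c \<nu>) * w)
        (gprod c) sequentially"
      using \<open>cball x e \<subseteq> ball 0 R\<close>
      by (intro uniform_limit_on_subset[OF gprod_uniform_limit[of R]]) auto
    ultimately show "\<exists>d>0. cball x d \<subseteq> ball 0 R \<and>
        uniform_limit (cball x d) (\<lambda>n w. \<Prod>\<nu><n. 1 + of_real (c \<nu>) * w) (gprod c) sequentially"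
      by blast
  qed (auto intro!: holomorphic_intros)
  then have "gprod c holomorphic_on (\<Union>R. ball 0 R)"
    by (intro holomorphic_on_UN_open) auto
  moreover have "w \<in> ball 0 (norm w + 1)" for w :: complex
    by simp
  then have "(\<Union>R. ball (0::complex) R) = UNIV"
    by blast
  ultimately have "gprod c holomorphic_on UNIV"
    by simp
  then show ?thesis
    using holomorphic_on_compose_gen[OF assms, of "gprod c" UNIV] by (simp add: o_def)
qed

lemma gprod_logderiv:
  assumes "gprod c w \<noteq> 0"
  shows "(\<lambda>\<nu>. of_real (c \<nu>) / (1 + of_real (c \<nu>) * w)) sums (deriv (gprod c) w / gprod c w)"
proof -
  have "(\<lambda>\<nu>. deriv (\<lambda>w. 1 + of_real (c \<nu>) * w) w / (1 + of_real (c \<nu>) * w))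
      sums (deriv (gprod c) w / gprod c w)"
  proof (rule logderiv_prodinf_complex_uniform_limit[where A = "ball 0 (norm w + 1)"])
    show "uniform_limit (ball 0 (cmod w + 1))
        (\<lambda>n x. \<Prod>k<n. 1 + complex_of_real (c k) * x) (gprod c) sequentially"
      by (rule uniform_limit_on_subset[OF gprod_uniform_limit[of "norm w + 1"]]) auto
  qed (use assms in \<open>auto intro!: holomorphic_intros\<close>)
  moreover have "deriv (\<lambda>w. 1 + of_real (c \<nu>) * w) w = of_real (c \<nu>)" for \<nu>
    by (auto intro!: DERIV_imp_deriv derivative_eq_intros)
  ultimately show ?thesis
    by simp
qed

lemma gprod_cnj: "gprod c (cnj w) = cnj (gprod c w)"
proof -
  have "(\<lambda>n. cnj (\<Prod>\<nu><n. 1 + of_real (c \<nu>) * w)) \<longlonglongrightarrow> cnj (gprod c w)"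
    by (intro tendsto_cnj gprod_limit)
  then have "(\<lambda>n. \<Prod>\<nu><n. 1 + of_real (c \<nu>) * cnj w) \<longlonglongrightarrow> cnj (gprod c w)"
    by simp
  then show ?thesis
    by (rule LIMSEQ_unique[OF gprod_limit])
qed

end

section \<open>A branch of the logarithm of a product on a closed strip\<close>

definition strip :: "complex set" where
  "strip = {t. 0 \<le> Im t \<and> Im t \<le> pi}"

text \<open>The exceptional pairs: their connecting segment lies in an edge, where the derivative of
  \<open>la\<close> is real and may have a pole. Any other segment between points of the strip has
  its open part inside the strip.\<close>

definition same_edge :: "complex \<Rightarrow> complex \<Rightarrow> bool" where
  "same_edge s t \<longleftrightarrow> (Im s = 0 \<and> Im t = 0) \<or> (Im s = pi \<and> Im t = pi)"

text \<open>Rotating the argument by a quarter turn moves the branch cut of the principal logarithm out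
  of the closed upper half-plane, which contains 1 + c * exp t for t in the strip.\<close>

definition la :: "real \<Rightarrow> complex \<Rightarrow> complex" where
  "la c t = Ln (- \<i> * (1 + of_real c * exp t)) + \<i> * of_real pi / 2"

lemma exp_i_pi_half: "exp (\<i> * of_real pi / 2) = \<i>"
  using cis_conv_exp[of "pi / 2"] by (simp add: cis_pi_half)

lemma Im_exp_strip: "t \<in> strip \<Longrightarrow> Im (exp t) \<ge> 0"
  by (auto simp: strip_def Im_exp sin_ge_zero)

lemma Im_exp_interior: "0 < Im t \<Longrightarrow> Im t < pi \<Longrightarrow> Im (exp t) > 0"
  by (auto simp: Im_exp sin_gt_zero)

lemma la_arg_not_nonpos:
  assumes "c \<ge> 0" "t \<in> strip" "1 + of_real c * exp t \<noteq> 0"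
  shows "- \<i> * (1 + of_real c * exp t) \<notin> \<real>\<^sub>\<le>\<^sub>0"
proof
  assume *: "- \<i> * (1 + of_real c * exp t) \<in> \<real>\<^sub>\<le>\<^sub>0"
  then have "Re (1 + of_real c * exp t) = 0" "c * Im (exp t) \<le> 0"
    by (auto simp: complex_nonpos_Reals_iff)
  moreover have "c * Im (exp t) \<ge> 0"
    using assms Im_exp_strip by simp
  ultimately show False
    using assms(3) by (simp add: complex_eq_iff)
qed

lemma minus_i_times_i: "- (\<i> * z * \<i>) = z"
  by (simp add: complex_eq_iff)

lemma exp_la: "1 + of_real c * exp t \<noteq> 0 \<Longrightarrow> exp (la c t) = 1 + of_real c * exp t"
  by (simp add: la_def exp_add exp_Ln exp_i_pi_half minus_i_times_i)

lemma la_has_derivative: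
  assumes "c \<ge> 0" "t \<in> strip" "1 + of_real c * exp t \<noteq> 0"
  shows "(la c has_field_derivative (of_real c * exp t / (1 + of_real c * exp t))) (at t within S)"
proof -
  have "((\<lambda>t. - \<i> * (1 + of_real c * exp t)) has_field_derivative - \<i> * (of_real c * exp t)) (at t within S)"
    by (auto intro!: derivative_eq_intros)
  from DERIV_chain2[OF has_field_derivative_Ln[OF la_arg_not_nonpos[OF assms]] this]
  have "(la c has_field_derivative
      inverse (- \<i> * (1 + of_real c * exp t)) * (- \<i> * (of_real c * exp t))) (at t within S)"
    unfolding la_def by (intro DERIV_add[where E = 0, simplified] DERIV_const)
  moreover have "inverse (- \<i> * z) * (- \<i> * w) = w / z" if "z \<noteq> 0" for z w
    using that by (simp add: field_simps)
  ultimately show ?thesis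
    using assms(3) by simp
qed

lemma la_continuous:
  assumes "c \<ge> 0" "\<And>t. t \<in> S \<Longrightarrow> t \<in> strip \<and> 1 + of_real c * exp t \<noteq> 0"
  shows "continuous_on S (la c)"
  by (rule DERIV_continuous_on) (rule la_has_derivative, use assms in auto)

lemma la_0: "la 0 t = 0"
  by (simp add: la_def)

text \<open>Ties the rotated branch to the principal one in the right half-plane, where size
  estimates and real values are available.\<close>

lemma la_eq_Ln:
  assumes "Re (1 + of_real c * exp t) > 0"
  shows "la c t = Ln (1 + of_real c * exp t)"
proof -
  let ?y = "1 + of_real c * exp t"
  have "?y \<noteq> 0"
    using assms by (metis less_irrefl zero_complex.sel(1))
  then have "Ln (\<i> * (- \<i> * ?y)) = Ln (- \<i> * ?y) + \<i> * of_real pi / 2"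
    using assms by (subst Ln_times_ii) auto
  moreover have "\<i> * (- \<i> * ?y) = ?y"
    by (simp add: complex_eq_iff)
  ultimately show ?thesis
    by (simp only: la_def)
qed

text \<open>From |Ln (1 + w)| \<le> 2 * |w| for |w| < 1/2. The estimate serves both the summation of
  the branches and the behaviour far to the left.\<close>

lemma norm_la_le:
  assumes "c \<ge> 0" "c * exp (Re t) < 1/2"
  shows "norm (la c t) \<le> 2 * (c * exp (Re t))"
proof -
  have n: "norm (of_real c * exp t) = c * exp (Re t)"
    using assms(1) by (simp add: norm_mult norm_exp_eq_Re)
  then have "Re (of_real c * exp t) > - 1"
    using abs_Re_le_cmod[of "of_real c * exp t"] assms(2) by linarith
  then show ?thesis
    using norm_Ln_le[of "of_real c * exp t"] la_eq_Ln[of c t] assms n by simp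
qed

lemma Im_la_nonneg:
  assumes "c \<ge> 0" "t \<in> strip" "1 + of_real c * exp t \<noteq> 0"
  shows "0 \<le> Im (la c t)"
proof -
  let ?z = "- \<i> * (1 + of_real c * exp t)"
  have "Re ?z \<ge> 0"
    using assms(1) Im_exp_strip[OF assms(2)] by simp
  moreover have "?z \<noteq> 0"
    using assms(3) by simp
  ultimately have "\<bar>Im (Ln ?z)\<bar> \<le> pi / 2"
    using Re_Ln_pos_le by blast
  then show ?thesis
    by (auto simp: la_def abs_le_iff)
qed

lemma Im_la_bottom:
  assumes "c \<ge> 0" "Im t = 0"
  shows "Im (la c t) = 0"
proof -
  have "1 + of_real c * exp t = of_real (1 + c * exp (Re t))"
    using assms(2) by (simp add: complex_eq_iff Re_exp Im_exp)
  moreover have "1 + c * exp (Re t) > 0"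
    using assms(1) by (simp add: add_pos_nonneg)
  ultimately show ?thesis
    by (subst la_eq_Ln) (simp_all del: of_real_add of_real_mult add: Ln_of_real)
qed

text \<open>Here the factor is real. To the right of its zero it is negative, and the branch
  continued through the upper half-plane assigns it the argument pi.\<close>

lemma Im_la_top:
  assumes "c \<ge> 0" "Im t = pi" "1 + of_real c * exp t \<noteq> 0"
  shows "Im (la c t) = (if c * exp (Re t) > 1 then pi else 0)"
proof -
  define y where "y = 1 - c * exp (Re t)"
  have y: "1 + of_real c * exp t = of_real y"
    using assms(2) by (simp add: complex_eq_iff Re_exp Im_exp y_def)
  then have "y \<noteq> 0"
    using assms(3) by auto
  show ?thesis
  proof (cases "y > 0")
    case True
    then have "la c t = Ln (of_real y)"
      by (subst la_eq_Ln) (simp_all only: y Re_complex_of_real)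
    then have "Im (la c t) = 0"
      using True by (simp add: Ln_of_real)
    then show ?thesis
      using True by (simp add: y_def)
  next
    case False
    then have "Im (Ln (- \<i> * of_real y)) = pi / 2"
      using \<open>y \<noteq> 0\<close> by (subst Im_Ln_eq_pi_half) auto
    then show ?thesis
      using False \<open>y \<noteq> 0\<close> by (simp add: la_def y) (simp add: y_def)
  qed
qed

text \<open>Along the segment, traversed with velocity t - s, the product f * cnj (t - s) has
  derivative |t - s|^2 * f', because (t - s) * cnj (t - s) is real and positive. So its imaginary
  part increases.\<close>

lemma Im_increment_pos:
  fixes f f' :: "complex \<Rightarrow> complex"
  assumes "s \<noteq> t" and cont: "continuous_on (closed_segment s t) f"
    and der: "\<And>z. z \<in> open_segment s t \<Longrightarrow> (f has_field_derivative f' z) (at z)"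
    and pos: "\<And>z. z \<in> open_segment s t \<Longrightarrow> Im (f' z) > 0"
  shows "Im ((f t - f s) * cnj (t - s)) > 0"
proof -
  define h where "h x = s + of_real x * (t - s)" for x
  define \<phi> where "\<phi> x = Im (f (h x) * cnj (t - s))" for x
  have h_closed: "h x \<in> closed_segment s t" if "x \<in> {0..1}" for x
    using that unfolding h_def closed_segment_def
    by (auto intro!: exI[of _ x] simp: algebra_simps scaleR_conv_of_real)
  have h_open: "h x \<in> open_segment s t" if "0 < x" "x < 1" for x
    using that \<open>s \<noteq> t\<close> unfolding h_def in_segment
    by (auto intro!: exI[of _ x] simp: algebra_simps scaleR_conv_of_real)
  have "\<phi> 0 < \<phi> 1"
  proof (rule DERIV_pos_imp_increasing_open[of 0 1 \<phi>])
    fix x :: real assume x: "0 < x" "x < 1"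
    have "(h has_vector_derivative (t - s)) (at x)"
      unfolding h_def by (auto intro!: derivative_eq_intros simp: has_vector_derivative_def scaleR_conv_of_real)
    from field_vector_diff_chain_at[OF this der[OF h_open[OF x]]]
    have "((\<lambda>x. f (h x)) has_vector_derivative (t - s) * f' (h x)) (at x)"
      by (simp add: o_def)
    then have "((\<lambda>x. f (h x) * cnj (t - s)) has_vector_derivative
        ((t - s) * f' (h x)) * cnj (t - s)) (at x)"
      by (rule has_vector_derivative_mult_left)
    then have *: "(\<phi> has_vector_derivative Im (((t - s) * f' (h x)) * cnj (t - s))) (at x)"
      unfolding \<phi>_def by (rule bounded_linear.has_vector_derivative[OF bounded_linear_Im])
    have "((t - s) * f' (h x)) * cnj (t - s) = of_real ((norm (t - s))\<^sup>2) * f' (h x)"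
      unfolding complex_norm_square by (simp only: mult_ac)
    moreover have "Im (of_real r * w) = r * Im w" for r w
      by simp
    ultimately have "Im (((t - s) * f' (h x)) * cnj (t - s)) = (norm (t - s))\<^sup>2 * Im (f' (h x))"
      by metis
    with * have "(\<phi> has_real_derivative (norm (t - s))\<^sup>2 * Im (f' (h x))) (at x)"
      by (simp only: has_real_derivative_iff_has_vector_derivative)
    moreover have "(norm (t - s))\<^sup>2 * Im (f' (h x)) > 0"
      using pos[OF h_open[OF x]] \<open>s \<noteq> t\<close> by simp
    ultimately show "\<exists>y. (\<phi> has_real_derivative y) (at x) \<and> 0 < y"
      by blast
  next
    have "continuous_on {0..1} (\<lambda>x. f (h x))"
      by (rule continuous_on_compose2[OF cont])
         (use h_closed in \<open>auto simp: h_def intro!: continuous_intros\<close>)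
    then show "continuous_on {0..1} \<phi>"
      unfolding \<phi>_def by (intro continuous_intros)
  qed simp
  then show ?thesis
    by (simp add: \<phi>_def h_def left_diff_distrib)
qed

lemma open_segment_interior:
  assumes "s \<in> strip" "t \<in> strip" "\<not> same_edge s t" "z \<in> open_segment s t"
  shows "0 < Im z" "Im z < pi"
proof -
  from assms(4) obtain u where u: "0 < u" "u < 1" "z = (1 - u) *\<^sub>R s + u *\<^sub>R t"
    by (auto simp: in_segment)
  then have z: "Im z = (1 - u) * Im s + u * Im t"
    by simp
  have "0 \<le> (1 - u) * Im s" "0 \<le> u * Im t" "0 < (1 - u) * Im s \<or> 0 < u * Im t \<or> Im s = 0 \<and> Im t = 0"
    using u(1,2) assms(1,2) by (auto simp: strip_def zero_less_mult_iff)
  then show "0 < Im z"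
    using assms(3) z by (auto simp: same_edge_def)
  have "0 \<le> (1 - u) * (pi - Im s)" "0 \<le> u * (pi - Im t)"
    "0 < (1 - u) * (pi - Im s) \<or> 0 < u * (pi - Im t) \<or> Im s = pi \<and> Im t = pi"
    using u(1,2) assms(1,2) by (auto simp: strip_def zero_less_mult_iff)
  moreover have "pi - Im z = (1 - u) * (pi - Im s) + u * (pi - Im t)"
    using z by (simp add: algebra_simps)
  ultimately show "Im z < pi"
    using assms(3) by (auto simp: same_edge_def)
qed

lemma closed_segment_strip:
  assumes "s \<in> strip" "t \<in> strip" "z \<in> closed_segment s t"
  shows "z \<in> strip"
proof -
  have "strip = {t. Im t \<ge> 0} \<inter> {t. Im t \<le> pi}"
    by (auto simp: strip_def)
  then have "convex strip"
    using convex_halfspace_Im_ge convex_halfspace_Im_le by (metis convex_Int)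
  then show ?thesis
    using assms convex_contains_segment by blast
qed

text \<open>The fraction equals 1 - 1 / (1 + c * w), and inversion swaps the half-planes. With w =
  exp t it is the derivative of \<open>la\<close>.\<close>

lemma Im_frac_pos:
  assumes "c > 0" "Im w > 0"
  shows "Im (of_real c * w / (1 + of_real c * w)) > 0"
proof -
  let ?v = "1 + of_real c * w"
  have "?v \<noteq> 0"
    using assms by (simp add: complex_eq_iff)
  then have "of_real c * w / ?v = 1 - 1 / ?v"
    by (simp add: field_simps)
  moreover have "Im (1 / ?v) < 0"
    using assms \<open>?v \<noteq> 0\<close> by (simp add: Im_divide sum_power2_gt_zero_iff complex_eq_iff divide_neg_pos)
  ultimately show ?thesis
    by simp
qed

lemma interior_factor_nonzero:
  assumes "c \<ge> 0" "0 < Im t" "Im t < pi"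
  shows "1 + of_real c * exp t \<noteq> 0"
proof
  assume *: "1 + of_real c * exp t = 0"
  then have "c * Im (exp t) = 0"
    by (simp add: complex_eq_iff)
  then have "c = 0"
    using Im_exp_interior[OF assms(2,3)] by simp
  with * show False
    by simp
qed

lemma la_increment_pos:
  assumes "c > 0" "s \<in> strip" "t \<in> strip" "\<not> same_edge s t" "s \<noteq> t"
    and nz: "1 + of_real c * exp s \<noteq> 0" "1 + of_real c * exp t \<noteq> 0"
  shows "Im ((la c t - la c s) * cnj (t - s)) > 0"
proof (rule Im_increment_pos)
  note int = open_segment_interior[OF assms(2-4)]
  have "1 + of_real c * exp z \<noteq> 0" if "z \<in> closed_segment s t" for z
    using that nz int interior_factor_nonzero[of c z] \<open>c > 0\<close>
    by (cases "z \<in> open_segment s t") (auto simp: open_segment_def)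
  then show "continuous_on (closed_segment s t) (la c)"
    using closed_segment_strip[OF assms(2,3)] \<open>c > 0\<close> by (intro la_continuous) auto
  fix z assume z: "z \<in> open_segment s t"
  have "z \<in> strip"
    using int[OF z] by (simp add: strip_def)
  then show "(la c has_field_derivative of_real c * exp z / (1 + of_real c * exp z)) (at z)"
    using interior_factor_nonzero[of c z] int[OF z] \<open>c > 0\<close> by (intro la_has_derivative) auto
  show "Im (of_real c * exp z / (1 + of_real c * exp z)) > 0"
    by (rule Im_frac_pos[OF \<open>c > 0\<close>]) (use Im_exp_interior int[OF z] in blast)
qed fact

text \<open>On a common edge Im (t - s) = 0, so only the imaginary part of \<open>la\<close> counts.
  It vanishes on the lower edge and is a step function rising from 0 to pi on the upper one, hence
  only the weak inequality.\<close>

lemma la_increment_nonneg: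
  assumes "c \<ge> 0" "s \<in> strip" "t \<in> strip"
    and nz: "1 + of_real c * exp s \<noteq> 0" "1 + of_real c * exp t \<noteq> 0"
  shows "Im ((la c t - la c s) * cnj (t - s)) \<ge> 0"
proof (cases "same_edge s t")
  case True
  then have "Im (t - s) = 0"
    by (auto simp: same_edge_def)
  then have eq: "Im ((la c t - la c s) * cnj (t - s)) = (Im (la c t) - Im (la c s)) * (Re t - Re s)"
    by simp
  consider "Im s = 0" "Im t = 0" | "Im s = pi" "Im t = pi"
    using True by (auto simp: same_edge_def)
  then show ?thesis
  proof cases
    case 1
    then show ?thesis
      by (simp add: eq Im_la_bottom assms(1))
  next
    case 2
    have "c * exp (Re s) \<le> c * exp (Re t)" if "Re s \<le> Re t"
      using that assms(1) by (simp add: mult_left_mono)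
    moreover have "c * exp (Re t) \<le> c * exp (Re s)" if "Re t \<le> Re s"
      using that assms(1) by (simp add: mult_left_mono)
    ultimately show ?thesis
      unfolding eq Im_la_top[OF assms(1) 2(1) nz(1)] Im_la_top[OF assms(1) 2(2) nz(2)]
      by (cases "Re s \<le> Re t") (auto simp: zero_le_mult_iff)
  qed
next
  case False
  then show ?thesis
    using la_increment_pos[of c s t] assms la_0 by (cases "c = 0"; cases "s = t") auto
qed

definition lsum :: "(nat \<Rightarrow> real) \<Rightarrow> complex \<Rightarrow> complex" where
  "lsum c t = (\<Sum>\<nu>. la (c \<nu>) t)"

context nonneg_summable
begin

text \<open>The bound is uniform on the half-plane Re t \<le> R, as the M-test requires. It is
  claimed only eventually because finitely many coefficients may be too large for
  \<open>norm_la_le\<close>.\<close>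

lemma norm_la_eventually_le:
  "\<forall>\<^sub>F \<nu> in sequentially. \<forall>t. Re t \<le> R \<longrightarrow> norm (la (c \<nu>) t) \<le> 2 * (c \<nu> * exp R)"
proof -
  have "(\<lambda>\<nu>. c \<nu> * exp R) \<longlonglongrightarrow> 0 * exp R"
    by (intro tendsto_intros summable_LIMSEQ_zero summable_c)
  then have "\<forall>\<^sub>F \<nu> in sequentially. c \<nu> * exp R < 1/2"
    by (rule order_tendstoD(2)) simp
  then show ?thesis
  proof eventually_elim
    case (elim \<nu>)
    show ?case
    proof (intro allI impI)
      fix t :: complex
      assume "Re t \<le> R"
      then have "c \<nu> * exp (Re t) \<le> c \<nu> * exp R"
        using nonneg by (intro mult_left_mono) auto
      with elim show "norm (la (c \<nu>) t) \<le> 2 * (c \<nu> * exp R)"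
        using norm_la_le[OF nonneg, of \<nu> t] by linarith
    qed
  qed
qed

lemma summable_la: "summable (\<lambda>\<nu>. la (c \<nu>) t)"
proof (rule summable_comparison_test_ev)
  show "\<forall>\<^sub>F \<nu> in sequentially. norm (la (c \<nu>) t) \<le> 2 * (c \<nu> * exp (Re t))"
    using norm_la_eventually_le[of "Re t"] by eventually_elim auto
  show "summable (\<lambda>\<nu>. 2 * (c \<nu> * exp (Re t)))"
    by (intro summable_mult summable_mult2 summable_c)
qed

lemma lsum_sums: "(\<lambda>\<nu>. la (c \<nu>) t) sums lsum c t"
  unfolding lsum_def by (rule summable_sums[OF summable_la])

lemma exp_lsum:
  assumes "gprod c (exp t) \<noteq> 0"
  shows "exp (lsum c t) = gprod c (exp t)"
proof -
  have "exp (lsum c t) = (\<Prod>\<nu>. exp (la (c \<nu>) t))"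
    unfolding lsum_def by (rule prodinf_exp[symmetric, OF summable_la])
  also have "\<dots> = gprod c (exp t)"
    unfolding gprod_def by (intro prodinf_cong exp_la gprod_nonzeroD assms)
  finally show ?thesis .
qed

lemma norm_lsum_le:
  assumes "suminf c * exp (Re t) < 1/2"
  shows "norm (lsum c t) \<le> 2 * suminf c * exp (Re t)"
proof -
  have "c \<nu> \<le> suminf c" for \<nu>
    using sum_le_suminf[OF summable_c, of "{\<nu>}"] nonneg by simp
  then have "c \<nu> * exp (Re t) < 1/2" for \<nu>
    using assms by (meson exp_ge_zero le_less_trans mult_right_mono)
  then have "norm (la (c \<nu>) t) \<le> 2 * (c \<nu> * exp (Re t))" for \<nu>
    by (intro norm_la_le nonneg)
  then have "norm (lsum c t) \<le> (\<Sum>\<nu>. 2 * (c \<nu> * exp (Re t)))"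
    unfolding lsum_def by (intro norm_suminf_le summable_mult summable_mult2 summable_c)
  also have "\<dots> = 2 * suminf c * exp (Re t)"
    by (simp add: suminf_mult suminf_mult2[OF summable_c, symmetric] summable_mult2 summable_c)
  finally show ?thesis .
qed

text \<open>The M-test works on each half-plane Re t < R. These are open, and continuity is local,
  so it carries over to the whole domain. Continuity up to the edges is needed later for limit
  points lying there.\<close>

lemma lsum_continuous: "continuous_on {t \<in> strip. gprod c (exp t) \<noteq> 0} (lsum c)"
proof -
  let ?S = "{t \<in> strip. gprod c (exp t) \<noteq> 0}"
  have bounded: "continuous_on (?S \<inter> {t. Re t < R}) (lsum c)" for R
  proof (rule uniform_limit_theorem[where f = "\<lambda>n t. \<Sum>\<nu><n. la (c \<nu>) t" and F = sequentially])
    show "uniform_limit (?S \<inter> {t. Re t < R}) (\<lambda>n t. \<Sum>\<nu><n. la (c \<nu>) t) (lsum c) sequentially"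
      unfolding lsum_def
    proof (rule Weierstrass_m_test_ev)
      show "\<forall>\<^sub>F \<nu> in sequentially. \<forall>t\<in>?S \<inter> {t. Re t < R}. norm (la (c \<nu>) t) \<le> 2 * (c \<nu> * exp R)"
        using norm_la_eventually_le[of R] by eventually_elim auto
      show "summable (\<lambda>\<nu>. 2 * (c \<nu> * exp R))"
        by (intro summable_mult summable_mult2 summable_c)
    qed
    show "\<forall>\<^sub>F n in sequentially. continuous_on (?S \<inter> {t. Re t < R}) (\<lambda>t. \<Sum>\<nu><n. la (c \<nu>) t)"
      by (intro always_eventually allI continuous_on_sum la_continuous nonneg)
         (use gprod_nonzeroD in auto)
  qed simp
  show ?thesis
    unfolding continuous_on_eq_continuous_within
  proof
    fix t assume t: "t \<in> ?S"
    have "continuous (at t within ?S \<inter> {u. Re u < Re t + 1}) (lsum c)"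
      using bounded[of "Re t + 1"] t by (simp add: continuous_on_eq_continuous_within)
    moreover have "at t within ?S \<inter> {u. Re u < Re t + 1} = at t within ?S"
      by (rule at_within_nhd[where S = "{u. Re u < Re t + 1}"])
         (auto simp: open_halfspace_Re_lt)
    ultimately show "continuous (at t within ?S) (lsum c)"
      by simp
  qed
qed

lemma lsum_increment_sums:
  "(\<lambda>\<nu>. Im ((la (c \<nu>) t - la (c \<nu>) s) * cnj (t - s))) sums
    Im ((lsum c t - lsum c s) * cnj (t - s))"
  by (intro sums_Im sums_mult2 sums_diff lsum_sums)

lemma lsum_increment_nonneg:
  assumes "s \<in> strip" "t \<in> strip" "gprod c (exp s) \<noteq> 0" "gprod c (exp t) \<noteq> 0"
  shows "Im ((lsum c t - lsum c s) * cnj (t - s)) \<ge> 0"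
  by (rule sums_le[OF _ sums_zero lsum_increment_sums])
     (intro la_increment_nonneg nonneg gprod_nonzeroD assms)

lemma lsum_increment_pos:
  assumes "s \<in> strip" "t \<in> strip" "gprod c (exp s) \<noteq> 0" "gprod c (exp t) \<noteq> 0"
    and "c \<mu> > 0" "s \<noteq> t" "\<not> same_edge s t"
  shows "Im ((lsum c t - lsum c s) * cnj (t - s)) > 0"
proof -
  let ?f = "\<lambda>\<nu>. Im ((la (c \<nu>) t - la (c \<nu>) s) * cnj (t - s))"
  have "?f \<nu> \<ge> 0" for \<nu>
    by (intro la_increment_nonneg nonneg gprod_nonzeroD assms)
  moreover have "?f \<mu> > 0"
    by (intro la_increment_pos gprod_nonzeroD assms)
  ultimately show ?thesis
    using suminf_pos2[of ?f \<mu>] lsum_increment_sums[of t s] by (simp add: sums_iff)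
qed

text \<open>Every factor has a nonnegative argument on the strip, so each single one bounds the sum
  from below.\<close>

lemma Im_lsum_ge_la:
  assumes "t \<in> strip" "gprod c (exp t) \<noteq> 0"
  shows "Im (la (c \<mu>) t) \<le> Im (lsum c t)"
proof -
  have "(\<lambda>\<nu>. Im (la (c \<nu>) t)) sums Im (lsum c t)"
    by (intro sums_Im lsum_sums)
  then show ?thesis
    using sum_le_suminf[of "\<lambda>\<nu>. Im (la (c \<nu>) t)" "{\<mu>}"]
      Im_la_nonneg[OF nonneg assms(1) gprod_nonzeroD[OF assms(2)]]
    by (simp add: sums_iff)
qed

lemma Im_lsum_nonneg:
  assumes "t \<in> strip" "gprod c (exp t) \<noteq> 0"
  shows "0 \<le> Im (lsum c t)"
  using Im_lsum_ge_la[OF assms, of 0] Im_la_nonneg[OF nonneg assms(1) gprod_nonzeroD[OF assms(2)]]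
    order_trans by blast

lemma Im_lsum_bottom:
  assumes "Im t = 0"
  shows "Im (lsum c t) = 0"
  using sums_Im[OF lsum_sums[of t]] Im_la_bottom[OF nonneg assms] by (simp add: sums_iff)

text \<open>The coefficients tend to 0. Without finiteness \<open>card\<close> would return the
  default 0; with it, \<open>card\<close> counts the zeros passed on the upper edge, and the value 0
  does mean that none was passed.\<close>

lemma finite_large_factors: "finite {\<nu>. c \<nu> * exp x > 1}"
proof -
  have "(\<lambda>\<nu>. c \<nu> * exp x) \<longlonglongrightarrow> 0 * exp x"
    by (intro tendsto_intros summable_LIMSEQ_zero summable_c)
  then have "\<forall>\<^sub>F \<nu> in sequentially. c \<nu> * exp x < 1"
    by (rule order_tendstoD(2)) simp
  then obtain N where "\<And>\<nu>. \<nu> \<ge> N \<Longrightarrow> c \<nu> * exp x < 1"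
    by (auto simp: eventually_sequentially)
  then have "{\<nu>. c \<nu> * exp x > 1} \<subseteq> {..<N}"
    by (force simp: not_le[symmetric])
  then show ?thesis
    using finite_subset by blast
qed

lemma Im_lsum_top:
  assumes "Im t = pi" "gprod c (exp t) \<noteq> 0"
  shows "Im (lsum c t) = pi * real (card {\<nu>. c \<nu> * exp (Re t) > 1})"
proof -
  let ?L = "{\<nu>. c \<nu> * exp (Re t) > 1}"
  have "(\<lambda>\<nu>. Im (la (c \<nu>) t)) sums (\<Sum>\<nu>\<in>?L. Im (la (c \<nu>) t))"
    by (rule sums_finite)
       (auto simp: finite_large_factors Im_la_top[OF nonneg assms(1) gprod_nonzeroD[OF assms(2)]])
  also have "(\<Sum>\<nu>\<in>?L. Im (la (c \<nu>) t)) = pi * real (card ?L)"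
    by (simp add: Im_la_top[OF nonneg assms(1) gprod_nonzeroD[OF assms(2)]])
  finally show ?thesis
    using sums_Im[OF lsum_sums[of t]] sums_unique2 by blast
qed

lemma gprod_interior_nonzero: "0 < Im t \<Longrightarrow> Im t < pi \<Longrightarrow> gprod c (exp t) \<noteq> 0"
  using gprod_eq_0_iff interior_factor_nonzero nonneg by blast

lemma gprod_bottom_nonzero:
  assumes "Im t = 0"
  shows "gprod c (exp t) \<noteq> 0"
proof -
  have "Re (1 + of_real (c \<nu>) * exp t) > 0" for \<nu>
    using nonneg[of \<nu>] assms by (simp add: Re_exp add_pos_nonneg)
  then show ?thesis
    unfolding gprod_eq_0_iff by (metis less_irrefl zero_complex.sel(1))
qed

lemma gprod_top_eq_0_iff:
  assumes "Im t = pi"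
  shows "gprod c (exp t) = 0 \<longleftrightarrow> (\<exists>\<nu>. c \<nu> * exp (Re t) = 1)"
  unfolding gprod_eq_0_iff using assms by (auto simp: complex_eq_iff Re_exp Im_exp)

end

section \<open>The logarithm of F in logarithmic coordinates\<close>

text \<open>In the coordinate t with z ^ k = exp t, a sector of opening pi / k becomes the strip. The
  reflection below replaces exp t by its negative conjugate, and so turns the factors of the
  denominator into factors of the same kind as those of the numerator.\<close>

definition reflect :: "complex \<Rightarrow> complex" where
  "reflect t = \<i> * of_real pi + cnj t"

lemma exp_reflect: "exp (reflect t) = - cnj (exp t)"
  by (simp add: reflect_def exp_add exp_cnj)

lemma reflect_strip: "t \<in> strip \<Longrightarrow> reflect t \<in> strip"
  by (simp add: strip_def reflect_def)

lemma Re_reflect [simp]: "Re (reflect t) = Re t"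
  and Im_reflect [simp]: "Im (reflect t) = pi - Im t"
  by (simp_all add: reflect_def)

text \<open>\<open>c\<close> belongs to the numerator, \<open>d\<close> to the denominator. The
  conditions on \<open>c 0\<close> and \<open>d 0\<close> say that both products have a genuine
  factor: the former makes the increment inequality strict, the latter provides a pole on the lower
  edge.\<close>

locale pf_function =
  C: nonneg_summable c + D: nonneg_summable d for c d :: "nat \<Rightarrow> real" +
  fixes k p :: nat and A :: real
  assumes k_ge_2: "k \<ge> 2" and p_pos: "p > 0" and coprime_p_k: "coprime p k" and A_nonneg: "A \<ge> 0"
    and c_pos: "c 0 > 0" and d_pos: "d 0 > 0"
begin

definition \<eta> :: real where
  "\<eta> = real p / real k"

definition num :: "complex \<Rightarrow> complex" where
  "num t = exp (of_real \<eta> * t + of_real A * exp t) * gprod c (exp t)"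

definition den :: "complex \<Rightarrow> complex" where
  "den t = gprod d (- exp t)"

definition regular :: "complex \<Rightarrow> bool" where
  "regular t \<longleftrightarrow> t \<in> strip \<and> num t \<noteq> 0 \<and> den t \<noteq> 0"

text \<open>The last term is a branch of - log \<open>den\<close>. Negation and conjugation together
  reverse only the real part, so all terms enter the argument with a plus sign.\<close>

definition logF :: "complex \<Rightarrow> complex" where
  "logF t = of_real \<eta> * t + of_real A * exp t + lsum c t - cnj (lsum d (reflect t))"

lemma \<eta>_pos: "\<eta> > 0"
  using p_pos k_ge_2 by (simp add: \<eta>_def)

lemma gprod_d_reflect: "gprod d (exp (reflect t)) = cnj (den t)"
  by (simp add: exp_reflect den_def flip: D.gprod_cnj)

lemma regularD:
  assumes "regular t"
  shows "t \<in> strip" "gprod c (exp t) \<noteq> 0" "gprod d (exp (reflect t)) \<noteq> 0"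
  using assms by (auto simp: regular_def num_def gprod_d_reflect)

lemma exp_logF:
  assumes "regular t"
  shows "exp (logF t) = num t / den t"
proof -
  have "exp (logF t) = exp (of_real \<eta> * t + of_real A * exp t) * exp (lsum c t) /
      cnj (exp (lsum d (reflect t)))"
    by (simp add: logF_def exp_diff exp_add exp_cnj)
  then show ?thesis
    using regularD[OF assms] by (simp add: C.exp_lsum D.exp_lsum num_def gprod_d_reflect)
qed

lemma regular_interior:
  assumes "0 < Im t" "Im t < pi"
  shows "regular t"
  using assms C.gprod_interior_nonzero[of t] D.gprod_interior_nonzero[of "reflect t"]
  by (simp add: regular_def num_def strip_def gprod_d_reflect)

lemma regular_bottom_iff:
  assumes "Im t = 0"
  shows "regular t \<longleftrightarrow> (\<forall>\<nu>. d \<nu> * exp (Re t) \<noteq> 1)"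
  using assms C.gprod_bottom_nonzero[of t] D.gprod_top_eq_0_iff[of "reflect t"]
  by (simp add: regular_def num_def strip_def gprod_d_reflect)

lemma regular_top_iff:
  assumes "Im t = pi"
  shows "regular t \<longleftrightarrow> (\<forall>\<nu>. c \<nu> * exp (Re t) \<noteq> 1)"
  using assms D.gprod_bottom_nonzero[of "reflect t"] C.gprod_top_eq_0_iff[of t]
  by (simp add: regular_def num_def strip_def gprod_d_reflect)

text \<open>Zeros of \<open>num\<close> lie only on the upper edge, zeros of \<open>den\<close> only
  on the lower one.\<close>

lemma num_or_den_nonzero:
  assumes "t \<in> strip"
  shows "num t \<noteq> 0 \<or> den t \<noteq> 0"
proof -
  consider "0 < Im t" "Im t < pi" | "Im t = 0" | "Im t = pi"
    using assms by (force simp: strip_def)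
  then show ?thesis
  proof cases
    case 1
    then show ?thesis
      using regular_interior by (simp add: regular_def)
  next
    case 2
    then show ?thesis
      using C.gprod_bottom_nonzero by (simp add: num_def)
  next
    case 3
    then show ?thesis
      using D.gprod_bottom_nonzero[of "reflect t"] by (simp add: gprod_d_reflect)
  qed
qed

lemma logF_continuous: "continuous_on {t. regular t} logF"
proof -
  have "continuous_on {t. regular t} (lsum c)"
    by (rule continuous_on_subset[OF C.lsum_continuous]) (use regularD in auto)
  moreover have "continuous_on {t. regular t} (\<lambda>t. lsum d (reflect t))"
    by (rule continuous_on_compose2[OF D.lsum_continuous])
       (use regularD reflect_strip in \<open>auto simp: reflect_def intro!: continuous_intros\<close>)
  ultimately show ?thesis
    unfolding logF_def by (intro continuous_intros)
qed

text \<open>The linear term drops out because \<eta> is real. In the last term, the negation and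
  conjugation in \<open>logF\<close> are absorbed by the conjugation that \<open>reflect\<close>
  applies to t - s.\<close>

lemma logF_increment:
  "Im ((logF t - logF s) * cnj (t - s)) = A * Im ((exp t - exp s) * cnj (t - s)) +
    Im ((lsum c t - lsum c s) * cnj (t - s)) +
    Im ((lsum d (reflect t) - lsum d (reflect s)) * cnj (reflect t - reflect s))"
  by (simp add: logF_def reflect_def algebra_simps)

lemma exp_increment_nonneg:
  assumes "s \<in> strip" "t \<in> strip"
  shows "Im ((exp t - exp s) * cnj (t - s)) \<ge> 0"
proof (cases "s = t \<or> same_edge s t")
  case True
  then show ?thesis
    by (auto simp: same_edge_def Im_exp)
next
  case False
  then have "Im ((exp t - exp s) * cnj (t - s)) > 0"
    by (intro Im_increment_pos[where f' = exp])
       (use open_segment_interior[OF assms] in \<open>auto intro!: continuous_intros DERIV_exp Im_exp_interior\<close>)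
  then show ?thesis
    by simp
qed

lemma logF_increment_nonneg:
  assumes "regular s" "regular t"
  shows "Im ((logF t - logF s) * cnj (t - s)) \<ge> 0"
  unfolding logF_increment
  by (intro add_nonneg_nonneg mult_nonneg_nonneg A_nonneg exp_increment_nonneg
      C.lsum_increment_nonneg D.lsum_increment_nonneg reflect_strip regularD assms)

text \<open>Strictness is supplied by the factor with coefficient \<open>c 0\<close>.\<close>

lemma logF_increment_pos:
  assumes "regular s" "regular t" "s \<noteq> t" "\<not> same_edge s t"
  shows "Im ((logF t - logF s) * cnj (t - s)) > 0"
  unfolding logF_increment
  by (intro add_pos_nonneg add_nonneg_pos mult_nonneg_nonneg A_nonneg exp_increment_nonneg
      C.lsum_increment_pos[OF _ _ _ _ c_pos] D.lsum_increment_nonneg reflect_strip regularD assms)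

lemma increment_Im_mult:
  "Im ((logF t - logF s) * cnj (t - s)) =
    (Im (logF t) - Im (logF s)) * (Re t - Re s) - (Re (logF t) - Re (logF s)) * (Im t - Im s)"
  by (simp add: algebra_simps)

text \<open>Equal real parts of \<open>logF\<close> leave only dV * dx \<ge> 0. The case dx = 0 is
  excluded because two distinct points with the same real part never share an edge, so the strict
  inequality applies to them.\<close>

lemma level_Re_less:
  assumes "regular s" "regular t" "Re (logF s) = Re (logF t)" "Im (logF s) < Im (logF t)"
  shows "Re s < Re t"
proof -
  have "(Im (logF t) - Im (logF s)) * (Re t - Re s) \<ge> 0"
    using logF_increment_nonneg[OF assms(1,2)] assms(3) by (simp add: increment_Im_mult)
  then have le: "Re s \<le> Re t"
    using assms(4) by (simp add: zero_le_mult_iff)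
  have "Re s \<noteq> Re t"
  proof
    assume eq: "Re s = Re t"
    have "s \<noteq> t"
      using assms(4) by auto
    then have "\<not> same_edge s t"
      using eq by (auto simp: same_edge_def complex_eq_iff)
    then show False
      using logF_increment_pos[OF assms(1,2) \<open>s \<noteq> t\<close>] eq assms(3) by (simp add: increment_Im_mult)
  qed
  with le show ?thesis
    by simp
qed

lemma level_unique:
  assumes "regular s" "regular t" "logF s = logF t" "\<not> same_edge s t"
  shows "s = t"
  using logF_increment_pos[OF assms(1,2) _ assms(4)] assms(3) by force

lemma Im_logF_strict_mono:
  assumes "0 < \<theta>" "\<theta> < pi" "x < y"
  shows "Im (logF (Complex x \<theta>)) < Im (logF (Complex y \<theta>))"
proof -
  have "Im ((logF (Complex y \<theta>) - logF (Complex x \<theta>)) * cnj (Complex y \<theta> - Complex x \<theta>)) > 0"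
    using assms by (intro logF_increment_pos regular_interior) (auto simp: same_edge_def)
  then have "(Im (logF (Complex y \<theta>)) - Im (logF (Complex x \<theta>))) * (y - x) > 0"
    unfolding increment_Im_mult by simp
  then show ?thesis
    using assms(3) by (simp add: zero_less_mult_iff)
qed

lemma Im_logF: "Im (logF t) = \<eta> * Im t + A * Im (exp t) + Im (lsum c t) + Im (lsum d (reflect t))"
  by (simp add: logF_def)

lemma Im_logF_bottom:
  assumes "Im t = 0" "regular t"
  shows "Im (logF t) = pi * real (card {\<nu>. d \<nu> * exp (Re t) > 1})"
  using assms regularD[OF assms(2)] D.Im_lsum_top[of "reflect t"]
  by (simp add: Im_logF Im_exp C.Im_lsum_bottom)

lemma Im_logF_top:
  assumes "Im t = pi" "regular t"
  shows "Im (logF t) = \<eta> * pi + pi * real (card {\<nu>. c \<nu> * exp (Re t) > 1})"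
  using assms regularD[OF assms(2)] D.Im_lsum_bottom[of "reflect t"]
  by (simp add: Im_logF Im_exp C.Im_lsum_top)

lemma Im_logF_ge:
  assumes "regular t"
  shows "\<eta> * Im t \<le> Im (logF t)"
  using regularD[OF assms] Im_exp_strip[of t] A_nonneg
  by (simp add: Im_logF C.Im_lsum_nonneg D.Im_lsum_nonneg reflect_strip)

lemma Im_logF_nonneg:
  assumes "regular t"
  shows "0 \<le> Im (logF t)"
proof -
  have "0 \<le> \<eta> * Im t"
    using regularD(1)[OF assms] \<eta>_pos by (simp add: strip_def)
  then show ?thesis
    using Im_logF_ge[OF assms] by linarith
qed

lemma Im_logF_gt:
  assumes "0 < Im t" "Im t < pi"
  shows "\<eta> * Im t < Im (logF t)"
proof -
  \<comment> \<open>Strictness comes from comparison with a point further left at the same height;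
    the distance 1 is arbitrary.\<close>
  have "\<eta> * Im t \<le> Im (logF (Complex (Re t - 1) (Im t)))"
    using Im_logF_ge[of "Complex (Re t - 1) (Im t)"] regular_interior assms by simp
  also have "\<dots> < Im (logF (Complex (Re t) (Im t)))"
    by (rule Im_logF_strict_mono) (use assms in auto)
  finally show ?thesis
    by simp
qed

text \<open>Constant of the error term at the left end: A from the exponential and, by
  \<open>norm_lsum_le\<close>, twice the coefficient sum from each product.\<close>

definition K where "K = A + 2 * suminf c + 2 * suminf d"

text \<open>In the variable z: near the origin \<open>F\<close> behaves like z^p, uniformly in the
  direction.\<close>

lemma logF_asymp_left:
  assumes "(suminf c + suminf d) * exp (Re t) < 1/2"
  shows "norm (logF t - of_real \<eta> * t) \<le> K * exp (Re t)"
proof -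
  have "suminf c \<ge> 0" "suminf d \<ge> 0"
    using C.nonneg D.nonneg by (auto intro!: suminf_nonneg C.summable_c D.summable_c)
  then have "suminf c * exp (Re t) \<ge> 0" "suminf d * exp (Re t) \<ge> 0"
    by simp_all
  then have "suminf c * exp (Re t) < 1/2" "suminf d * exp (Re t) < 1/2"
    using assms unfolding distrib_right by linarith+
  then have "norm (lsum c t) \<le> 2 * suminf c * exp (Re t)"
    "norm (cnj (lsum d (reflect t))) \<le> 2 * suminf d * exp (Re t)"
    using C.norm_lsum_le[of t] D.norm_lsum_le[of "reflect t"] by simp_all
  moreover have "norm (of_real A * exp t) = A * exp (Re t)"
    using A_nonneg by (simp add: norm_mult norm_exp_eq_Re)
  moreover have "logF t - of_real \<eta> * t = of_real A * exp t + lsum c t - cnj (lsum d (reflect t))"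
    by (simp add: logF_def)
  then have "norm (logF t - of_real \<eta> * t) \<le>
      norm (of_real A * exp t) + norm (lsum c t) + norm (cnj (lsum d (reflect t)))"
    using norm_triangle_ineq4[of "of_real A * exp t + lsum c t" "cnj (lsum d (reflect t))"]
      norm_triangle_ineq[of "of_real A * exp t" "lsum c t"] by simp
  ultimately show ?thesis
    by (simp add: K_def distrib_right)
qed

text \<open>Far to the right, the first factor of the numerator and the first factor of the denominator
  contribute together almost \<^term>\<open>pi\<close> to the argument; the bound is uniform down to the lower edge.\<close>

lemma Im_la_slope:
  assumes "e > 0" "e * exp x > 1" "0 < \<theta>" "\<theta> < pi"
  shows "\<bar>Im (la e (Complex x \<theta>)) - \<theta>\<bar> \<le> \<theta> / (e * exp x - 1)"
    and "\<bar>Im (la e (Complex x (pi - \<theta>))) - (pi - \<theta>)\<bar> \<le> \<theta> / (e * exp x - 1)"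
proof -
  \<comment> \<open>\<open>h\<close> is the deviation of the argument from that of exp t. It
    vanishes at heights 0 and pi, and its derivative \<open>h'\<close> is small, so the mean value
    theorem from the nearer end gives a bound proportional to \<theta>.\<close>
  define h where "h y = Im (la e (Complex x y)) - y" for y
  define h' where "h' y = - Re (1 / (1 + of_real e * exp (Complex x y)))" for y
  have far: "norm (1 + of_real e * exp (Complex x y)) \<ge> e * exp x - 1" for y
    using norm_triangle_ineq2[of "of_real e * exp (Complex x y)" "- 1"] \<open>e > 0\<close>
    by (simp add: norm_mult norm_exp_eq_Re add.commute)
  then have nz: "1 + of_real e * exp (Complex x y) \<noteq> 0" for y
    using assms(2) by (metis diff_gt_0_iff_gt norm_zero not_le)
  have der: "(h has_real_derivative h' y) (at y)" if y: "0 \<le> y" "y \<le> pi" for y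
  proof -
    let ?w = "of_real e * exp (Complex x y)"
    have "((\<lambda>y. of_real x + of_real y * \<i>) has_vector_derivative \<i>) (at y)"
      by (auto simp: has_vector_derivative_def scaleR_conv_of_real intro!: derivative_eq_intros)
    then have "(Complex x has_vector_derivative \<i>) (at y)"
      by (simp add: Complex_eq[abs_def] mult.commute)
    from field_vector_diff_chain_at[OF this la_has_derivative[of e "Complex x y"]]
    have "((\<lambda>y. la e (Complex x y)) has_vector_derivative \<i> * (?w / (1 + ?w))) (at y)"
      using nz y \<open>e > 0\<close> by (simp add: o_def strip_def)
    then have "((\<lambda>y. Im (la e (Complex x y))) has_vector_derivative Im (\<i> * (?w / (1 + ?w)))) (at y)"
      by (rule bounded_linear.has_vector_derivative[OF bounded_linear_Im])
    then have "(h has_real_derivative Im (\<i> * (?w / (1 + ?w))) - 1) (at y)"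
      unfolding h_def has_real_derivative_iff_has_vector_derivative[symmetric]
      by (intro DERIV_diff DERIV_ident)
    moreover have "?w / (1 + ?w) = 1 - 1 / (1 + ?w)"
      using nz[of y] by (simp add: field_simps)
    then have "Im (\<i> * (?w / (1 + ?w))) - 1 = h' y"
      by (simp add: h'_def)
    ultimately show ?thesis
      by simp
  qed
  have h': "\<bar>h' y\<bar> \<le> 1 / (e * exp x - 1)" for y
  proof -
    have "\<bar>h' y\<bar> \<le> norm (1 / (1 + of_real e * exp (Complex x y)))"
      unfolding h'_def using abs_Re_le_cmod by (metis abs_minus_cancel)
    also have "\<dots> \<le> 1 / (e * exp x - 1)"
      using far[of y] assms(2) by (simp add: norm_divide divide_simps)
    finally show ?thesis .
  qed
  have mvt: "\<bar>h b - h a\<bar> \<le> (b - a) / (e * exp x - 1)" if ab: "0 \<le> a" "a < b" "b \<le> pi" for a b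
  proof -
    obtain z where "h b - h a = (b - a) * h' z"
      using MVT2[OF ab(2), of h h'] der ab by force
    then have "\<bar>h b - h a\<bar> = (b - a) * \<bar>h' z\<bar>"
      using ab(2) by (simp add: abs_mult)
    also have "\<dots> \<le> (b - a) * (1 / (e * exp x - 1))"
      using ab(2) h' by (intro mult_left_mono) auto
    finally show ?thesis
      by simp
  qed
  have "h 0 = 0"
    using Im_la_bottom[of e "Complex x 0"] \<open>e > 0\<close> by (simp add: h_def)
  then show "\<bar>Im (la e (Complex x \<theta>)) - \<theta>\<bar> \<le> \<theta> / (e * exp x - 1)"
    using mvt[of 0 \<theta>] assms by (simp add: h_def)
  have "h pi = 0"
    using Im_la_top[of e "Complex x pi"] nz[of pi] assms by (simp add: h_def)
  then have "\<bar>h (pi - \<theta>)\<bar> \<le> \<theta> / (e * exp x - 1)"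
    using mvt[of "pi - \<theta>" pi] assms by simp
  then show "\<bar>Im (la e (Complex x (pi - \<theta>))) - (pi - \<theta>)\<bar> \<le> \<theta> / (e * exp x - 1)"
    by (simp only: h_def)
qed

text \<open>The first numerator factor contributes about \<theta>, the first denominator factor
  about pi - \<theta>. The total error is at most \<eta> * \<theta> / 2 and is beaten by the linear
  term \<eta> * \<theta>; this needs errors proportional to \<theta>, since \<theta> may be
  arbitrarily small.\<close>

lemma Im_logF_large:
  obtains x where "\<And>\<theta>. 0 < \<theta> \<Longrightarrow> \<theta> < pi \<Longrightarrow> Im (logF (Complex x \<theta>)) > pi"
proof
  define m where "m = min (c 0) (d 0)"
  \<comment> \<open>Chosen so that \<open>m * exp x - 1\<close> = 4 / \<eta>, which makes each of
    the two errors at most \<eta> * \<theta> / 4.\<close>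
  define x where "x = ln ((1 + 4 / \<eta>) / m)"
  have "m > 0"
    using c_pos d_pos by (simp add: m_def)
  then have m: "m * exp x = 1 + 4 / \<eta>"
    using \<eta>_pos by (simp add: x_def add_pos_pos)
  have "m * exp x \<le> c 0 * exp x" "m * exp x \<le> d 0 * exp x"
    by (simp_all add: m_def)
  then have large: "c 0 * exp x - 1 \<ge> 4 / \<eta>" "d 0 * exp x - 1 \<ge> 4 / \<eta>"
    using m by linarith+
  fix \<theta> assume \<theta>: "0 < \<theta>" "\<theta> < pi"
  have bound: "\<theta> / (e - 1) \<le> \<eta> * \<theta> / 4" if "e - 1 \<ge> 4 / \<eta>" for e
  proof -
    have "\<theta> / (e - 1) \<le> \<theta> / (4 / \<eta>)"
      using that \<theta> \<eta>_pos zero_less_divide_iff[of 4 \<eta>]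
      by (intro divide_left_mono mult_pos_pos) linarith+
    then show ?thesis
      by (simp add: mult.commute)
  qed
  have gt1: "c 0 * exp x > 1" "d 0 * exp x > 1"
    using large \<eta>_pos zero_less_divide_iff[of 4 \<eta>] by linarith+
  let ?t = "Complex x \<theta>"
  have reg: "regular ?t"
    using \<theta> by (simp add: regular_interior)
  have refl: "reflect ?t = Complex x (pi - \<theta>)"
    by (simp add: complex_eq_iff)
  have "Im (la (c 0) ?t) \<ge> \<theta> - \<eta> * \<theta> / 4"
    using Im_la_slope(1)[OF c_pos gt1(1) \<theta>] bound[OF large(1)] by linarith
  moreover have "Im (la (d 0) (reflect ?t)) \<ge> pi - \<theta> - \<eta> * \<theta> / 4"
    using Im_la_slope(2)[OF d_pos gt1(2) \<theta>] bound[OF large(2)] unfolding refl by linarith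
  moreover have "Im (la (c 0) ?t) \<le> Im (lsum c ?t)" "Im (la (d 0) (reflect ?t)) \<le> Im (lsum d (reflect ?t))"
    by (intro C.Im_lsum_ge_la D.Im_lsum_ge_la reflect_strip regularD reg)+
  moreover have "A * Im (exp ?t) \<ge> 0"
    by (intro mult_nonneg_nonneg A_nonneg Im_exp_strip regularD reg)
  ultimately have "Im (logF ?t) \<ge> pi + \<eta> * \<theta> / 2"
    unfolding Im_logF by simp
  moreover have "\<eta> * \<theta> > 0"
    using \<eta>_pos \<theta> by simp
  ultimately show "Im (logF ?t) > pi"
    by linarith
qed

end

text \<open>The largest coefficient belongs to the zero or pole closest to the origin.\<close>

lemma (in nonneg_summable) attains_max:
  assumes "c 0 > 0"
  obtains \<mu> where "c \<mu> > 0" "\<And>\<nu>. c \<nu> \<le> c \<mu>"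
proof -
  \<comment> \<open>The exponential is 2 / c 0, so \<open>S\<close> consists of the indices with c
    \<nu> > c 0 / 2. It is finite and contains 0.\<close>
  define S where "S = {\<nu>. c \<nu> * exp (ln (2 / c 0)) > 1}"
  have S: "finite S" "0 \<in> S"
    unfolding S_def by (rule finite_large_factors) (use assms in simp)
  then have "Max (c ` S) \<in> c ` S"
    by (intro Max_in) auto
  then obtain \<mu> where "\<mu> \<in> S" "c \<mu> = Max (c ` S)"
    by auto
  then have \<mu>: "\<mu> \<in> S" "\<And>\<nu>. \<nu> \<in> S \<Longrightarrow> c \<nu> \<le> c \<mu>"
    using S(1) by auto
  have "c \<nu> \<le> c \<mu>" if "\<nu> \<notin> S" for \<nu>
  proof -
    have "c \<nu> * exp (ln (2 / c 0)) \<le> c \<mu> * exp (ln (2 / c 0))"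
      using that \<mu>(1) unfolding S_def mem_Collect_eq by linarith
    then show ?thesis
      by (simp only: mult_le_cancel_right) simp
  qed
  moreover have "c \<mu> > 0"
    using \<mu>(2)[OF S(2)] assms by linarith
  ultimately show thesis
    using that \<mu> by metis
qed

section \<open>The sign of |F| - \<rho> on the strip\<close>

context pf_function
begin

text \<open>|F| - \<rho>, multiplied by |den|. In this form it is continuous across zeros, where it
  is negative for \<rho> > 0, and across poles, where it is positive; so the intermediate value
  theorem applies along whole edges.\<close>

definition \<Psi> :: "real \<Rightarrow> complex \<Rightarrow> real" where
  "\<Psi> \<rho> t = norm (num t) - \<rho> * norm (den t)"

lemma \<Psi>_continuous: "continuous_on S (\<Psi> \<rho>)"
proof -
  have "num holomorphic_on UNIV" "den holomorphic_on UNIV"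
    unfolding num_def den_def
    by (intro holomorphic_intros C.gprod_holomorphic D.gprod_holomorphic)+
  then have "continuous_on UNIV num" "continuous_on UNIV den"
    by (auto intro: holomorphic_on_imp_continuous_on)
  then have "continuous_on UNIV (\<Psi> \<rho>)"
    unfolding \<Psi>_def by (intro continuous_intros)
  then show ?thesis
    using continuous_on_subset by blast
qed

lemma \<Psi>_regular:
  assumes "regular t"
  shows "\<Psi> \<rho> t = norm (den t) * (exp (Re (logF t)) - \<rho>)"
proof -
  have "exp (Re (logF t)) = norm (num t / den t)"
    using exp_logF[OF assms] norm_exp_eq_Re by metis
  then show ?thesis
    using assms by (simp add: \<Psi>_def norm_divide regular_def field_simps)
qed

lemma \<Psi>_less_0_iff: "regular t \<Longrightarrow> \<rho> > 0 \<Longrightarrow> \<Psi> \<rho> t < 0 \<longleftrightarrow> Re (logF t) < ln \<rho>"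
  and \<Psi>_eq_0_iff: "regular t \<Longrightarrow> \<rho> > 0 \<Longrightarrow> \<Psi> \<rho> t = 0 \<longleftrightarrow> Re (logF t) = ln \<rho>"
proof -
  assume *: "regular t" "\<rho> > 0"
  then have "norm (den t) > 0"
    by (simp add: regular_def)
  moreover have "exp (Re (logF t)) < \<rho> \<longleftrightarrow> Re (logF t) < ln \<rho>"
    using *(2) by (metis exp_less_cancel_iff exp_ln)
  moreover have "exp (Re (logF t)) = \<rho> \<longleftrightarrow> Re (logF t) = ln \<rho>"
    using *(2) by auto
  ultimately show "\<Psi> \<rho> t < 0 \<longleftrightarrow> Re (logF t) < ln \<rho>" "\<Psi> \<rho> t = 0 \<longleftrightarrow> Re (logF t) = ln \<rho>"
    by (auto simp: \<Psi>_regular[OF *(1)] mult_less_0_iff)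
qed

lemma \<Psi>_pole: "t \<in> strip \<Longrightarrow> den t = 0 \<Longrightarrow> \<Psi> \<rho> t > 0"
  using num_or_den_nonzero by (auto simp: \<Psi>_def)

lemma \<Psi>_zero: "t \<in> strip \<Longrightarrow> num t = 0 \<Longrightarrow> \<rho> > 0 \<Longrightarrow> \<Psi> \<rho> t < 0"
  using num_or_den_nonzero by (auto simp: \<Psi>_def)

lemma regular_if_\<Psi>_0:
  assumes "t \<in> strip" "\<rho> > 0" "\<Psi> \<rho> t = 0"
  shows "regular t"
  using assms \<Psi>_pole[of t \<rho>] \<Psi>_zero[of t \<rho>] by (force simp: regular_def)

lemma left_bounds:
  assumes "\<epsilon> > 0"
  obtains x where "x \<le> y" "K * exp x < \<epsilon>" "(suminf c + suminf d) * exp x < 1/2"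
proof -
  have lim: "((\<lambda>x. r * exp x) \<longlongrightarrow> r * 0) at_bot" for r :: real
    by (intro tendsto_intros exp_at_bot)
  have "\<forall>\<^sub>F x in at_bot. K * exp x < \<epsilon>" "\<forall>\<^sub>F x in at_bot. (suminf c + suminf d) * exp x < 1/2"
    by (rule order_tendstoD(2)[OF lim]; simp add: assms)+
  moreover have "\<forall>\<^sub>F x in at_bot. x \<le> y"
    by (rule eventually_le_at_bot)
  ultimately have "\<forall>\<^sub>F x in at_bot. x \<le> y \<and> K * exp x < \<epsilon> \<and> (suminf c + suminf d) * exp x < 1/2"
    by eventually_elim auto
  then show thesis
    using that eventually_happens' trivial_limit_at_bot_linorder by blast
qed

lemma K_nonneg: "K \<ge> 0"
  using A_nonneg C.nonneg D.nonneg
  by (auto simp: K_def intro!: add_nonneg_nonneg suminf_nonneg C.summable_c D.summable_c)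

lemma suminf_ge: "c \<nu> \<le> suminf c + suminf d" "d \<nu> \<le> suminf c + suminf d"
proof -
  have "c \<nu> \<le> suminf c" "d \<nu> \<le> suminf d"
    using sum_le_suminf[OF C.summable_c, of "{\<nu>}"] sum_le_suminf[OF D.summable_c, of "{\<nu>}"]
      C.nonneg D.nonneg by simp_all
  moreover have "suminf c \<ge> 0" "suminf d \<ge> 0"
    using C.nonneg D.nonneg by (auto intro!: suminf_nonneg C.summable_c D.summable_c)
  ultimately show "c \<nu> \<le> suminf c + suminf d" "d \<nu> \<le> suminf c + suminf d"
    by linarith+
qed

lemma \<Psi>_left:
  assumes "\<rho> > 0"
  obtains x where "\<And>t. t \<in> strip \<Longrightarrow> Re t \<le> x \<Longrightarrow> \<Psi> \<rho> t < 0"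
proof -
  \<comment> \<open>The first bound gives \<eta> * Re t \<le> ln \<rho> - 1, and the error of the
    asymptotics stays below 1, so that Re (logF t) < ln \<rho>.\<close>
  obtain x where x: "x \<le> (ln \<rho> - 1) / \<eta>" "K * exp x < 1" "(suminf c + suminf d) * exp x < 1/2"
    using left_bounds[of 1] zero_less_one by blast
  show thesis
  proof
    fix t assume t: "t \<in> strip" "Re t \<le> x"
    have exp: "r * exp (Re t) \<le> r * exp x" if "r \<ge> 0" for r
      using t(2) that by (simp add: mult_left_mono)
    have "suminf c + suminf d \<ge> 0"
      using suminf_ge(1)[of 0] c_pos by linarith
    then have small: "(suminf c + suminf d) * exp (Re t) < 1/2"
      using exp x(3) by (meson le_less_trans)
    have "c \<nu> * exp (Re t) \<le> (suminf c + suminf d) * exp (Re t)"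
      "d \<nu> * exp (Re t) \<le> (suminf c + suminf d) * exp (Re t)" for \<nu>
      by (intro mult_right_mono suminf_ge exp_ge_zero)+
    from le_less_trans[OF this(1) small] le_less_trans[OF this(2) small]
    have ne: "c \<nu> * exp (Re t) \<noteq> 1" "d \<nu> * exp (Re t) \<noteq> 1" for \<nu>
      by (simp_all add: less_imp_neq order.strict_trans[of _ "1/2" 1])
    consider "0 < Im t" "Im t < pi" | "Im t = 0" | "Im t = pi"
      using t(1) by (force simp: strip_def)
    then have reg: "regular t"
      by cases (simp_all add: regular_interior regular_bottom_iff regular_top_iff ne)
    have "Re (logF t) - \<eta> * Re t \<le> norm (logF t - of_real \<eta> * t)"
      using complex_Re_le_cmod[of "logF t - of_real \<eta> * t"] by simp
    also have "\<dots> \<le> K * exp (Re t)"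
      by (rule logF_asymp_left[OF small])
    also have "\<dots> < 1"
      using exp[OF K_nonneg] x(2) by linarith
    also have "\<eta> * Re t \<le> ln \<rho> - 1"
      using order_trans[OF t(2) x(1)] \<eta>_pos by (simp add: field_simps)
    then have "1 \<le> ln \<rho> - \<eta> * Re t"
      by simp
    finally show "\<Psi> \<rho> t < 0"
      using \<Psi>_less_0_iff[OF reg assms] by simp
  qed
qed

lemma strip_bottom [simp]: "Complex x 0 \<in> strip"
  and strip_top [simp]: "Complex x pi \<in> strip"
  by (simp_all add: strip_def)

lemma \<Psi>_horizontal_continuous: "continuous_on S (\<lambda>x. \<Psi> \<rho> (Complex x \<theta>))"
  by (rule continuous_on_compose2[OF \<Psi>_continuous[of UNIV]])
     (auto simp: Complex_eq intro!: continuous_intros)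

lemma den_bottom_pole:
  assumes "d \<mu> > 0"
  shows "den (Complex (- ln (d \<mu>)) 0) = 0"
proof -
  have "d \<mu> * exp (- ln (d \<mu>)) = 1"
    using assms by (simp add: exp_minus field_simps)
  then have "\<exists>\<nu>. d \<nu> * exp (Re (reflect (Complex (- ln (d \<mu>)) 0))) = 1"
    by auto
  then have "gprod d (exp (reflect (Complex (- ln (d \<mu>)) 0))) = 0"
    by (subst D.gprod_top_eq_0_iff) simp
  then show ?thesis
    by (simp add: gprod_d_reflect)
qed

lemma num_top_zero:
  assumes "c \<mu> > 0"
  shows "num (Complex (- ln (c \<mu>)) pi) = 0"
proof -
  have "c \<mu> * exp (- ln (c \<mu>)) = 1"
    using assms by (simp add: exp_minus field_simps)
  then have "gprod c (exp (Complex (- ln (c \<mu>)) pi)) = 0"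
    by (subst C.gprod_top_eq_0_iff) auto
  then show ?thesis
    by (simp add: num_def)
qed

definition level :: "real \<Rightarrow> real \<Rightarrow> complex \<Rightarrow> bool" where
  "level \<rho> \<gamma> t \<longleftrightarrow> regular t \<and> Re (logF t) = ln \<rho> \<and> Im (logF t) = \<gamma>"

lemma less_pole_iff: "e > 0 \<Longrightarrow> e * exp x < 1 \<longleftrightarrow> x < - ln e" for e x :: real
proof -
  assume "e > 0"
  then have "e * exp x < 1 \<longleftrightarrow> exp x < exp (- ln e)"
    by (simp add: exp_minus field_simps)
  then show ?thesis
    by simp
qed

text \<open>On the lower edge the argument is 0 up to the first pole, which is at \<open>?b\<close>.
  On this interval \<open>\<Psi> \<rho>\<close> passes from negative values at the far left to a
  positive value at the pole.\<close>

lemma level_zero_exists: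
  assumes "\<rho> > 0"
  obtains x where "level \<rho> 0 (Complex x 0)" "\<And>\<nu>. d \<nu> * exp x < 1"
proof -
  obtain \<mu> where \<mu>: "d \<mu> > 0" "\<And>\<nu>. d \<nu> \<le> d \<mu>"
    using D.attains_max[OF d_pos] by blast
  let ?b = "- ln (d \<mu>)"
  obtain x0 where x0: "\<And>t. t \<in> strip \<Longrightarrow> Re t \<le> x0 \<Longrightarrow> \<Psi> \<rho> t < 0"
    using \<Psi>_left[OF assms] by blast
  have pole: "\<Psi> \<rho> (Complex ?b 0) > 0"
    by (rule \<Psi>_pole) (simp_all add: den_bottom_pole \<mu>)
  have "x0 < ?b"
    using x0[of "Complex ?b 0"] pole by force
  moreover have "\<Psi> \<rho> (Complex x0 0) < 0"
    using x0 by simp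
  ultimately obtain x where x: "x0 \<le> x" "x \<le> ?b" "\<Psi> \<rho> (Complex x 0) = 0"
    using IVT'[of "\<lambda>x. \<Psi> \<rho> (Complex x 0)" x0 0 ?b] pole \<Psi>_horizontal_continuous by force
  then have "x < ?b"
    using pole by (cases "x = ?b") auto
  then have less: "d \<nu> * exp x < 1" for \<nu>
    using less_pole_iff[OF \<mu>(1)] \<mu>(2)[of \<nu>] by (meson exp_ge_zero le_less_trans mult_right_mono)
  have reg: "regular (Complex x 0)"
    using regular_if_\<Psi>_0[OF _ assms x(3)] by simp
  have "{\<nu>. 1 < d \<nu> * exp x} = {}"
    using less less_asym by blast
  then have "level \<rho> 0 (Complex x 0)"
    using reg x(3) \<Psi>_eq_0_iff[OF reg assms] Im_logF_bottom[OF _ reg] by (simp add: level_def)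
  then show thesis
    using less that by blast
qed

end

section \<open>Points of the level set with a prescribed argument in (0, pi]\<close>

context pf_function
begin

text \<open>On the lower edge the argument is pi times the number of poles passed, so \<gamma> = pi
  and exactly one pole lies to the left of \<open>l\<close>. Between that pole, where
  \<open>\<Psi> \<rho>\<close> is positive, and \<open>l\<close> the argument stays
  constant.\<close>

lemma level_bottom_from_limit:
  assumes "\<rho> > 0" "regular (Complex l 0)" "Im (logF (Complex l 0)) = \<gamma>" "0 < \<gamma>" "\<gamma> \<le> pi"
    and "\<Psi> \<rho> (Complex l 0) \<le> 0"
  shows "\<exists>t. level \<rho> \<gamma> t"
proof -
  have \<gamma>: "pi * real (card {\<nu>. d \<nu> * exp l > 1}) = \<gamma>"
    using Im_logF_bottom[OF _ assms(2)] assms(3) by simp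
  then have "real (card {\<nu>. d \<nu> * exp l > 1}) \<le> 1" "card {\<nu>. d \<nu> * exp l > 1} \<noteq> 0"
    using assms(4,5) mult_le_cancel_left_pos[OF pi_gt_zero, of _ 1] by (auto intro!: Nat.gr0I)
  then have card: "card {\<nu>. d \<nu> * exp l > 1} = 1"
    by linarith
  then obtain \<mu> where \<mu>: "{\<nu>. d \<nu> * exp l > 1} = {\<mu>}"
    using card_1_singletonE by blast
  then have dl: "d \<mu> * exp l > 1"
    by blast
  then have d_pos': "d \<mu> > 0"
    using D.nonneg[of \<mu>] by (cases "d \<mu> = 0") auto
  define b where "b = - ln (d \<mu>)"
  have db: "d \<mu> * exp x > 1 \<longleftrightarrow> b < x" for x
  proof -
    have "d \<mu> * exp x > 1 \<longleftrightarrow> exp b < exp x"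
      using d_pos' by (simp add: b_def exp_minus field_simps)
    then show ?thesis
      by simp
  qed
  have other: "d \<nu> * exp x < 1" if "\<nu> \<noteq> \<mu>" "x \<le> l" for \<nu> x
  proof -
    have "d \<nu> * exp x \<le> d \<nu> * exp l"
      using that D.nonneg by (intro mult_left_mono) auto
    moreover have "\<not> d \<nu> * exp l > 1"
      using \<mu> that(1) by blast
    moreover have "d \<nu> * exp l \<noteq> 1"
      using regular_bottom_iff[of "Complex l 0"] assms(2) by simp
    ultimately show ?thesis
      by linarith
  qed
  have pole: "\<Psi> \<rho> (Complex b 0) > 0"
    unfolding b_def by (rule \<Psi>_pole) (simp_all add: den_bottom_pole d_pos')
  have "b \<le> l"
    using db[of l] dl by simp
  then obtain x where x: "b \<le> x" "x \<le> l" "\<Psi> \<rho> (Complex x 0) = 0"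
    using IVT2'[of "\<lambda>x. \<Psi> \<rho> (Complex x 0)" l 0 b] pole assms(6) \<Psi>_horizontal_continuous by force
  have reg: "regular (Complex x 0)"
    by (rule regular_if_\<Psi>_0[OF _ assms(1) x(3)]) simp
  have "b < x"
    using x pole by (cases "x = b") auto
  then have "{\<nu>. d \<nu> * exp x > 1} = {\<mu>}"
    using other[OF _ x(2)] db by (auto dest: less_asym)
  then have "Im (logF (Complex x 0)) = \<gamma>"
    using Im_logF_bottom[OF _ reg] \<gamma> card by simp
  then have "level \<rho> \<gamma> (Complex x 0)"
    using reg x(3) \<Psi>_eq_0_iff[OF reg assms(1)] by (simp add: level_def)
  then show ?thesis
    by blast
qed

text \<open>On the upper edge the argument is \<eta> * pi plus pi for each zero passed. As \<gamma>
  \<le> pi, no zero lies to the left of \<open>l\<close>, and moving left towards small |F| keeps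
  the argument.\<close>

lemma level_top_from_limit:
  assumes "\<rho> > 0" "regular (Complex l pi)" "Im (logF (Complex l pi)) = \<gamma>" "\<gamma> \<le> pi"
    and "\<Psi> \<rho> (Complex l pi) \<ge> 0"
  shows "\<exists>t. level \<rho> \<gamma> t"
proof -
  have \<gamma>: "\<eta> * pi + pi * real (card {\<nu>. c \<nu> * exp l > 1}) = \<gamma>"
    using Im_logF_top[OF _ assms(2)] assms(3) by simp
  have "\<eta> * pi > 0"
    using \<eta>_pos by simp
  then have "pi * real (card {\<nu>. c \<nu> * exp l > 1}) < pi * 1"
    using \<gamma> assms(4) by linarith
  then have card: "card {\<nu>. c \<nu> * exp l > 1} = 0"
    unfolding mult_less_cancel_left_pos[OF pi_gt_zero] by linarith
  then have le: "\<not> c \<nu> * exp l > 1" for \<nu>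
    using C.finite_large_factors[of l] by auto
  obtain x0 where x0: "\<And>t. t \<in> strip \<Longrightarrow> Re t \<le> x0 \<Longrightarrow> \<Psi> \<rho> t < 0"
    using \<Psi>_left[OF assms(1)] by blast
  have "x0 \<le> l"
    using x0[of "Complex l pi"] assms(5) by force
  moreover have "\<Psi> \<rho> (Complex x0 pi) < 0"
    using x0 by simp
  ultimately obtain x where x: "x0 \<le> x" "x \<le> l" "\<Psi> \<rho> (Complex x pi) = 0"
    using IVT'[of "\<lambda>x. \<Psi> \<rho> (Complex x pi)" x0 0 l] assms(5) \<Psi>_horizontal_continuous by force
  have reg: "regular (Complex x pi)"
    by (rule regular_if_\<Psi>_0[OF _ assms(1) x(3)]) simp
  have "\<not> c \<nu> * exp x > 1" for \<nu>
  proof -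
    have "c \<nu> * exp x \<le> c \<nu> * exp l"
      using x C.nonneg by (intro mult_left_mono) auto
    then show ?thesis
      using le[of \<nu>] by linarith
  qed
  then have "Im (logF (Complex x pi)) = \<gamma>"
    using Im_logF_top[OF _ reg] \<gamma> card by simp
  then have "level \<rho> \<gamma> (Complex x pi)"
    using reg x(3) \<Psi>_eq_0_iff[OF reg assms(1)] by (simp add: level_def)
  then show ?thesis
    by blast
qed

lemma logF_vertical_continuous:
  assumes "0 < \<theta>" "\<theta> < pi"
  shows "isCont (\<lambda>\<theta>. Im (logF (Complex x \<theta>))) \<theta>"
proof -
  have "continuous_on {0<..<pi} (\<lambda>\<theta>. logF (Complex x \<theta>))"
    by (rule continuous_on_compose2[OF logF_continuous])
       (auto simp: Complex_eq regular_interior intro!: continuous_intros)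
  then have "isCont (\<lambda>\<theta>. logF (Complex x \<theta>)) \<theta>"
    using assms by (simp add: continuous_on_eq_continuous_at)
  then show ?thesis
    unfolding isCont_def by (rule tendsto_Im)
qed

lemma logF_horizontal_continuous:
  assumes "0 < \<theta>" "\<theta> < pi"
  shows "continuous_on S (\<lambda>x. Im (logF (Complex x \<theta>)))"
proof -
  have "continuous_on S (\<lambda>x. logF (Complex x \<theta>))"
    by (rule continuous_on_compose2[OF logF_continuous])
       (use assms in \<open>auto simp: Complex_eq regular_interior intro!: continuous_intros\<close>)
  then show ?thesis
    by (intro continuous_intros)
qed

lemma Im_logF_left:
  assumes "(suminf c + suminf d) * exp x < 1/2"
  shows "Im (logF (Complex x \<theta>)) \<le> \<eta> * \<theta> + K * exp x"
proof -
  have "Im (logF (Complex x \<theta>)) - \<eta> * \<theta> \<le> norm (logF (Complex x \<theta>) - of_real \<eta> * Complex x \<theta>)"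
    using abs_Im_le_cmod[of "logF (Complex x \<theta>) - of_real \<eta> * Complex x \<theta>"] by simp
  also have "\<dots> \<le> K * exp x"
    using logF_asymp_left[of "Complex x \<theta>"] assms by simp
  finally show ?thesis
    by simp
qed

text \<open>The curve on which the argument equals \<^term>\<open>\<gamma>\<close> is a graph over the vertical coordinate. If
  \<^term>\<open>\<Psi> \<rho>\<close> kept a constant sign on it, then the curve would have a limit point on the lower edge
  (negative sign) or on the upper edge (positive sign), and moving from there along the edge to the
  left, towards a pole or to infinity, \<^term>\<open>\<Psi> \<rho>\<close> would change its sign before the argument does.\<close>

lemma level_exists:
  assumes "\<rho> > 0" "0 < \<gamma>" "\<gamma> \<le> pi"
  shows "\<exists>t. level \<rho> \<gamma> t"
proof (rule ccontr)
  assume none: "\<nexists>t. level \<rho> \<gamma> t"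
  let ?V = "\<lambda>x \<theta>. Im (logF (Complex x \<theta>))"
  \<comment> \<open>Inside the strip the argument exceeds \<eta> * \<theta>, so it can equal
    \<gamma> only at heights below \<gamma> / \<eta>.\<close>
  define \<theta>m where "\<theta>m = min (\<gamma> / \<eta>) pi"
  have \<theta>m: "0 < \<theta>m" "\<theta>m \<le> pi" "\<And>\<theta>. \<theta> < \<theta>m \<Longrightarrow> \<eta> * \<theta> < \<gamma>"
    using assms(2) \<eta>_pos by (auto simp: \<theta>m_def field_simps)
  obtain x2 where x2: "\<And>\<theta>. 0 < \<theta> \<Longrightarrow> \<theta> < pi \<Longrightarrow> ?V x2 \<theta> > pi"
    using Im_logF_large by blast
  have "\<exists>x<x2. ?V x \<theta> = \<gamma>" if \<theta>: "0 < \<theta>" "\<theta> < \<theta>m" for \<theta>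
  proof -
    obtain x1 where x1: "x1 \<le> x2" "K * exp x1 < \<gamma> - \<eta> * \<theta>" "(suminf c + suminf d) * exp x1 < 1/2"
      using left_bounds[of "\<gamma> - \<eta> * \<theta>" x2] \<theta>m(3)[OF \<theta>(2)] by force
    have "?V x1 \<theta> \<le> \<gamma>"
      using Im_logF_left[OF x1(3), of \<theta>] x1(2) by linarith
    moreover have "?V x2 \<theta> > \<gamma>"
      using x2[of \<theta>] \<theta> \<theta>m(2) assms(3) by force
    moreover have "continuous_on {x1..x2} (\<lambda>x. ?V x \<theta>)"
      using \<theta> \<theta>m(2) by (intro logF_horizontal_continuous) auto
    ultimately obtain x where "x1 \<le> x" "x \<le> x2" "?V x \<theta> = \<gamma>"
      using IVT'[of "\<lambda>x. ?V x \<theta>" x1 \<gamma> x2] x1(1) by auto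
    moreover have "x \<noteq> x2"
      using calculation \<open>?V x2 \<theta> > \<gamma>\<close> by auto
    ultimately show ?thesis
      by (intro exI[of _ x]) auto
  qed
  then obtain X where X: "\<And>\<theta>. 0 < \<theta> \<Longrightarrow> \<theta> < \<theta>m \<Longrightarrow> X \<theta> < x2 \<and> ?V (X \<theta>) \<theta> = \<gamma>"
    by metis
  have int: "0 < \<theta> \<and> \<theta> < pi" if "0 < \<theta>" "\<theta> < \<theta>m" for \<theta>
    using that \<theta>m(2) by auto
  \<comment> \<open>Monotonicity in x turns comparisons with \<open>X \<theta>\<close> into
    comparisons of the argument with \<gamma>. Continuity of \<open>X\<close> then follows from
    continuity of the argument along vertical lines.\<close>
  have less_X: "x < X \<theta> \<longleftrightarrow> ?V x \<theta> < \<gamma>" and X_less: "X \<theta> < x \<longleftrightarrow> \<gamma> < ?V x \<theta>"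
    if \<theta>: "0 < \<theta>" "\<theta> < \<theta>m" for x \<theta>
    using Im_logF_strict_mono[of \<theta> x "X \<theta>"] Im_logF_strict_mono[of \<theta> "X \<theta>" x]
      int[OF \<theta>] X[OF \<theta>] by (cases x "X \<theta>" rule: linorder_cases; force)+
  have "isCont X \<theta>" if \<theta>: "0 < \<theta>" "\<theta> < \<theta>m" for \<theta>
  proof -
    have near: "\<forall>\<^sub>F y in at \<theta>. y \<in> {0<..<\<theta>m}"
      using \<theta> by (intro eventually_at_in_open') auto
    have V_lim: "((\<lambda>y. ?V x y) \<longlongrightarrow> ?V x \<theta>) (at \<theta>)" for x
      using logF_vertical_continuous[of \<theta> x] int[OF \<theta>] by (simp add: isCont_def)
    show ?thesis
      unfolding isCont_def
    proof (rule order_tendstoI)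
      fix a assume "a < X \<theta>"
      then have "\<forall>\<^sub>F y in at \<theta>. ?V a y < \<gamma>"
        using less_X[OF \<theta>] by (intro order_tendstoD[OF V_lim]) auto
      with near show "\<forall>\<^sub>F y in at \<theta>. a < X y"
        by eventually_elim (use less_X in auto)
    next
      fix a assume "X \<theta> < a"
      then have "\<forall>\<^sub>F y in at \<theta>. \<gamma> < ?V a y"
        using X_less[OF \<theta>] by (intro order_tendstoD[OF V_lim]) auto
      with near show "\<forall>\<^sub>F y in at \<theta>. X y < a"
        by eventually_elim (use X_less in auto)
    qed
  qed
  then have "continuous_on {0<..<\<theta>m} X"
    by (intro continuous_at_imp_continuous_on) auto
  then have h_cont: "continuous_on {0<..<\<theta>m} (\<lambda>\<theta>. \<Psi> \<rho> (Complex (X \<theta>) \<theta>))"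
    by (intro continuous_on_compose2[OF \<Psi>_continuous[of UNIV]])
       (auto simp: Complex_eq intro!: continuous_intros)
  have reg: "regular (Complex (X \<theta>) \<theta>)" if "0 < \<theta>" "\<theta> < \<theta>m" for \<theta>
    using int[OF that] by (simp add: regular_interior)
  have h_nz: "\<Psi> \<rho> (Complex (X \<theta>) \<theta>) \<noteq> 0" if \<theta>: "0 < \<theta>" "\<theta> < \<theta>m" for \<theta>
    using none \<Psi>_eq_0_iff[OF reg[OF \<theta>] assms(1)] reg[OF \<theta>] X[OF \<theta>] unfolding level_def by blast
  have h_sign: False if "0 < \<theta>1" "\<theta>1 < \<theta>m" "0 < \<theta>2" "\<theta>2 < \<theta>m"
    "\<Psi> \<rho> (Complex (X \<theta>1) \<theta>1) > 0" "\<Psi> \<rho> (Complex (X \<theta>2) \<theta>2) < 0" for \<theta>1 \<theta>2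
  proof -
    have "connected ((\<lambda>\<theta>. \<Psi> \<rho> (Complex (X \<theta>) \<theta>)) ` {0<..<\<theta>m})"
      by (intro connected_continuous_image h_cont connected_Ioo)
    then have "0 \<in> (\<lambda>\<theta>. \<Psi> \<rho> (Complex (X \<theta>) \<theta>)) ` {0<..<\<theta>m}"
      using that connectedD_interval[of _ "\<Psi> \<rho> (Complex (X \<theta>2) \<theta>2)" "\<Psi> \<rho> (Complex (X \<theta>1) \<theta>1)" 0]
      by auto
    then show False
      using h_nz by force
  qed
  have limit: "\<exists>l r. strict_mono r \<and> (\<lambda>n. Complex (X (\<theta>s (r n))) (\<theta>s (r n))) \<longlonglongrightarrow> Complex l \<theta>"
    if "\<And>n. X (\<theta>s n) \<in> {x1..x2}" "\<theta>s \<longlonglongrightarrow> \<theta>" for x1 \<theta>s \<theta>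
  proof -
    have "\<forall>n. X (\<theta>s n) \<in> {x1..x2}"
      using that(1) by blast
    from seq_compactE[OF compact_imp_seq_compact[OF compact_Icc] this]
    obtain l r where "strict_mono r" "((\<lambda>n. X (\<theta>s n)) \<circ> r) \<longlonglongrightarrow> l"
      by metis
    then have "strict_mono r" "(\<lambda>n. X (\<theta>s (r n))) \<longlonglongrightarrow> l"
      by (simp_all add: o_def)
    moreover have "(\<lambda>n. \<theta>s (r n)) \<longlonglongrightarrow> \<theta>"
      using LIMSEQ_subseq_LIMSEQ[OF that(2) \<open>strict_mono r\<close>] by (simp add: o_def)
    ultimately have "(\<lambda>n. Complex (X (\<theta>s (r n))) (\<theta>s (r n))) \<longlonglongrightarrow> Complex l \<theta>"
      by (intro tendsto_Complex)
    with \<open>strict_mono r\<close> show ?thesis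
      by blast
  qed
  have V_limit: "Im (logF u) = \<gamma>"
    if "(\<lambda>n. Complex (X (\<theta>s n)) (\<theta>s n)) \<longlonglongrightarrow> u" "\<And>n. 0 < \<theta>s n \<and> \<theta>s n < \<theta>m" "regular u" for \<theta>s u
  proof -
    have "(\<lambda>n. logF (Complex (X (\<theta>s n)) (\<theta>s n))) \<longlonglongrightarrow> logF u"
      by (rule continuous_on_tendsto_compose[OF logF_continuous that(1)]) (use that reg in auto)
    then have "(\<lambda>n. Im (logF (Complex (X (\<theta>s n)) (\<theta>s n)))) \<longlonglongrightarrow> Im (logF u)"
      by (rule tendsto_Im)
    then show ?thesis
      using X that(2) by (simp add: LIMSEQ_const_iff)
  qed
  have \<Psi>_limit: "(\<lambda>n. \<Psi> \<rho> (u n)) \<longlonglongrightarrow> \<Psi> \<rho> v" if "u \<longlonglongrightarrow> v" for u v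
    by (rule continuous_on_tendsto_compose[OF \<Psi>_continuous[of UNIV] that]) auto
  have seq: "(\<lambda>n. 1 / (real n + 2)) \<longlonglongrightarrow> 0"
    using LIMSEQ_ignore_initial_segment[OF lim_1_over_n, of 2] by (simp add: add.commute)
  consider "\<And>\<theta>. 0 < \<theta> \<Longrightarrow> \<theta> < \<theta>m \<Longrightarrow> \<Psi> \<rho> (Complex (X \<theta>) \<theta>) < 0"
    | "\<And>\<theta>. 0 < \<theta> \<Longrightarrow> \<theta> < \<theta>m \<Longrightarrow> \<Psi> \<rho> (Complex (X \<theta>) \<theta>) > 0"
    using h_sign h_nz by (meson linorder_neqE)
  then show False
  proof cases
    case 1
    obtain x1 where x1: "x1 \<le> x2" "K * exp x1 < \<gamma> / 2" "(suminf c + suminf d) * exp x1 < 1/2"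
      using left_bounds[OF half_gt_zero[OF assms(2)], of x2] by blast
    \<comment> \<open>Heights tending to 0. The cap \<gamma> / (2 * \<eta>) keeps \<eta> * \<theta>
      below \<gamma> / 2, so the argument at \<open>x1\<close> is below \<gamma> for all of them and
      \<open>X\<close> stays to the right of \<open>x1\<close>.\<close>
    define \<theta>s where "\<theta>s n = min \<theta>m (\<gamma> / (2 * \<eta>)) * (1 / (real n + 2))" for n
    have m: "min \<theta>m (\<gamma> / (2 * \<eta>)) > 0"
      using \<theta>m(1) assms(2) \<eta>_pos by simp
    have \<theta>s_less: "0 < \<theta>s n \<and> \<theta>s n < min \<theta>m (\<gamma> / (2 * \<eta>))" for n
      using m mult_strict_left_mono[of "1 / (real n + 2)" 1 "min \<theta>m (\<gamma> / (2 * \<eta>))"]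
      by (simp add: \<theta>s_def)
    then have \<theta>s: "0 < \<theta>s n \<and> \<theta>s n < \<theta>m" for n
      by simp
    have "\<theta>s \<longlonglongrightarrow> min \<theta>m (\<gamma> / (2 * \<eta>)) * 0"
      unfolding \<theta>s_def by (intro tendsto_intros seq)
    then have lim0: "\<theta>s \<longlonglongrightarrow> 0"
      by simp
    have "X (\<theta>s n) \<in> {x1..x2}" for n
    proof -
      have "\<eta> * \<theta>s n < \<gamma> / 2"
        using \<theta>s_less[of n] \<eta>_pos by (simp add: field_simps)
      then have "?V x1 (\<theta>s n) < \<gamma>"
        using Im_logF_left[OF x1(3), of "\<theta>s n"] x1(2) by linarith
      then have "x1 < X (\<theta>s n)"
        using less_X \<theta>s by blast
      then show ?thesis
        using X[of "\<theta>s n"] \<theta>s[of n] by simp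
    qed
    from limit[OF this lim0] obtain l r where
      r: "strict_mono r" and l: "(\<lambda>n. Complex (X (\<theta>s (r n))) (\<theta>s (r n))) \<longlonglongrightarrow> Complex l 0"
      by blast
    have le: "\<Psi> \<rho> (Complex l 0) \<le> 0"
      by (rule LIMSEQ_le_const2[OF \<Psi>_limit[OF l]]) (use 1 \<theta>s less_imp_le in blast)
    then have "den (Complex l 0) \<noteq> 0"
      using \<Psi>_pole[of "Complex l 0" \<rho>] by auto
    then have "regular (Complex l 0)"
      using C.gprod_bottom_nonzero[of "Complex l 0"] by (simp add: regular_def num_def)
    moreover from V_limit[OF l _ this] have "Im (logF (Complex l 0)) = \<gamma>"
      using \<theta>s by simp
    ultimately show False
      using level_bottom_from_limit[OF assms(1)] assms(2,3) le none by blast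
  next
    case 2
    obtain x1 where x1: "\<And>t. t \<in> strip \<Longrightarrow> Re t \<le> x1 \<Longrightarrow> \<Psi> \<rho> t < 0"
      using \<Psi>_left[OF assms(1)] by blast
    \<comment> \<open>Heights tending to the upper end of the graph. The positive sign on the graph
      keeps \<open>X\<close> to the right of \<open>x1\<close>, left of which
      \<open>\<Psi> \<rho>\<close> is negative.\<close>
    define \<theta>s where "\<theta>s n = \<theta>m * (1 - 1 / (real n + 2))" for n
    have \<theta>s: "0 < \<theta>s n \<and> \<theta>s n < \<theta>m" for n
      using \<theta>m(1) mult_strict_left_mono[of "1 - 1 / (real n + 2)" 1 \<theta>m] by (simp add: \<theta>s_def)
    have "\<theta>s \<longlonglongrightarrow> \<theta>m * (1 - 0)"
      unfolding \<theta>s_def by (intro tendsto_intros seq)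
    then have lim0: "\<theta>s \<longlonglongrightarrow> \<theta>m"
      by simp
    have "X (\<theta>s n) \<in> {x1..x2}" for n
    proof -
      have "\<not> X (\<theta>s n) \<le> x1"
        using x1[of "Complex (X (\<theta>s n)) (\<theta>s n)"] 2[of "\<theta>s n"] \<theta>s[of n] regularD(1)[OF reg[of "\<theta>s n"]]
        by force
      then show ?thesis
        using X[of "\<theta>s n"] \<theta>s[of n] by simp
    qed
    from limit[OF this lim0] obtain l r where
      r: "strict_mono r" and l: "(\<lambda>n. Complex (X (\<theta>s (r n))) (\<theta>s (r n))) \<longlonglongrightarrow> Complex l \<theta>m"
      by blast
    have ge: "\<Psi> \<rho> (Complex l \<theta>m) \<ge> 0"
      by (rule LIMSEQ_le_const[OF \<Psi>_limit[OF l]]) (use 2 \<theta>s less_imp_le in blast)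
    have strip: "Complex l \<theta>m \<in> strip"
      using \<theta>m(1,2) by (simp add: strip_def)
    show False
    proof (cases "\<theta>m < pi")
      case True
      then have "regular (Complex l \<theta>m)"
        using \<theta>m(1) by (simp add: regular_interior)
      then have "Im (logF (Complex l \<theta>m)) = \<gamma>"
        using V_limit[OF l] \<theta>s by simp
      \<comment> \<open>If the graph ends inside the strip, the limit point has argument exactly
        \<eta> times its height, whereas interior points have a strictly larger argument.\<close>
      moreover have "\<eta> * \<theta>m = \<gamma>"
        using True \<eta>_pos by (auto simp: \<theta>m_def min_def split: if_splits)
      ultimately show False
        using Im_logF_gt[of "Complex l \<theta>m"] True \<theta>m(1) by simp
    next
      case False
      then have eq: "\<theta>m = pi"
        using \<theta>m(2) by simp
      have "num (Complex l pi) \<noteq> 0"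
        using \<Psi>_zero[of "Complex l pi" \<rho>] ge assms(1) eq by force
      then have "regular (Complex l pi)"
        using D.gprod_bottom_nonzero[of "reflect (Complex l pi)"]
        by (simp add: regular_def gprod_d_reflect)
      moreover from V_limit[OF l[unfolded eq] _ this] have "Im (logF (Complex l pi)) = \<gamma>"
        using \<theta>s eq by simp
      ultimately show False
        using level_top_from_limit[OF assms(1)] assms(3) ge none eq by blast
    qed
  qed
qed

end

section \<open>The logarithmic derivative\<close>

text \<open>The multiplicative form f' = f * a avoids division by f, so that the product rule holds
  without nonvanishing conditions.\<close>

definition has_logderiv :: "(complex \<Rightarrow> complex) \<Rightarrow> complex \<Rightarrow> complex \<Rightarrow> bool" where
  "has_logderiv f a z \<longleftrightarrow> (f has_field_derivative f z * a) (at z)"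

lemma has_logderiv_mult:
  "has_logderiv f a z \<Longrightarrow> has_logderiv g b z \<Longrightarrow> has_logderiv (\<lambda>z. f z * g z) (a + b) z"
  unfolding has_logderiv_def
  by (rule DERIV_cong[OF DERIV_mult]) (auto simp: algebra_simps)

lemma has_logderiv_divide:
  "has_logderiv f a z \<Longrightarrow> has_logderiv g b z \<Longrightarrow> g z \<noteq> 0 \<Longrightarrow>
    has_logderiv (\<lambda>z. f z / g z) (a - b) z"
  unfolding has_logderiv_def
  by (rule DERIV_cong[OF DERIV_divide]) (auto simp: field_simps)

lemma has_logderiv_exp:
  "(f has_field_derivative a) (at z) \<Longrightarrow> has_logderiv (\<lambda>z. exp (f z)) a z"
  unfolding has_logderiv_def by (auto intro!: derivative_eq_intros)

lemma has_logderiv_power: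
  "z \<noteq> 0 \<Longrightarrow> has_logderiv (\<lambda>z. z ^ n) (of_nat n / z) z"
  unfolding has_logderiv_def
  by (rule DERIV_cong[OF DERIV_power[OF DERIV_ident]]) (cases n; simp add: field_simps)

lemma (in nonneg_summable) gprod_has_logderiv:
  assumes "(f has_field_derivative a) (at z)" "gprod c (f z) \<noteq> 0"
  shows "has_logderiv (\<lambda>z. gprod c (f z)) (deriv (gprod c) (f z) / gprod c (f z) * a) z"
proof -
  have "gprod c holomorphic_on UNIV"
    using gprod_holomorphic[of "\<lambda>z. z" UNIV] by simp
  then have "(gprod c has_field_derivative deriv (gprod c) (f z)) (at (f z))"
    using holomorphic_derivI open_UNIV by blast
  from DERIV_chain2[OF this assms(1)] show ?thesis
    using assms(2) by (simp add: has_logderiv_def)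
qed

text \<open>The extra factor w turns the derivative with respect to w into the one with respect to
  log w.\<close>

lemma (in nonneg_summable) logderiv_sums:
  assumes "gprod c w \<noteq> 0"
  shows "(\<lambda>\<nu>. of_real (c \<nu>) * w / (1 + of_real (c \<nu>) * w)) sums (w * (deriv (gprod c) w / gprod c w))"
  using sums_mult[OF gprod_logderiv[OF assms], of w] by (simp add: mult.commute)

text \<open>Each term contributes c \<nu> * (Im w)^2 / |1 + c \<nu> * w|^2. Multiplying by Im w
  treats both half-planes at once.\<close>

lemma (in nonneg_summable) Im_logderiv_mult:
  assumes "gprod c w \<noteq> 0"
  shows "Im (w * (deriv (gprod c) w / gprod c w)) * Im w \<ge> 0"
    and "c \<mu> > 0 \<Longrightarrow> Im w \<noteq> 0 \<Longrightarrow> Im (w * (deriv (gprod c) w / gprod c w)) * Im w > 0"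
proof -
  let ?f = "\<lambda>\<nu>. Im (of_real (c \<nu>) * w / (1 + of_real (c \<nu>) * w)) * Im w"
  have sums: "?f sums (Im (w * (deriv (gprod c) w / gprod c w)) * Im w)"
    by (intro sums_mult2 sums_Im logderiv_sums assms)
  have f: "?f \<nu> = c \<nu> * (Im w)\<^sup>2 / (norm (1 + of_real (c \<nu>) * w))\<^sup>2" for \<nu>
  proof -
    let ?v = "1 + of_real (c \<nu>) * w"
    have "Im (of_real (c \<nu>) * w) * Re ?v - Re (of_real (c \<nu>) * w) * Im ?v = c \<nu> * Im w"
      by (simp add: algebra_simps)
    then show ?thesis
      unfolding Im_divide cmod_power2 by (simp only: power2_eq_square times_divide_eq_left mult.assoc)
  qed
  then have nonneg': "?f \<nu> \<ge> 0" for \<nu>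
    using nonneg by simp
  then show "Im (w * (deriv (gprod c) w / gprod c w)) * Im w \<ge> 0"
    using sums_le[OF _ sums_zero sums] by simp
  assume "c \<mu> > 0" "Im w \<noteq> 0"
  then have "?f \<mu> > 0"
    unfolding f using gprod_nonzeroD[OF assms, of \<mu>] by simp
  then show "Im (w * (deriv (gprod c) w / gprod c w)) * Im w > 0"
    using suminf_pos2[of ?f \<mu>] nonneg' sums by (simp add: sums_iff)
qed

lemma (in nonneg_summable) logderiv_real_sums:
  fixes y :: real
  assumes "gprod c (of_real y) \<noteq> 0"
  shows "(\<lambda>\<nu>. c \<nu> * y / (1 + c \<nu> * y)) sums Re (of_real y * (deriv (gprod c) (of_real y) / gprod c (of_real y)))"
    and "Im (of_real y * (deriv (gprod c) (of_real y) / gprod c (of_real y))) = 0"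
proof -
  have eq: "of_real (c \<nu>) * of_real y / (1 + of_real (c \<nu>) * of_real y) = complex_of_real (c \<nu> * y / (1 + c \<nu> * y))" for \<nu>
    by simp
  note sums = logderiv_sums[OF assms, unfolded eq]
  show "(\<lambda>\<nu>. c \<nu> * y / (1 + c \<nu> * y)) sums Re (of_real y * (deriv (gprod c) (of_real y) / gprod c (of_real y)))"
    using sums_Re[OF sums] by (simp only: Re_complex_of_real)
  show "Im (of_real y * (deriv (gprod c) (of_real y) / gprod c (of_real y))) = 0"
    using sums_Im[OF sums] sums_unique2 sums_zero by (fastforce simp only: Im_complex_of_real)
qed

lemma (in nonneg_summable) gprod_real_nonzero:
  fixes y :: real
  assumes "\<And>\<nu>. c \<nu> * y > - 1"
  shows "gprod c (of_real y) \<noteq> 0"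
proof
  assume "gprod c (of_real y) = 0"
  then obtain \<nu> where "1 + complex_of_real (c \<nu>) * of_real y = 0"
    using gprod_eq_0_iff by blast
  then have "1 + c \<nu> * y = 0"
    by (simp add: complex_eq_iff)
  then show False
    using assms[of \<nu>] by simp
qed

text \<open>The difference of two terms is c \<nu> * (y' - y) divided by (1 + c \<nu> * y') * (1 + c
  \<nu> * y). For y' \<le> 0 the divisor is at most 1, which gives the quantitative bound.\<close>

lemma (in nonneg_summable) logderiv_slope:
  fixes y y' :: real
  assumes "y \<le> y'" "\<And>\<nu>. c \<nu> * y > - 1" "\<And>\<nu>. c \<nu> * y' > - 1"
  defines "L \<equiv> \<lambda>y. Re (of_real y * (deriv (gprod c) (of_real y) / gprod c (of_real y)))"
  shows "L y \<le> L y'" and "y' \<le> 0 \<Longrightarrow> c \<mu> * (y' - y) \<le> L y' - L y"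
proof -
  let ?f = "\<lambda>\<nu>. c \<nu> * y' / (1 + c \<nu> * y') - c \<nu> * y / (1 + c \<nu> * y)"
  have sums: "?f sums (L y' - L y)"
    unfolding L_def by (intro sums_diff logderiv_real_sums gprod_real_nonzero assms)
  have f: "?f \<nu> = c \<nu> * (y' - y) / ((1 + c \<nu> * y') * (1 + c \<nu> * y))" for \<nu>
  proof -
    have "1 + c \<nu> * y' \<noteq> 0" "1 + c \<nu> * y \<noteq> 0"
      using assms(2,3)[of \<nu>] by linarith+
    then show ?thesis
      by (simp add: field_simps)
  qed
  have pos: "1 + c \<nu> * y' > 0" "1 + c \<nu> * y > 0" for \<nu>
    using assms(2,3)[of \<nu>] by linarith+
  have f_nonneg: "?f \<nu> \<ge> 0" for \<nu>
    unfolding f using pos[of \<nu>] nonneg[of \<nu>] assms(1) by simp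
  then show "L y \<le> L y'"
    using sums_le[OF _ sums_zero sums] by simp
  assume "y' \<le> 0"
  then have "c \<mu> * y' \<le> 0" "c \<mu> * y \<le> 0"
    using nonneg[of \<mu>] assms(1) by (auto simp: mult_nonneg_nonpos)
  then have "(1 + c \<mu> * y') * (1 + c \<mu> * y) \<le> 1 * 1"
    using pos[of \<mu>] by (intro mult_mono) auto
  then have "c \<mu> * (y' - y) \<le> ?f \<mu>"
    unfolding f using pos[of \<mu>] nonneg[of \<mu>] assms(1)
      mult_left_mono[of "(1 + c \<mu> * y') * (1 + c \<mu> * y)" 1 "c \<mu> * (y' - y)"]
    by (simp add: pos_le_divide_eq)
  also have "\<dots> \<le> L y' - L y"
    using sum_le_suminf[of ?f "{\<mu>}"] f_nonneg sums by (simp add: sums_iff)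
  finally show "c \<mu> * (y' - y) \<le> L y' - L y" .
qed

context pf_function
begin

definition F :: "complex \<Rightarrow> complex" where
  "F z = z ^ p * exp (of_real A * z ^ k) * (gprod c (z ^ k) / gprod d (- (z ^ k)))"

text \<open>The logarithmic derivative of \<open>F\<close> with respect to log w, where w = z^k;
  thus z * F' / F = k * \<open>Dl\<close> (z^k), and a zero of \<open>Dl\<close> is what makes an
  \<alpha>-point multiple.\<close>

definition Dl :: "complex \<Rightarrow> complex" where
  "Dl w = of_real \<eta> + of_real A * w + w * (deriv (gprod c) w / gprod c w)
    - (- w) * (deriv (gprod d) (- w) / gprod d (- w))"

lemma F_has_logderiv:
  assumes "z \<noteq> 0" "gprod c (z ^ k) \<noteq> 0" "gprod d (- (z ^ k)) \<noteq> 0"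
  shows "has_logderiv F (of_nat k / z * Dl (z ^ k)) z"
proof -
  have pow: "((\<lambda>z. z ^ k) has_field_derivative (z ^ k * of_nat k / z)) (at z)"
    using has_logderiv_power[OF assms(1), of k] by (simp add: has_logderiv_def)
  have npow: "((\<lambda>z. - (z ^ k)) has_field_derivative - (z ^ k * of_nat k / z)) (at z)"
    by (intro DERIV_minus pow)
  have "((\<lambda>z. of_real A * z ^ k) has_field_derivative of_real A * (z ^ k * of_nat k / z)) (at z)"
    by (intro DERIV_cmult pow)
  note has_logderiv_mult[OF has_logderiv_mult[OF has_logderiv_power[OF assms(1), of p] has_logderiv_exp[OF this]]
      has_logderiv_divide[OF C.gprod_has_logderiv[OF pow assms(2)] D.gprod_has_logderiv[OF npow assms(3)] assms(3)]]
  moreover have "of_nat p / z = of_nat k / z * of_real \<eta>"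
    using k_ge_2 by (simp add: \<eta>_def)
  ultimately show ?thesis
    unfolding F_def[abs_def] Dl_def by (simp add: algebra_simps)
qed

definition R :: "complex \<Rightarrow> complex" where
  "R t = num t / den t"

lemma R_has_logderiv:
  assumes "regular t"
  shows "has_logderiv R (Dl (exp t)) t"
proof -
  have nz: "gprod c (exp t) \<noteq> 0" "gprod d (- exp t) \<noteq> 0"
    using assms by (auto simp: regular_def num_def den_def)
  have nexp: "((\<lambda>t. - exp t) has_field_derivative - exp t) (at t)"
    by (intro DERIV_minus DERIV_exp)
  have "((\<lambda>t. of_real \<eta> * t + of_real A * exp t) has_field_derivative
      of_real \<eta> + of_real A * exp t) (at t)"
    by (auto intro!: derivative_eq_intros)
  note has_logderiv_divide[OF has_logderiv_mult[OF has_logderiv_exp[OF this]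
        C.gprod_has_logderiv[OF DERIV_exp nz(1)]] D.gprod_has_logderiv[OF nexp nz(2)] nz(2)]
  then show ?thesis
    unfolding R_def[abs_def] num_def den_def Dl_def by (simp add: algebra_simps)
qed

text \<open>Im \<open>Dl\<close> has the same sign as Im w.\<close>

lemma Dl_off_axis:
  assumes "Im w \<noteq> 0" "gprod c w \<noteq> 0" "gprod d (- w) \<noteq> 0"
  shows "Dl w \<noteq> 0"
proof -
  have "Im (Dl w) * Im w = A * (Im w)\<^sup>2 + Im (w * (deriv (gprod c) w / gprod c w)) * Im w
      + Im ((- w) * (deriv (gprod d) (- w) / gprod d (- w))) * Im (- w)"
    by (simp add: Dl_def algebra_simps power2_eq_square)
  also have "\<dots> > 0"
    by (intro add_pos_nonneg add_nonneg_pos C.Im_logderiv_mult(2)[OF _ c_pos] D.Im_logderiv_mult(1)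
        mult_nonneg_nonneg A_nonneg assms) simp
  finally show ?thesis
    by auto
qed

text \<open>Before the first pole every term is nonnegative, and \<eta> is positive.\<close>

lemma Dl_positive_axis:
  assumes "y \<ge> 0" "\<And>\<nu>. d \<nu> * y < 1"
  shows "Re (Dl (of_real y)) > 0"
proof -
  have "Re (of_real y * (deriv (gprod c) (of_real y) / gprod c (of_real y))) \<ge> 0"
    using C.logderiv_slope(1)[of 0 y] C.nonneg assms(1)
    by (simp add: order_less_le_trans[of "- 1" 0])
  moreover have "Re (of_real (- y) * (deriv (gprod d) (of_real (- y)) / gprod d (of_real (- y)))) \<le> 0"
    using D.logderiv_slope(1)[of "- y" 0] assms by simp
  moreover have "A * y \<ge> 0"
    using A_nonneg assms(1) by simp
  ultimately show ?thesis
    using \<eta>_pos unfolding Dl_def by simp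
qed

text \<open>The term with coefficient \<open>c 0\<close> supplies the rate of decrease, and no other
  term increases. The rate, beyond mere monotonicity, is what later excludes a triple zero.\<close>

lemma Dl_negative_axis:
  assumes "0 \<le> y" "y \<le> y'" "\<And>\<nu>. c \<nu> * y' < 1"
  shows "Re (Dl (of_real (- y'))) \<le> Re (Dl (of_real (- y))) - c 0 * (y' - y)"
proof -
  have c: "c \<nu> * y < 1" for \<nu>
    using assms(3)[of \<nu>] C.nonneg[of \<nu>] assms(2) mult_left_mono[of y y' "c \<nu>"] by linarith
  have "c 0 * (y' - y) \<le> Re (of_real (- y) * (deriv (gprod c) (of_real (- y)) / gprod c (of_real (- y))))
      - Re (of_real (- y') * (deriv (gprod c) (of_real (- y')) / gprod c (of_real (- y'))))"
    using C.logderiv_slope(2)[of "- y'" "- y" 0] assms c by simp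
  moreover have "d \<nu> * y > - 1" "d \<nu> * y' > - 1" for \<nu>
    using D.nonneg[of \<nu>] assms(1,2) mult_nonneg_nonneg[of "d \<nu>" y] mult_nonneg_nonneg[of "d \<nu>" y'] by linarith+
  then have "Re (of_real y * (deriv (gprod d) (of_real y) / gprod d (of_real y)))
      \<le> Re (of_real y' * (deriv (gprod d) (of_real y') / gprod d (of_real y')))"
    using D.logderiv_slope(1)[of y y'] assms(2) by blast
  moreover have "A * y \<le> A * y'"
    using A_nonneg assms(2) by (simp add: mult_left_mono)
  ultimately show ?thesis
    unfolding Dl_def by simp
qed

lemma Dl_real_negative:
  assumes "0 \<le> y" "\<And>\<nu>. c \<nu> * y < 1"
  shows "Im (Dl (of_real (- y))) = 0"
proof -
  have "d \<nu> * y > - 1" for \<nu>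
    using D.nonneg[of \<nu>] assms(1) mult_nonneg_nonneg[of "d \<nu>" y] by linarith
  then have "gprod c (of_real (- y)) \<noteq> 0" "gprod d (of_real y) \<noteq> 0"
    using assms(2) by (auto intro!: C.gprod_real_nonzero D.gprod_real_nonzero simp del: of_real_minus)
  then show ?thesis
    using C.logderiv_real_sums(2)[of "- y"] D.logderiv_real_sums(2)[of y] by (simp add: Dl_def)
qed

end

section \<open>Multiplicity of the \<alpha>-points\<close>

context pf_function
begin

lemma F_exp:
  assumes "u ^ k = 1"
  shows "F (u * exp (t / of_nat k)) = u ^ p * R t"
proof -
  have "exp (t / of_nat k) ^ k = exp t"
    using k_ge_2 by (simp flip: exp_of_nat_mult)
  then have k: "(u * exp (t / of_nat k)) ^ k = exp t"
    using assms by (simp add: power_mult_distrib)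
  have "exp (t / of_nat k) ^ p = exp (of_real \<eta> * t)"
    using k_ge_2 by (simp add: \<eta>_def flip: exp_of_nat_mult)
  then show ?thesis
    unfolding F_def k R_def num_def den_def by (simp add: power_mult_distrib exp_add)
qed

lemma F_cnj: "F (cnj z) = cnj (F z)"
proof -
  have "gprod c (cnj z ^ k) = cnj (gprod c (z ^ k))" "gprod d (- (cnj z ^ k)) = cnj (gprod d (- (z ^ k)))"
    using C.gprod_cnj[of "z ^ k"] D.gprod_cnj[of "- (z ^ k)"] by simp_all
  moreover have "exp (of_real A * cnj z ^ k) = cnj (exp (of_real A * z ^ k))"
    by (simp add: exp_cnj)
  ultimately show ?thesis
    by (simp add: F_def)
qed

lemma F_nonzeroD:
  assumes "F z \<noteq> 0"
  shows "z \<noteq> 0" "gprod c (z ^ k) \<noteq> 0" "gprod d (- (z ^ k)) \<noteq> 0"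
  using assms p_pos by (auto simp: F_def)

lemma level_R:
  assumes "level \<rho> \<gamma> t" "\<rho> > 0"
  shows "R t = of_real \<rho> * cis \<gamma>"
proof -
  have "R t = exp (logF t)"
    using exp_logF assms(1) by (simp add: level_def R_def)
  also have "\<dots> = of_real (exp (ln \<rho>)) * cis \<gamma>"
    using assms(1) exp_eq_polar[of "logF t"] by (simp add: level_def del: exp_ln)
  finally show ?thesis
    using assms(2) by simp
qed

lemma level_of_norm_R:
  assumes "t \<in> strip" "norm (R t) = \<rho>" "\<rho> > 0"
  shows "level \<rho> (Im (logF t)) t"
proof -
  have reg: "regular t"
    using assms by (auto simp: regular_def R_def)
  moreover have "exp (Re (logF t)) = \<rho>"
    using exp_logF[OF reg] assms(2) norm_exp_eq_Re by (metis R_def)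
  ultimately show ?thesis
    by (auto simp: level_def)
qed

lemma F_holomorphic: "F holomorphic_on {z. gprod d (- (z ^ k)) \<noteq> 0}"
  unfolding F_def by (intro holomorphic_intros C.gprod_holomorphic D.gprod_holomorphic) auto

lemma open_regular_F: "open {z. gprod c (z ^ k) \<noteq> 0 \<and> gprod d (- (z ^ k)) \<noteq> 0 \<and> z \<noteq> 0}"
proof -
  have "(\<lambda>z. gprod c (z ^ k)) holomorphic_on UNIV" "(\<lambda>z. gprod d (- (z ^ k))) holomorphic_on UNIV"
    by (intro holomorphic_intros C.gprod_holomorphic D.gprod_holomorphic)+
  then have "continuous_on UNIV (\<lambda>z. gprod c (z ^ k))" "continuous_on UNIV (\<lambda>z. gprod d (- (z ^ k)))"
    by (auto intro: holomorphic_on_imp_continuous_on)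
  then show ?thesis
    by (intro open_Collect_conj open_Collect_neq) (auto intro: continuous_intros)
qed

lemma F_analytic:
  assumes "F z \<noteq> 0"
  shows "F analytic_on {z}"
proof -
  let ?S = "{z. gprod c (z ^ k) \<noteq> 0 \<and> gprod d (- (z ^ k)) \<noteq> 0 \<and> z \<noteq> 0}"
  have "F holomorphic_on ?S"
    by (rule holomorphic_on_subset[OF F_holomorphic]) auto
  moreover have "z \<in> ?S"
    using F_nonzeroD[OF assms] by simp
  ultimately show ?thesis
    using open_regular_F analytic_at by blast
qed

lemma deriv_F:
  assumes "F z \<noteq> 0"
  shows "deriv F z = F z * (of_nat k / z * Dl (z ^ k))"
  using F_has_logderiv[OF F_nonzeroD[OF assms]] by (simp add: has_logderiv_def DERIV_imp_deriv)

lemma deriv_F_nonzero: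
  assumes "F z \<noteq> 0" "Dl (z ^ k) \<noteq> 0"
  shows "deriv F z \<noteq> 0"
  using assms F_nonzeroD[OF assms(1)] k_ge_2 by (simp add: deriv_F)

lemma deriv_F_minus:
  assumes "F z \<noteq> 0"
  shows "deriv (\<lambda>z. F z - \<alpha>) z = F z * (of_nat k / z * Dl (z ^ k))"
proof -
  have "((\<lambda>z. F z - \<alpha>) has_field_derivative F z * (of_nat k / z * Dl (z ^ k)) - 0) (at z)"
    using F_has_logderiv[OF F_nonzeroD[OF assms]] unfolding has_logderiv_def
    by (intro DERIV_diff DERIV_const)
  then show ?thesis
    by (simp add: DERIV_imp_deriv)
qed

lemma zorder_simple:
  assumes "F z = \<alpha>" "\<alpha> \<noteq> 0" "Dl (z ^ k) \<noteq> 0"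
  shows "zorder (\<lambda>z. F z - \<alpha>) z = 1"
proof (rule zorder_zero_eqI')
  have nz: "F z \<noteq> 0"
    using assms by simp
  show "(\<lambda>z. F z - \<alpha>) analytic_on {z}"
    by (intro analytic_intros F_analytic nz)
  show "(deriv ^^ i) (\<lambda>z. F z - \<alpha>) z = 0" if "i < nat 1" for i
    using that assms(1) by simp
  show "(deriv ^^ nat 1) (\<lambda>z. F z - \<alpha>) z \<noteq> 0"
    using assms nz F_nonzeroD[OF nz] k_ge_2 by (simp add: deriv_F_minus)
qed simp

lemma Dl_holomorphic: "Dl holomorphic_on {w. gprod c w \<noteq> 0 \<and> gprod d (- w) \<noteq> 0}"
proof -
  have P: "gprod c holomorphic_on UNIV" "gprod d holomorphic_on UNIV"
    using C.gprod_holomorphic[of "\<lambda>z. z" UNIV] D.gprod_holomorphic[of "\<lambda>z. z" UNIV] by simp_all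
  then have "deriv (gprod c) holomorphic_on UNIV" "deriv (gprod d) holomorphic_on UNIV"
    by (auto intro: holomorphic_deriv)
  moreover have "(\<lambda>w. - w) holomorphic_on (UNIV :: complex set)"
    by (intro holomorphic_intros)
  ultimately have dd: "(\<lambda>w. deriv (gprod d) (- w)) holomorphic_on S"
    and dc: "deriv (gprod c) holomorphic_on S" for S
    using holomorphic_on_compose_gen[of "\<lambda>w. - w" UNIV "deriv (gprod d)" UNIV] holomorphic_on_subset
    by (force simp: o_def)+
  show ?thesis
    unfolding Dl_def
    by (intro holomorphic_on_add holomorphic_on_diff holomorphic_on_mult holomorphic_on_divide
        holomorphic_on_minus holomorphic_on_const holomorphic_on_ident dc dd
        C.gprod_holomorphic[of "\<lambda>z. z", simplified] D.gprod_holomorphic) auto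
qed

text \<open>Re (Dl (- x)) + c 0 * x does not increase in x. If the derivative of \<open>Dl\<close>
  vanished, this function would have the positive derivative \<open>c 0\<close> at y.\<close>

lemma deriv_Dl_negative_axis:
  assumes "y > 0" "\<And>\<nu>. c \<nu> * y < 1" "gprod c (of_real (- y)) \<noteq> 0" "gprod d (of_real y) \<noteq> 0"
  shows "(Dl has_field_derivative deriv Dl (of_real (- y))) (at (of_real (- y)))"
    and "deriv Dl (of_real (- y)) \<noteq> 0"
proof -
  let ?S = "{w. gprod c w \<noteq> 0 \<and> gprod d (- w) \<noteq> 0}"
  have "gprod c holomorphic_on UNIV" "(\<lambda>w. gprod d (- w)) holomorphic_on UNIV"
    by (intro holomorphic_intros C.gprod_holomorphic[of "\<lambda>z. z", simplified] D.gprod_holomorphic)+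
  then have "continuous_on UNIV (gprod c)" "continuous_on UNIV (\<lambda>w. gprod d (- w))"
    by (auto intro: holomorphic_on_imp_continuous_on)
  then have "open ?S"
    by (intro open_Collect_conj open_Collect_neq) (auto intro: continuous_intros)
  then show der: "(Dl has_field_derivative deriv Dl (of_real (- y))) (at (of_real (- y)))"
    using assms(3,4) by (intro holomorphic_derivI[OF Dl_holomorphic]) auto
  have "((\<lambda>x. of_real (- x) :: complex) has_vector_derivative - 1) (at y)"
    by (auto simp: has_vector_derivative_def scaleR_conv_of_real intro!: derivative_eq_intros)
  from field_vector_diff_chain_at[OF this der]
  have "((\<lambda>x. Dl (of_real (- x))) has_vector_derivative - deriv Dl (of_real (- y))) (at y)"
    by (simp add: o_def)
  then have "((\<lambda>x. Re (Dl (of_real (- x)))) has_vector_derivative Re (- deriv Dl (of_real (- y)))) (at y)"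
    by (rule bounded_linear.has_vector_derivative[OF bounded_linear_Re])
  then have der_Re: "((\<lambda>x. Re (Dl (of_real (- x)))) has_real_derivative Re (- deriv Dl (of_real (- y)))) (at y)"
    by (simp only: has_real_derivative_iff_has_vector_derivative)
  have "((\<lambda>x. Re (Dl (of_real (- x))) + c 0 * x) has_real_derivative Re (- deriv Dl (of_real (- y))) + c 0 * 1) (at y)"
    by (intro DERIV_add der_Re DERIV_cmult DERIV_ident)
  moreover have False if der0: "((\<lambda>x. Re (Dl (of_real (- x))) + c 0 * x) has_real_derivative c 0) (at y)"
  proof -
    obtain e where e: "e > 0" "\<And>h. 0 < h \<Longrightarrow> h < e \<Longrightarrow>
        Re (Dl (of_real (- (y - h)))) + c 0 * (y - h) < Re (Dl (of_real (- y))) + c 0 * y"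
      using DERIV_pos_inc_left[OF der0 c_pos] by blast
    define h where "h = min (e / 2) y"
    have h: "0 < h" "h < e" "h \<le> y"
      using e(1) assms(1) by (auto simp: h_def)
    have "Re (Dl (of_real (- y))) \<le> Re (Dl (of_real (- (y - h)))) - c 0 * (y - (y - h))"
      using h assms(2) by (intro Dl_negative_axis) auto
    then show False
      using e(2)[OF h(1,2)] by (simp add: algebra_simps)
  qed
  ultimately show "deriv Dl (of_real (- y)) \<noteq> 0"
    by auto
qed

text \<open>F' is F * (k / z) * Dl (z^k). Where \<open>Dl\<close> vanishes, only the term with the
  derivative of \<open>Dl\<close> survives in F'', and that derivative is nonzero.\<close>

lemma zorder_double:
  assumes "F z = \<alpha>" "\<alpha> \<noteq> 0" "z ^ k = of_real (- y)" "y > 0" "\<And>\<nu>. c \<nu> * y < 1" "Dl (of_real (- y)) = 0"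
  shows "zorder (\<lambda>z. F z - \<alpha>) z = 2"
proof (rule zorder_zero_eqI')
  have nz: "F z \<noteq> 0"
    using assms by simp
  note z = F_nonzeroD[OF nz]
  show "(\<lambda>z. F z - \<alpha>) analytic_on {z}"
    by (intro analytic_intros F_analytic nz)
  show "(deriv ^^ i) (\<lambda>z. F z - \<alpha>) z = 0" if i: "i < nat 2" for i
  proof -
    consider "i = 0" | "i = 1"
      using i by force
    then show ?thesis
      by cases (use assms nz in \<open>simp_all add: deriv_F_minus\<close>)
  qed
  let ?S = "{z. gprod c (z ^ k) \<noteq> 0 \<and> gprod d (- (z ^ k)) \<noteq> 0 \<and> z \<noteq> 0}"
  have der: "deriv (\<lambda>z. F z - \<alpha>) v = F v * (of_nat k / v) * Dl (v ^ k)" if "v \<in> ?S" for v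
  proof -
    have "((\<lambda>z. F z - \<alpha>) has_field_derivative F v * (of_nat k / v * Dl (v ^ k)) - 0) (at v)"
      using F_has_logderiv[of v] that unfolding has_logderiv_def
      by (intro DERIV_diff DERIV_const) auto
    then show ?thesis
      by (simp add: DERIV_imp_deriv)
  qed
  have "((\<lambda>v. v ^ k) has_field_derivative (of_nat k * z ^ (k - 1))) (at z)"
    by (auto intro!: derivative_eq_intros)
  moreover have "(Dl has_field_derivative deriv Dl (z ^ k)) (at (z ^ k))"
    using deriv_Dl_negative_axis(1)[of y] assms z by simp
  ultimately have chain: "((\<lambda>v. Dl (v ^ k)) has_field_derivative deriv Dl (z ^ k) * (of_nat k * z ^ (k - 1))) (at z)"
    by (intro DERIV_chain2[where f = Dl])
  have "(F has_field_derivative F z * (of_nat k / z * Dl (z ^ k))) (at z)"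
    using F_has_logderiv[OF z] by (simp add: has_logderiv_def)
  moreover have "((\<lambda>v. of_nat k / v) has_field_derivative - of_nat k / z\<^sup>2) (at z)"
    using z(1) by (auto intro!: derivative_eq_intros simp: power2_eq_square)
  ultimately obtain E where
    E: "((\<lambda>v. F v * (of_nat k / v)) has_field_derivative E) (at z)"
    using DERIV_mult by blast
  have "((\<lambda>v. F v * (of_nat k / v) * Dl (v ^ k)) has_field_derivative
      F z * (of_nat k / z) * (deriv Dl (z ^ k) * (of_nat k * z ^ (k - 1)))) (at z)"
    using DERIV_mult[OF E chain] assms(3,6) by (simp add: mult.commute)
  then have "(deriv (\<lambda>z. F z - \<alpha>) has_field_derivative
      F z * (of_nat k / z) * (deriv Dl (z ^ k) * (of_nat k * z ^ (k - 1)))) (at z)"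
    by (rule has_field_derivative_transform_within_open[OF _ open_regular_F]) (use z der in auto)
  then have "deriv (deriv (\<lambda>z. F z - \<alpha>)) z =
      F z * (of_nat k / z) * (deriv Dl (z ^ k) * (of_nat k * z ^ (k - 1)))"
    by (rule DERIV_imp_deriv)
  moreover have "deriv Dl (z ^ k) \<noteq> 0"
    using deriv_Dl_negative_axis(2)[of y] assms z by simp
  ultimately show "(deriv ^^ nat 2) (\<lambda>z. F z - \<alpha>) z \<noteq> 0"
    using nz z(1) k_ge_2 by (simp add: numeral_2_eq_2)
qed simp

end

section \<open>Level points on the upper edge\<close>

context pf_function
begin

text \<open>The argument exceeds \<eta> * pi by pi for each zero passed, so it equals \<eta> * pi
  only before the first zero.\<close>

lemma level_top_iff:
  assumes "\<rho> > 0"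
  shows "level \<rho> (\<eta> * pi) (Complex x pi) \<longleftrightarrow> (\<forall>\<nu>. c \<nu> * exp x < 1) \<and> \<Psi> \<rho> (Complex x pi) = 0"
proof
  assume L: "level \<rho> (\<eta> * pi) (Complex x pi)"
  then have reg: "regular (Complex x pi)"
    by (simp add: level_def)
  have "pi * real (card {\<nu>. c \<nu> * exp x > 1}) = 0"
    using Im_logF_top[OF _ reg] L by (simp add: level_def)
  then have "{\<nu>. c \<nu> * exp x > 1} = {}"
    using C.finite_large_factors[of x] by simp
  then have "\<not> c \<nu> * exp x > 1" for \<nu>
    by blast
  moreover have "c \<nu> * exp x \<noteq> 1" for \<nu>
    using regular_top_iff[of "Complex x pi"] reg by simp
  ultimately have "c \<nu> * exp x < 1" for \<nu>
    by (meson linorder_neqE)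
  moreover have "\<Psi> \<rho> (Complex x pi) = 0"
    using L \<Psi>_eq_0_iff[OF reg assms] by (simp add: level_def)
  ultimately show "(\<forall>\<nu>. c \<nu> * exp x < 1) \<and> \<Psi> \<rho> (Complex x pi) = 0"
    by blast
next
  assume *: "(\<forall>\<nu>. c \<nu> * exp x < 1) \<and> \<Psi> \<rho> (Complex x pi) = 0"
  then have reg: "regular (Complex x pi)"
    using regular_if_\<Psi>_0[of "Complex x pi"] assms by simp
  have "{\<nu>. c \<nu> * exp x > 1} = {}"
    using * less_asym by blast
  then show "level \<rho> (\<eta> * pi) (Complex x pi)"
    using reg Im_logF_top[OF _ reg] \<Psi>_eq_0_iff[OF reg assms] * by (simp add: level_def)
qed

lemma below_first_zero_mono:
  assumes "\<forall>\<nu>. c \<nu> * exp x < 1" "y \<le> x"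
  shows "\<forall>\<nu>. c \<nu> * exp y < 1"
proof
  fix \<nu>
  have "c \<nu> * exp y \<le> c \<nu> * exp x"
    using assms(2) C.nonneg by (intro mult_left_mono) auto
  then show "c \<nu> * exp y < 1"
    using assms(1) le_less_trans by blast
qed

text \<open>On the upper edge, left of the first zero of the numerator, \<^term>\<open>R\<close> is a positive function
  times a constant of modulus one.\<close>

definition top :: "real \<Rightarrow> real" where
  "top x = Re (R (Complex x pi) * cis (- (\<eta> * pi)))"

lemma top_regular:
  assumes "\<forall>\<nu>. c \<nu> * exp x < 1"
  shows "regular (Complex x pi)"
  using assms regular_top_iff[of "Complex x pi"] by (auto dest: spec less_imp_neq)

lemma R_top:
  assumes "\<forall>\<nu>. c \<nu> * exp x < 1"
  shows "R (Complex x pi) * cis (- (\<eta> * pi)) = of_real (top x)" "top x > 0"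
proof -
  note reg = top_regular[OF assms]
  have "{\<nu>. c \<nu> * exp x > 1} = {}"
    using assms less_asym by blast
  then have "level (exp (Re (logF (Complex x pi)))) (\<eta> * pi) (Complex x pi)"
    using reg Im_logF_top[OF _ reg] by (simp add: level_def)
  from level_R[OF this exp_gt_zero]
  have "R (Complex x pi) * cis (- (\<eta> * pi)) = of_real (exp (Re (logF (Complex x pi))))"
    by (simp add: cis_mult mult.assoc)
  then show "R (Complex x pi) * cis (- (\<eta> * pi)) = of_real (top x)" "top x > 0"
    by (simp_all add: top_def)
qed

lemma \<Psi>_top:
  assumes "\<forall>\<nu>. c \<nu> * exp x < 1"
  shows "\<Psi> \<rho> (Complex x pi) = norm (den (Complex x pi)) * (top x - \<rho>)" "den (Complex x pi) \<noteq> 0"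
proof -
  note reg = top_regular[OF assms]
  have "norm (R (Complex x pi) * cis (- (\<eta> * pi))) = top x"
    using R_top[OF assms] by simp
  then have "exp (Re (logF (Complex x pi))) = top x"
    using exp_logF[OF reg] norm_exp_eq_Re by (metis R_def norm_cis norm_mult mult.right_neutral)
  then show "\<Psi> \<rho> (Complex x pi) = norm (den (Complex x pi)) * (top x - \<rho>)" "den (Complex x pi) \<noteq> 0"
    using \<Psi>_regular[OF reg] reg by (simp_all add: regular_def)
qed

lemma top_has_derivative:
  assumes "\<forall>\<nu>. c \<nu> * exp x < 1"
  shows "(top has_real_derivative top x * Re (Dl (of_real (- exp x)))) (at x)"
proof -
  have "((\<lambda>x. of_real x + \<i> * of_real pi) has_vector_derivative 1) (at x)"
    by (auto simp: has_vector_derivative_def scaleR_conv_of_real intro!: derivative_eq_intros)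
  then have "((\<lambda>x. Complex x pi) has_vector_derivative 1) (at x)"
    by (simp add: Complex_eq)
  moreover have "(R has_field_derivative R (Complex x pi) * Dl (exp (Complex x pi))) (at (Complex x pi))"
    using R_has_logderiv[OF top_regular[OF assms]] by (simp add: has_logderiv_def)
  moreover have "exp (Complex x pi) = of_real (- exp x)"
    by (simp add: complex_eq_iff Re_exp Im_exp)
  ultimately have "((\<lambda>x. R (Complex x pi)) has_vector_derivative
      R (Complex x pi) * Dl (of_real (- exp x))) (at x)"
    using field_vector_diff_chain_at by (fastforce simp: o_def)
  then have "((\<lambda>x. R (Complex x pi) * cis (- (\<eta> * pi))) has_vector_derivative
      R (Complex x pi) * Dl (of_real (- exp x)) * cis (- (\<eta> * pi))) (at x)"
    by (rule has_vector_derivative_mult_left)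
  then have "(top has_vector_derivative
      Re (R (Complex x pi) * Dl (of_real (- exp x)) * cis (- (\<eta> * pi)))) (at x)"
    unfolding top_def[abs_def] by (rule bounded_linear.has_vector_derivative[OF bounded_linear_Re])
  moreover have "R (Complex x pi) * Dl (of_real (- exp x)) * cis (- (\<eta> * pi)) =
      of_real (top x) * Dl (of_real (- exp x))"
    unfolding R_top(1)[OF assms, symmetric] by (simp only: mult_ac)
  ultimately show ?thesis
    unfolding has_real_derivative_iff_has_vector_derivative by (simp only: Re_complex_of_real Re_divide) simp
qed

text \<open>The logarithmic derivative of \<open>top\<close>.\<close>

definition \<delta> :: "real \<Rightarrow> real" where
  "\<delta> x = Re (Dl (of_real (- exp x)))"

lemma \<delta>_strict_antimono:
  assumes "\<forall>\<nu>. c \<nu> * exp y < 1" "x < y"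
  shows "\<delta> y < \<delta> x"
proof -
  have "\<delta> y \<le> \<delta> x - c 0 * (exp y - exp x)"
    unfolding \<delta>_def using assms by (intro Dl_negative_axis) auto
  moreover have "c 0 * (exp y - exp x) > 0"
    using assms(2) c_pos by simp
  ultimately show ?thesis
    by linarith
qed

lemma \<delta>_0_imp_Dl_0:
  assumes "\<forall>\<nu>. c \<nu> * exp x < 1" "\<delta> x = 0"
  shows "Dl (of_real (- exp x)) = 0"
  using Dl_real_negative[of "exp x"] assms by (simp add: \<delta>_def complex_eq_iff)

text \<open>Rolle gives a critical point between the two roots, and \<delta> decreases strictly
  through it.\<close>

lemma top_roots_derivative:
  assumes x: "top x = \<rho>" and y: "top y = \<rho>" "\<forall>\<nu>. c \<nu> * exp y < 1" and "x < y"
  shows "\<delta> x > 0" "\<delta> y < 0"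
proof -
  have low: "\<forall>\<nu>. c \<nu> * exp z < 1" if "z \<le> y" for z
    using below_first_zero_mono[OF y(2)] that by blast
  have "\<exists>z>x. z < y \<and> (\<lambda>h. (top z * \<delta> z) * h) = (\<lambda>h. 0)"
  proof (rule Rolle_deriv[OF \<open>x < y\<close>])
    show "top x = top y"
      using x y by simp
    show "continuous_on {x..y} top"
      using top_has_derivative low
      by (intro continuous_at_imp_continuous_on ballI DERIV_isCont) auto
    show "(top has_derivative (\<lambda>h. (top z * \<delta> z) * h)) (at z)" if "x < z" "z < y" for z
      using top_has_derivative[OF low[of z]] that
      by (simp add: \<delta>_def has_field_derivative_def)
  qed
  then obtain z where xz: "x < z" "z < y" and "(\<lambda>h. (top z * \<delta> z) * h) = (\<lambda>h. 0)"
    by blast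
  from fun_cong[OF this(3), of 1] have "top z * \<delta> z = 0"
    by simp
  moreover have "top z > 0"
    using R_top(2)[OF low] xz(2) by simp
  ultimately have z: "x < z" "z < y" "\<delta> z = 0"
    using xz by auto
  show "\<delta> x > 0" "\<delta> y < 0"
    using \<delta>_strict_antimono[OF low[of z], of x] \<delta>_strict_antimono[OF low[of y], of z] z by auto
qed

text \<open>At a root with \<delta> \<noteq> 0 the graph crosses the height \<rho>. As
  \<open>\<Psi> \<rho>\<close> is negative both at the far left and at the first zero, the side on
  which \<open>top\<close> exceeds \<rho> must contain a second root.\<close>

lemma top_other_root:
  assumes "\<rho> > 0" "\<forall>\<nu>. c \<nu> * exp x < 1" "top x = \<rho>" "\<delta> x \<noteq> 0"
  obtains x' where "x' \<noteq> x" "\<forall>\<nu>. c \<nu> * exp x' < 1" "\<Psi> \<rho> (Complex x' pi) = 0"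
proof -
  obtain \<mu> where \<mu>: "c \<mu> > 0" "\<And>\<nu>. c \<nu> \<le> c \<mu>"
    using C.attains_max[OF c_pos] by blast
  let ?b = "- ln (c \<mu>)"
  have low: "(\<forall>\<nu>. c \<nu> * exp y < 1) \<longleftrightarrow> y < ?b" for y
  proof
    assume "y < ?b"
    then have "c \<mu> * exp y < 1"
      using less_pole_iff[OF \<mu>(1)] by blast
    then show "\<forall>\<nu>. c \<nu> * exp y < 1"
      using \<mu>(2) by (meson exp_ge_zero le_less_trans mult_right_mono)
  qed (use less_pole_iff[OF \<mu>(1)] in blast)
  have der: "(top has_real_derivative top x * \<delta> x) (at x)"
    using top_has_derivative[OF assms(2)] by (simp add: \<delta>_def)
  show thesis
  proof (cases "\<delta> x > 0")
    case True
    then obtain e where e: "e > 0" "\<And>h. 0 < h \<Longrightarrow> h < e \<Longrightarrow> top x < top (x + h)"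
      using DERIV_pos_inc_right[OF der] R_top(2)[OF assms(2)] by auto
    define h where "h = min (e / 2) ((?b - x) / 2)"
    have h: "0 < h" "h < e" "x + h < ?b"
      using e(1) low[of x] assms(2) by (auto simp: h_def min_def field_simps)
    have pos: "\<Psi> \<rho> (Complex (x + h) pi) > 0"
      using \<Psi>_top(1)[of "x + h" \<rho>] \<Psi>_top(2)[of "x + h"] low h e(2)[of h] assms(3) by auto
    have neg: "\<Psi> \<rho> (Complex ?b pi) < 0"
      by (rule \<Psi>_zero[OF _ num_top_zero[OF \<mu>(1)] assms(1)]) simp
    obtain x' where x': "x + h \<le> x'" "x' \<le> ?b" "\<Psi> \<rho> (Complex x' pi) = 0"
      using IVT2'[of "\<lambda>x. \<Psi> \<rho> (Complex x pi)" ?b 0 "x + h"] pos neg h(3) \<Psi>_horizontal_continuous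
      by force
    have "x' \<noteq> ?b"
      using x'(3) neg by auto
    then show thesis
      using that[of x'] x' low h(1) by auto
  next
    case False
    then have "top x * \<delta> x < 0"
      using assms(4) R_top(2)[OF assms(2)] by (simp add: mult_pos_neg)
    then obtain e where e: "e > 0" "\<And>h. 0 < h \<Longrightarrow> h < e \<Longrightarrow> top x < top (x - h)"
      using DERIV_neg_dec_left[OF der] by auto
    define h where "h = e / 2"
    have h: "0 < h" "h < e" "x - h < ?b"
      using e(1) low[of x] assms(2) by (auto simp: h_def)
    have pos: "\<Psi> \<rho> (Complex (x - h) pi) > 0"
      using \<Psi>_top(1)[of "x - h" \<rho>] \<Psi>_top(2)[of "x - h"] low h e(2)[of h] assms(3) by auto
    obtain x0 where x0: "\<And>t. t \<in> strip \<Longrightarrow> Re t \<le> x0 \<Longrightarrow> \<Psi> \<rho> t < 0"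
      using \<Psi>_left[OF assms(1)] by blast
    have neg: "\<Psi> \<rho> (Complex x0 pi) < 0"
      using x0 by simp
    have "x0 \<le> x - h"
      using x0[of "Complex (x - h) pi"] pos by force
    then obtain x' where x': "x0 \<le> x'" "x' \<le> x - h" "\<Psi> \<rho> (Complex x' pi) = 0"
      using IVT'[of "\<lambda>x. \<Psi> \<rho> (Complex x pi)" x0 0 "x - h"] pos neg \<Psi>_horizontal_continuous
      by force
    then show thesis
      using that[of x'] low h by auto
  qed
qed

text \<open>Of two roots the left has \<delta> > 0 and the right \<delta> < 0, so among three roots
  the middle one would have both signs. A single root must have \<delta> = 0 by
  \<open>top_other_root\<close>.\<close>

lemma top_levels:
  assumes "\<rho> > 0" "level \<rho> (\<eta> * pi) (Complex x0 pi)"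
  obtains (double) x where "\<And>y. level \<rho> (\<eta> * pi) (Complex y pi) \<longleftrightarrow> y = x" "Dl (of_real (- exp x)) = 0"
  | (simple) x1 x2 where "x1 < x2"
    "\<And>y. level \<rho> (\<eta> * pi) (Complex y pi) \<longleftrightarrow> y = x1 \<or> y = x2"
    "Dl (of_real (- exp x1)) \<noteq> 0" "Dl (of_real (- exp x2)) \<noteq> 0"
proof -
  let ?L = "\<lambda>x. level \<rho> (\<eta> * pi) (Complex x pi)"
  have L: "?L x \<longleftrightarrow> (\<forall>\<nu>. c \<nu> * exp x < 1) \<and> top x = \<rho>" for x
    using level_top_iff[OF assms(1)] \<Psi>_top(1)[of x \<rho>] \<Psi>_top(2)[of x] by auto
  have der: "\<delta> x > 0" "\<delta> y < 0" if "?L x" "?L y" "x < y" for x y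
    using that top_roots_derivative[of x \<rho> y] by (auto simp: L)
  show thesis
  proof (cases "\<exists>x. ?L x \<and> x \<noteq> x0")
    case True
    then obtain x1 x2 where x: "?L x1" "?L x2" "x1 < x2"
      using assms(2) by (metis linorder_neqE)
    have "y = x1 \<or> y = x2" if "?L y" for y
    proof (rule ccontr)
      assume "\<not> (y = x1 \<or> y = x2)"
      then consider "y < x1" | "x1 < y" "y < x2" | "x2 < y"
        by linarith
      then show False
        by cases (use der[OF x] der[OF that x(1)] der[OF x(1) that] der[OF that x(2)] der[OF x(2) that] in auto)
    qed
    then have "?L y \<longleftrightarrow> y = x1 \<or> y = x2" for y
      using x by blast
    moreover have "Dl (of_real (- exp x1)) \<noteq> 0" "Dl (of_real (- exp x2)) \<noteq> 0"
      using der[OF x] by (auto simp: \<delta>_def)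
    ultimately show thesis
      using simple x(3) by blast
  next
    case False
    then have unique: "?L y \<longleftrightarrow> y = x0" for y
      using assms(2) by blast
    have low: "\<forall>\<nu>. c \<nu> * exp x0 < 1" "top x0 = \<rho>"
      using assms(2) L by auto
    have "\<delta> x0 = 0"
    proof (rule ccontr)
      assume "\<delta> x0 \<noteq> 0"
      then obtain x' where "x' \<noteq> x0" "\<forall>\<nu>. c \<nu> * exp x' < 1" "\<Psi> \<rho> (Complex x' pi) = 0"
        using top_other_root[OF assms(1) low] by blast
      then show False
        using unique level_top_iff[OF assms(1)] by blast
    qed
    then show thesis
      using double unique \<delta>_0_imp_Dl_0[OF low(1)] by blast
  qed
qed

end

section \<open>The location of the alpha-points\<close>

lemma cis_eq_cis_iff: "cis x = cis y \<longleftrightarrow> (\<exists>n::int. x = y + 2 * pi * of_int n)"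
  using sin_cos_eq_iff[of x y] by (auto simp: complex_eq_iff)

lemma cis_add_2pi_int: "cis (2 * pi * of_int n + x) = cis x"
  unfolding cis_eq_cis_iff by (auto intro!: exI[of _ n])

context pf_function
begin

lemma k_pos [simp]: "k > 0" "k \<noteq> 0"
  using k_ge_2 by auto

text \<open>The integer \<^term>\<open>j\<close> numbers the rays of argument 2 * pi * j / k, and the sign
  \<^term>\<open>s\<close> distinguishes the two sectors adjacent to such a ray.\<close>

definition pt :: "int \<Rightarrow> int \<Rightarrow> complex \<Rightarrow> complex" where
  "pt j s t = of_real (exp (Re t / k)) * cis (2 * pi * of_int j / k + of_int s * Im t / k)"

lemma norm_pt [simp]: "cmod (pt j s t) = exp (Re t / k)"
  by (simp add: pt_def norm_mult)

lemma pt_nonzero [simp]: "pt j s t \<noteq> 0"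
  by (simp add: pt_def)

lemma pt_power: "pt j s t ^ k = of_real (exp (Re t)) * cis (of_int s * Im t)"
proof -
  have "real k * (2 * pi * of_int j / k + of_int s * Im t / k) = 2 * pi * of_int j + of_int s * Im t"
    by (simp add: field_simps)
  moreover have "exp (Re t / k) ^ k = exp (Re t)"
    by (simp flip: exp_of_nat_mult)
  ultimately show ?thesis
    unfolding pt_def power_mult_distrib Complex.DeMoivre
    by (simp only: cis_add_2pi_int flip: of_real_power)
qed

lemma pt_cong:
  assumes "[j = j'] (mod int k)"
  shows "pt j s t = pt j' s t"
proof -
  obtain n where "j' = j + int k * n"
    using assms by (auto simp: cong_iff_lin)
  then have "2 * pi * of_int j' / k + of_int s * Im t / k =
      2 * pi * of_int n + (2 * pi * of_int j / k + of_int s * Im t / k)"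
    by (simp add: field_simps)
  then show ?thesis
    unfolding pt_def by (simp only: cis_add_2pi_int)
qed

lemma F_pt_pos: "F (pt j 1 t) = cis (2 * pi * real p * of_int j / k) * R t"
proof -
  have "exp (t / of_nat k) = of_real (exp (Re t / k)) * cis (Im t / k)"
    using exp_eq_polar[of "t / of_nat k"] by simp
  then have "pt j 1 t = cis (2 * pi * of_int j / k) * exp (t / of_nat k)"
    by (simp add: pt_def flip: cis_mult)
  moreover have "cis (2 * pi * of_int j / k) ^ k = 1"
    unfolding Complex.DeMoivre using cis_add_2pi_int[of j 0] by simp
  moreover have "cis (2 * pi * of_int j / k) ^ p = cis (2 * pi * real p * of_int j / k)"
    unfolding Complex.DeMoivre by (simp add: mult.assoc mult.left_commute)
  ultimately show ?thesis
    using F_exp by simp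
qed

lemma F_pt_neg: "F (pt j (-1) t) = cis (2 * pi * real p * of_int j / k) * cnj (R t)"
proof -
  have "pt j (-1) t = cnj (pt (- j) 1 t)"
    by (simp add: pt_def cis_cnj)
  then show ?thesis
    using F_pt_pos[of "- j" t] by (simp add: F_cnj cis_cnj)
qed

lemma F_pt_level:
  assumes "level \<rho> \<gamma> t" "\<rho> > 0" "s = 1 \<or> s = -1"
  shows "F (pt j s t) = of_real \<rho> * cis (2 * pi * real p * of_int j / k + of_int s * \<gamma>)"
  using assms(3)
proof
  assume "s = 1"
  then show ?thesis
    by (simp add: F_pt_pos level_R[OF assms(1,2)] flip: cis_mult)
next
  assume "s = -1"
  then show ?thesis
    by (simp add: F_pt_neg level_R[OF assms(1,2)] cis_cnj cis_mult)
qed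

lemma norm_F_pt: "s = 1 \<or> s = -1 \<Longrightarrow> norm (F (pt j s t)) = norm (R t)"
  by (auto simp: F_pt_pos F_pt_neg norm_mult)

lemma pt_exhaust:
  assumes "z \<noteq> 0"
  obtains j s t where "t \<in> strip" "s = 1 \<or> s = -1" "z = pt j s t"
proof -
  \<comment> \<open>Rounding to the nearest integer picks the closest ray of argument 2 * pi * j /
    k; \<open>a\<close> is then k times the signed angle to it and lies in [-pi, pi).\<close>
  define j where "j = \<lfloor>Arg z * k / (2 * pi) + 1 / 2\<rfloor>"
  define a where "a = Arg z * k - 2 * pi * of_int j"
  define s :: int where "s = (if a \<ge> 0 then 1 else - 1)"
  define t where "t = Complex (real k * ln (cmod z)) \<bar>a\<bar>"
  have "of_int j \<le> Arg z * k / (2 * pi) + 1 / 2" "Arg z * k / (2 * pi) + 1 / 2 < of_int j + 1"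
    unfolding j_def by linarith+
  then have "2 * pi * of_int j \<le> Arg z * k + pi" "Arg z * k < 2 * pi * of_int j + pi"
    by (simp_all add: field_simps)
  then have "t \<in> strip"
    by (auto simp: t_def strip_def a_def)
  have "of_int s * Im t = a"
    by (simp add: s_def t_def)
  then have "2 * pi * of_int j / k + of_int s * Im t / k = Arg z"
    by (simp add: a_def field_simps)
  moreover have "exp (Re t / k) = cmod z"
    using assms by (simp add: t_def)
  ultimately have "z = pt j s t"
    using rcis_cmod_Arg[of z] by (simp add: pt_def rcis_def)
  then show thesis
    using that \<open>t \<in> strip\<close> by (auto simp: s_def split: if_splits)
qed

text \<open>The increment inequality is not strict for two points of one edge. Instead, before the
  first pole \<open>R\<close> is positive with positive logarithmic derivative, hence strictly
  increasing.\<close>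

lemma bottom_level_unique_aux:
  assumes x: "level \<rho> 0 (Complex x 0)" and y: "level \<rho> 0 (Complex y 0)" and "\<rho> > 0" "x < y"
  shows False
proof -
  have "\<forall>\<nu>. d \<nu> * exp y < 1"
  proof -
    have reg: "regular (Complex y 0)"
      using y by (simp add: level_def)
    have "pi * real (card {\<nu>. d \<nu> * exp y > 1}) = 0"
      using Im_logF_bottom[OF _ reg] y by (simp add: level_def)
    then have "{\<nu>. d \<nu> * exp y > 1} = {}"
      using D.finite_large_factors[of y] by simp
    then have "\<not> d \<nu> * exp y > 1" "d \<nu> * exp y \<noteq> 1" for \<nu>
      using regular_bottom_iff[of "Complex y 0"] reg by auto
    then show ?thesis
      by (meson linorder_neqE)
  qed
  then have low: "d \<nu> * exp z < 1" if "z \<le> y" for z \<nu>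
    using that mult_left_mono[of "exp z" "exp y" "d \<nu>"] D.nonneg[of \<nu>] by (auto intro: le_less_trans)
  have reg: "regular (Complex z 0)" if "z \<le> y" for z
    using low[OF that] regular_bottom_iff[of "Complex z 0"] by (auto dest: less_imp_neq)
  have R: "Im (R (Complex z 0)) = 0" "Re (R (Complex z 0)) > 0" if z: "z \<le> y" for z
  proof -
    have "{\<nu>. d \<nu> * exp z > 1} = {}"
      using low[OF z] less_asym by blast
    then have "level (exp (Re (logF (Complex z 0)))) 0 (Complex z 0)"
      using reg[OF z] Im_logF_bottom[OF _ reg[OF z]] by (simp add: level_def)
    from level_R[OF this exp_gt_zero] show "Im (R (Complex z 0)) = 0" "Re (R (Complex z 0)) > 0"
      by simp_all
  qed
  have "Re (R (Complex x 0)) < Re (R (Complex y 0))"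
  proof (rule DERIV_pos_imp_increasing[OF \<open>x < y\<close>])
    fix z assume z: "x \<le> z" "z \<le> y"
    have "((\<lambda>z. of_real z + \<i> * of_real 0) has_vector_derivative 1) (at z)"
      by (auto simp: has_vector_derivative_def scaleR_conv_of_real intro!: derivative_eq_intros)
    then have "((\<lambda>z. Complex z 0) has_vector_derivative 1) (at z)"
      by (simp add: Complex_eq)
    moreover have "(R has_field_derivative R (Complex z 0) * Dl (exp (Complex z 0))) (at (Complex z 0))"
      using R_has_logderiv[OF reg[OF z(2)]] by (simp add: has_logderiv_def)
    moreover have "exp (Complex z 0) = of_real (exp z)"
      by (simp add: complex_eq_iff Re_exp Im_exp)
    ultimately have "((\<lambda>z. R (Complex z 0)) has_vector_derivative R (Complex z 0) * Dl (of_real (exp z))) (at z)"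
      using field_vector_diff_chain_at by (fastforce simp: o_def)
    then have "((\<lambda>z. Re (R (Complex z 0))) has_vector_derivative Re (R (Complex z 0) * Dl (of_real (exp z)))) (at z)"
      by (rule bounded_linear.has_vector_derivative[OF bounded_linear_Re])
    then have "((\<lambda>z. Re (R (Complex z 0))) has_real_derivative Re (R (Complex z 0)) * Re (Dl (of_real (exp z)))) (at z)"
      using R(1)[OF z(2)] by (simp add: has_real_derivative_iff_has_vector_derivative)
    moreover have "Re (Dl (of_real (exp z))) > 0"
      using Dl_positive_axis[of "exp z"] low[OF z(2)] by simp
    ultimately show "\<exists>D. ((\<lambda>z. Re (R (Complex z 0))) has_real_derivative D) (at z) \<and> D > 0"
      using R(2)[OF z(2)] mult_pos_pos by blast
  qed
  moreover have "R (Complex x 0) = R (Complex y 0)"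
    using level_R x y assms(3) by simp
  ultimately show False
    by simp
qed

text \<open>The bound \<eta> * pi keeps the point off the upper edge, the bound pi means that no
  pole has been passed on the lower edge.\<close>

lemma low_level_cases:
  assumes "level \<rho> \<gamma> t" "\<gamma> < pi" "\<gamma> < \<eta> * pi"
  shows "Im t = 0 \<and> \<gamma> = 0 \<or> 0 < Im t \<and> Im t < pi \<and> 0 < \<gamma>"
proof -
  have reg: "regular t" and V: "Im (logF t) = \<gamma>"
    using assms(1) by (auto simp: level_def)
  consider "Im t = 0" | "Im t = pi" | "0 < Im t" "Im t < pi"
    using regularD(1)[OF reg] by (force simp: strip_def)
  then show ?thesis
  proof cases
    case 1
    have "pi * real (card {\<nu>. d \<nu> * exp (Re t) > 1}) < pi * 1"
      using Im_logF_bottom[OF 1 reg] V assms(2) by simp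
    then have "card {\<nu>. d \<nu> * exp (Re t) > 1} = 0"
      unfolding mult_less_cancel_left_pos[OF pi_gt_zero] by linarith
    then show ?thesis
      using Im_logF_bottom[OF 1 reg] V 1 by simp
  next
    case 2
    then have "\<eta> * pi \<le> \<gamma>"
      using Im_logF_ge[OF reg] V by simp
    then show ?thesis
      using assms(3) by simp
  next
    case 3
    then have "0 < \<eta> * Im t" "\<eta> * Im t < \<gamma>"
      using Im_logF_gt[OF 3] V \<eta>_pos by simp_all
    then show ?thesis
      using 3 by linarith
  qed
qed

lemma low_level_unique:
  assumes "level \<rho> \<gamma> t" "level \<rho> \<gamma> u" "\<rho> > 0" "\<gamma> < pi" "\<gamma> < \<eta> * pi"
  shows "t = u"
proof -
  have reg: "regular t" "regular u" and eq: "logF t = logF u"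
    using assms(1,2) by (auto simp: level_def complex_eq_iff)
  consider "Im t = 0" "Im u = 0" "\<gamma> = 0" | "0 < Im t" "Im t < pi"
    using low_level_cases[OF assms(1,4,5)] low_level_cases[OF assms(2,4,5)] by auto
  then show ?thesis
  proof cases
    case 1
    then have "t = Complex (Re t) 0" "u = Complex (Re u) 0"
      by (simp_all add: complex_eq_iff)
    then show ?thesis
      using bottom_level_unique_aux[OF _ _ assms(3), of "Re t" "Re u"]
        bottom_level_unique_aux[OF _ _ assms(3), of "Re u" "Re t"] assms(1,2) 1(3)
      by (metis linorder_neqE)
  next
    case 2
    then show ?thesis
      using level_unique[OF reg eq] by (auto simp: same_edge_def)
  qed
qed

lemma pi_div_k: "pi / k < pi" "pi / k \<le> pi / 2" "pi / k \<le> \<eta> * pi"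
proof -
  show "pi / k \<le> pi / 2"
    using k_ge_2 by (intro divide_left_mono) auto
  then show "pi / k < pi"
    using pi_gt_zero by linarith
  have "1 * pi \<le> real p * pi"
    using p_pos by (intro mult_right_mono) auto
  then show "pi / k \<le> \<eta> * pi"
    by (simp add: \<eta>_def divide_right_mono)
qed

end

section \<open>Roots of unity, sectors and signs of polar forms\<close>

lemma unit_root_cis: "unit_root k s = cis (pi * of_int s / k)"
  by (simp add: unit_root_def cis_conv_exp mult_ac)

lemma unit_root_cong:
  assumes "[a = b] (mod 2 * int k)" "k > 0"
  shows "unit_root k a = unit_root k b"
proof -
  obtain n where "b = a + 2 * int k * n"
    using assms(1) by (auto simp: cong_iff_lin)
  then have "pi * of_int b / k = 2 * pi * of_int n + pi * of_int a / k"
    using assms(2) by (simp add: field_simps)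
  then show ?thesis
    by (simp only: unit_root_cis cis_add_2pi_int)
qed

lemma sector_cong:
  assumes "[a = b] (mod 2 * int k)" "k > 0"
  shows "sector k a = sector k b"
proof -
  have "[- a = - b] (mod 2 * int k)"
    using assms(1) by (simp add: cong_minus_minus_iff)
  then show ?thesis
    using unit_root_cong assms(2) by (simp add: sector_def)
qed

lemma rcis_positive_iff:
  assumes "r > 0" "\<bar>x\<bar> < 2 * pi"
  shows "0 < of_real r * cis x \<longleftrightarrow> x = 0"
proof
  assume "0 < of_real r * cis x"
  then have "cos x > 0" "sin x = 0"
    using assms(1) by (auto simp: less_complex_def zero_less_mult_iff)
  then have "cos x = 1"
    using sin_cos_squared_add[of x] by (auto simp: power2_eq_1_iff)
  then obtain n :: int where n: "x = of_int n * 2 * pi"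
    by (auto simp: cos_one_2pi_int)
  then have "\<bar>of_int n\<bar> * (2 * pi) < 1 * (2 * pi)"
    using assms(2) by (simp add: abs_mult)
  then have "\<bar>real_of_int n\<bar> < 1"
    by (subst (asm) mult_less_cancel_right_pos) auto
  then show "x = 0"
    using n by simp
qed (use assms in \<open>simp add: less_complex_def\<close>)

lemma rcis_negative_iff:
  assumes "r > 0" "\<bar>x\<bar> \<le> pi"
  shows "of_real r * cis x < 0 \<longleftrightarrow> \<bar>x\<bar> = pi"
proof
  assume "of_real r * cis x < 0"
  then have *: "cos x < 0" "sin x = 0"
    using assms(1) by (auto simp: less_complex_def mult_less_0_iff)
  then have "sin \<bar>x\<bar> = 0" "x \<noteq> 0"
    by (auto simp: abs_if)
  show "\<bar>x\<bar> = pi"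
  proof (rule ccontr)
    assume "\<bar>x\<bar> \<noteq> pi"
    then have "sin \<bar>x\<bar> > 0"
      using assms(2) \<open>x \<noteq> 0\<close> by (intro sin_gt_zero) auto
    then show False
      using \<open>sin \<bar>x\<bar> = 0\<close> by simp
  qed
next
  assume "\<bar>x\<bar> = pi"
  then have "x = pi \<or> x = - pi"
    by (auto simp: abs_if split: if_splits)
  then show "of_real r * cis x < 0"
    using assms(1) by (auto simp: less_complex_def)
qed

context pf_function
begin

lemma pt_unit_root:
  "pt j s t * unit_root k n = of_real (exp (Re t / k)) * cis ((pi * of_int (2 * j + n) + of_int s * Im t) / k)"
  by (simp add: pt_def unit_root_cis mult.assoc cis_mult add_divide_distrib algebra_simps)

lemma Arg_pt_unit_root:
  assumes "0 \<le> pi * of_int (2 * j + n) + of_int s * Im t" "pi * of_int (2 * j + n) + of_int s * Im t \<le> pi"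
  shows "Arg (pt j s t * unit_root k n) = (pi * of_int (2 * j + n) + of_int s * Im t) / k"
proof -
  let ?x = "pi * of_int (2 * j + n) + of_int s * Im t"
  have "0 \<le> ?x / k" "?x / k \<le> pi / k"
    using assms by (auto intro: divide_right_mono)
  then have "- pi < ?x / k" "?x / k \<le> pi"
    using pi_div_k(1) pi_gt_zero by linarith+
  then have "?x / k \<in> {-pi<..pi}"
    unfolding greaterThanAtMost_iff by blast
  then show ?thesis
    unfolding pt_unit_root by (subst Arg_times_of_real) (auto intro: Arg_cis)
qed

lemma pt_in_sector:
  assumes "0 < Im t" "Im t < pi"
  shows "pt j 1 t \<in> sector k (2 * j)" "pt j (-1) t \<in> sector k (2 * j - 1)"
proof -
  have "Arg (pt j 1 t * unit_root k (- (2 * j))) = Im t / k"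
    using Arg_pt_unit_root[of j "- (2 * j)" 1 t] assms by simp
  moreover have "Arg (pt j (-1) t * unit_root k (- (2 * j - 1))) = (pi - Im t) / k"
    using Arg_pt_unit_root[of j "- (2 * j - 1)" "-1" t] assms by simp
  ultimately show "pt j 1 t \<in> sector k (2 * j)" "pt j (-1) t \<in> sector k (2 * j - 1)"
    using assms by (simp_all add: sector_def divide_strict_right_mono)
qed

lemma cong_solvable: "\<exists>j. [int p * j = x] (mod int k)"
proof -
  have "coprime (int p) (int k)"
    using coprime_p_k by simp
  then obtain y where "[int p * y = 1] (mod int k)"
    using cong_solve_coprime_int by blast
  then have "[int p * y * x = 1 * x] (mod int k)"
    by (rule cong_scalar_right)
  then show ?thesis
    by (intro exI[of _ "y * x"]) (simp add: mult.assoc)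
qed

lemma cong_unique:
  assumes "[int p * i = x] (mod int k)" "[int p * j = x] (mod int k)"
  shows "[i = j] (mod int k)"
proof -
  have "[int p * i = int p * j] (mod int k)"
    using assms cong_sym cong_trans by blast
  then show ?thesis
    using coprime_p_k by (simp add: cong_mult_lcancel)
qed

end

text \<open>\<beta> is the angle between \<alpha> and the ray of e_{2q}, and \<sigma> the side of
  that ray on which \<alpha> lies; in the theorem \<sigma> is 1 - 2 * \<kappa>.\<close>

locale alpha_setup = pf_function +
  fixes \<alpha> :: complex and q \<sigma> m :: int and \<rho> \<beta> :: real
  assumes \<rho>_pos: "\<rho> > 0" and sigma: "\<sigma> = 1 \<or> \<sigma> = -1"
    and beta_nonneg: "0 \<le> \<beta>" and beta_le: "\<beta> \<le> pi / k"
    and alpha: "\<alpha> = of_real \<rho> * cis (2 * pi * of_int q / k + of_int \<sigma> * \<beta>)"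
    and m: "[int p * m = q] (mod int k)"
begin

abbreviation h :: real where
  "h \<equiv> pi / k"

lemma h_pos: "h > 0"
  by simp

lemma alpha_nonzero: "\<alpha> \<noteq> 0"
  using \<rho>_pos by (simp add: alpha)

text \<open>Rotation to the j-th ray changes the argument by p * j steps of 2 * h, where k steps
  make a full turn. Equality of arguments therefore fixes N modulo k only.\<close>

lemma F_pt_eq_alpha_iff:
  assumes "level \<rho> V t" "s = 1 \<or> s = -1"
  shows "F (pt j s t) = \<alpha> \<longleftrightarrow>
    (\<exists>N::int. of_int s * V = of_int \<sigma> * \<beta> + 2 * h * of_int N \<and> [int p * j + N = q] (mod int k))"
proof -
  have "F (pt j s t) = \<alpha> \<longleftrightarrow>
      (\<exists>n::int. 2 * pi * real p * of_int j / k + of_int s * V = 2 * pi * of_int q / k + of_int \<sigma> * \<beta> + 2 * pi * of_int n)"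
    using \<rho>_pos by (simp add: F_pt_level[OF assms(1) \<rho>_pos assms(2)] alpha cis_eq_cis_iff)
  also have "\<dots> \<longleftrightarrow> (\<exists>n::int. of_int s * V = of_int \<sigma> * \<beta> + 2 * h * of_int (q + int k * n - int p * j))"
    by (intro ex_cong1) (simp add: field_simps)
  also have "\<dots> \<longleftrightarrow> (\<exists>N::int. of_int s * V = of_int \<sigma> * \<beta> + 2 * h * of_int N \<and> [int p * j + N = q] (mod int k))"
  proof safe
    fix n assume "of_int s * V = of_int \<sigma> * \<beta> + 2 * h * of_int (q + int k * n - int p * j)"
    then show "\<exists>N::int. of_int s * V = of_int \<sigma> * \<beta> + 2 * h * of_int N \<and> [int p * j + N = q] (mod int k)"
      by (intro exI[of _ "q + int k * n - int p * j"]) (simp add: cong_def)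
  next
    fix N assume N: "of_int s * V = of_int \<sigma> * \<beta> + 2 * h * of_int N" "[int p * j + N = q] (mod int k)"
    then obtain n where "q = int p * j + N + int k * n"
      by (auto simp: cong_iff_lin)
    then have "N = q + int k * (- n) - int p * j"
      by simp
    then show "\<exists>n::int. of_int s * V = of_int \<sigma> * \<beta> + 2 * h * of_int (q + int k * n - int p * j)"
      using N(1) by blast
  qed
  finally show ?thesis .
qed

text \<open>The possible arguments are \<beta> + 2 * h * M on the side \<sigma> and - \<beta> + 2 *
  h * M on the other. Being nonnegative, they start with \<beta> and 2 * h - \<beta>.\<close>

lemma alpha_point_cases:
  assumes "F (pt j s t) = \<alpha>" "level \<rho> V t" "s = 1 \<or> s = -1"
  obtains (near) "V = \<beta>" "[int p * j = q] (mod int k)" "s = \<sigma> \<or> \<beta> = 0"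
  | (mirror) "V = 2 * h - \<beta>" "[int p * j = q + \<sigma>] (mod int k)" "s = - \<sigma>"
  | (far) "V \<ge> 2 * h + \<beta>"
proof -
  obtain N where N: "of_int s * V = of_int \<sigma> * \<beta> + 2 * h * of_int N" "[int p * j + N = q] (mod int k)"
    using F_pt_eq_alpha_iff[OF assms(2,3)] assms(1) by blast
  define M where "M = s * N"
  have "V = of_int s * (of_int s * V)"
    using assms(3) by auto
  then have V: "V = of_int (s * \<sigma>) * \<beta> + 2 * h * of_int M"
    unfolding N(1) M_def by (simp add: algebra_simps)
  have V_nonneg: "V \<ge> 0"
    using assms(2) Im_logF_nonneg by (auto simp: level_def)
  have N_eq: "N = s * M"
    using assms(3) by (auto simp: M_def)
  have hM: "2 * h * of_int M \<ge> 2 * h * of_int n" if "M \<ge> n" for n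
    using that by (intro mult_left_mono) auto
  have hM': "2 * h * of_int M \<le> 2 * h * of_int n" if "M \<le> n" for n
    using that by (intro mult_left_mono) auto
  consider "s = \<sigma>" | "s = - \<sigma>"
    using sigma assms(3) by auto
  then show thesis
  proof cases
    case 1
    then have V1: "V = \<beta> + 2 * h * of_int M"
      using V sigma by auto
    consider "M \<le> -1" | "M = 0" | "M \<ge> 1"
      by linarith
    then show thesis
    proof cases
      assume "M \<le> -1"
      then have "V \<le> \<beta> - 2 * h"
        using hM'[of "-1"] V1 by simp
      then show thesis
        using V_nonneg beta_le h_pos by linarith
    next
      assume "M = 0"
      then show thesis
        using near V1 1 N(2) N_eq by simp
    next
      assume "M \<ge> 1"
      then show thesis
        using far V1 hM[of 1] by simp
    qed
  next
    case 2
    then have V2: "V = - \<beta> + 2 * h * of_int M"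
      using V sigma by auto
    consider "M \<le> 0" | "M = 1" | "M \<ge> 2"
      by linarith
    then show thesis
    proof cases
      \<comment> \<open>On the opposite side this is compatible with V \<ge> 0 only for \<beta> = 0,
        where the two sides cannot be told apart; hence the alternative \<beta> = 0 in the case
        \<open>near\<close>.\<close>
      assume "M \<le> 0"
      then have "2 * h * of_int M \<le> 0"
        using hM'[of 0] by simp
      then have "\<beta> = 0" "V = \<beta>" "2 * h * of_int M = 0"
        using V2 V_nonneg beta_nonneg by linarith+
      moreover from this(3) have "M = 0"
        using h_pos by simp
      ultimately show thesis
        using near N(2) N_eq by simp
    next
      assume "M = 1"
      then have "N = - \<sigma>"
        using N_eq 2 by simp
      then have "[int p * j + - \<sigma> + \<sigma> = q + \<sigma>] (mod int k)"
        using N(2) by (intro cong_add cong_refl) auto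
      then show thesis
        using mirror V2 \<open>M = 1\<close> 2 by simp
    next
      \<comment> \<open>4 * h - \<beta> \<ge> 2 * h + \<beta> because \<beta> \<le> h.\<close>
      assume "M \<ge> 2"
      then have "V \<ge> - \<beta> + 4 * h"
        using hM[of 2] V2 by simp
      then show thesis
        using far beta_le by linarith
    qed
  qed
qed

lemma near_point:
  assumes "level \<rho> \<beta> t" "[int p * j = q] (mod int k)"
  shows "F (pt j \<sigma> t) = \<alpha>"
  unfolding F_pt_eq_alpha_iff[OF assms(1) sigma] using assms(2) by (intro exI[of _ 0]) simp

lemma next_point:
  assumes "level \<rho> (2 * h - \<beta>) t" "[int p * j = q + \<sigma>] (mod int k)"
  shows "F (pt j (- \<sigma>) t) = \<alpha>"
proof -
  have s: "- \<sigma> = 1 \<or> - \<sigma> = -1"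
    using sigma by auto
  have "[int p * j + - \<sigma> = q + \<sigma> + - \<sigma>] (mod int k)"
    using assms(2) by (intro cong_add cong_refl)
  then show ?thesis
    unfolding F_pt_eq_alpha_iff[OF assms(1) s]
    by (intro exI[of _ "- \<sigma>"]) (simp add: algebra_simps)
qed

lemma alpha_point_level:
  assumes "F z = \<alpha>"
  obtains j s t V where "z = pt j s t" "s = 1 \<or> s = -1" "level \<rho> V t"
proof -
  have "z \<noteq> 0"
    using assms alpha_nonzero F_nonzeroD(1) by auto
  then obtain j s t where *: "t \<in> strip" "s = 1 \<or> s = -1" "z = pt j s t"
    using pt_exhaust by blast
  have "norm (R t) = norm \<alpha>"
    using norm_F_pt[OF *(2), of j t] assms unfolding *(3) by (simp only:)
  also have "\<dots> = \<rho>"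
    using \<rho>_pos by (simp add: alpha norm_mult)
  finally show thesis
    using that * level_of_norm_R \<rho>_pos by blast
qed

lemma level_less:
  assumes "level \<rho> V t" "level \<rho> W u" "V < W"
  shows "Re t < Re u"
  using assms level_Re_less[of t u] by (simp add: level_def)

lemma near_level_exists: "\<exists>t. level \<rho> \<beta> t"
proof (cases "\<beta> = 0")
  case True
  then show ?thesis
    using level_zero_exists[OF \<rho>_pos] by metis
next
  case False
  then show ?thesis
    using level_exists[OF \<rho>_pos, of \<beta>] beta_nonneg beta_le pi_div_k(1) by auto
qed

text \<open>For \<beta> < h only the argument \<beta> is minimal, and its level point is unique, so
  the closest \<alpha>-point is unique. It is simple by \<open>Dl_off_axis\<close> for \<beta> > 0
  and by \<open>Dl_positive_axis\<close> for \<beta> = 0.\<close>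

lemma generic_case:
  assumes "\<beta> < h"
  shows "(\<exists>!z. z \<in> nearest_points (alpha_set F \<alpha>)) \<and>
    (\<forall>z \<in> nearest_points (alpha_set F \<alpha>). simple_point F z \<and>
      (\<forall>w \<in> succeeding_points (alpha_set F \<alpha>) z. Arg z \<noteq> Arg w \<and> cmod z \<noteq> cmod w) \<and>
      (0 < \<beta> \<longrightarrow> z \<in> sector k (2 * m - (if \<sigma> = 1 then 0 else 1))) \<and>
      (\<beta> = 0 \<longrightarrow> 0 < z * unit_root k (- 2 * m)))"
proof -
  have low: "\<beta> < pi" "\<beta> < \<eta> * pi"
    using assms pi_div_k by linarith+
  obtain t where t: "level \<rho> \<beta> t"
    using near_level_exists by blast
  define z where "z = pt m \<sigma> t"
  have Fz: "F z = \<alpha>"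
    unfolding z_def by (rule near_point[OF t m])
  have t_cases: "Im t = 0 \<and> \<beta> = 0 \<or> 0 < Im t \<and> Im t < pi \<and> 0 < \<beta>"
    by (rule low_level_cases[OF t low])
  have near: "pt j s u = z"
    if u: "level \<rho> \<beta> u" and js: "[int p * j = q] (mod int k)" "s = \<sigma> \<or> \<beta> = 0" for j s u
  proof -
    have "u = t"
      by (rule low_level_unique[OF u t \<rho>_pos low])
    moreover have "pt j s t = pt m s t"
      by (rule pt_cong[OF cong_unique[OF js(1) m]])
    \<comment> \<open>For \<beta> = 0 the point lies on the lower edge, where the sign
      \<open>s\<close> makes no difference.\<close>
    moreover have "pt m s t = z"
      using js(2) t_cases by (auto simp: z_def pt_def)
    ultimately show ?thesis
      by simp
  qed
  have closest: "w = z \<or> cmod z < cmod w" if w: "F w = \<alpha>" for w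
  proof -
    obtain j s u V where u: "w = pt j s u" "s = 1 \<or> s = -1" "level \<rho> V u"
      using alpha_point_level[OF w] .
    have "V = \<beta> \<and> w = z \<or> V > \<beta>"
      using w[unfolded u(1)] u(3,2)
    proof (cases rule: alpha_point_cases)
      case near
      then show ?thesis
        using that near u \<open>\<And>u s j. level \<rho> \<beta> u \<Longrightarrow> [int p * j = q] (mod int k) \<Longrightarrow> s = \<sigma> \<or> \<beta> = 0 \<Longrightarrow> pt j s u = z\<close>
        by auto
    next
      case mirror
      then show ?thesis
        using assms by simp
    next
      case far
      then show ?thesis
        using h_pos by linarith
    qed
    then show ?thesis
      using level_less[OF t u(3)] by (auto simp: u(1) z_def divide_strict_right_mono)
  qed
  have nearest: "nearest_points (alpha_set F \<alpha>) = {z}"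
    using Fz closest by (force simp: nearest_points_def alpha_set_def)
  have "F z \<noteq> 0"
    using Fz alpha_nonzero by simp
  note z_nz = F_nonzeroD[OF this]
  have zk: "z ^ k = of_real (exp (Re t)) * cis (of_int \<sigma> * Im t)"
    by (simp add: z_def pt_power)
  have "Dl (z ^ k) \<noteq> 0"
  proof (cases "\<beta> = 0")
    case True
    then have "Im t = 0"
      using t_cases by auto
    then have tx: "t = Complex (Re t) 0"
      by (simp add: complex_eq_iff)
    obtain x where x: "level \<rho> 0 (Complex x 0)" "\<And>\<nu>. d \<nu> * exp x < 1"
      using level_zero_exists[OF \<rho>_pos] by blast
    have "Complex x 0 = t"
      using low_level_unique[OF x(1) _ \<rho>_pos] t low True by simp
    then have "d \<nu> * exp (Re t) < 1" for \<nu>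
      using x(2) by auto
    then have "Re (Dl (of_real (exp (Re t)))) > 0"
      by (intro Dl_positive_axis) auto
    moreover have "z ^ k = of_real (exp (Re t))"
      using \<open>Im t = 0\<close> by (simp add: zk)
    ultimately show ?thesis
      by auto
  next
    case False
    then have "sin (Im t) > 0"
      using t_cases by (auto intro: sin_gt_zero)
    then have "Im (z ^ k) \<noteq> 0"
      using sigma by (auto simp: zk)
    then show ?thesis
      by (rule Dl_off_axis[OF _ z_nz(2,3)])
  qed
  then have "deriv F z \<noteq> 0"
    by (rule deriv_F_nonzero[OF \<open>F z \<noteq> 0\<close>])
  moreover have "Arg z \<noteq> Arg w \<and> cmod z \<noteq> cmod w" if w: "w \<in> succeeding_points (alpha_set F \<alpha>) z" for w
  proof -
    have Fw: "F w = \<alpha>" "w \<noteq> z" and w_min: "\<And>v. F v = \<alpha> \<Longrightarrow> v \<noteq> z \<Longrightarrow> cmod w \<le> cmod v"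
      using w by (auto simp: succeeding_points_def nearest_points_def alpha_set_def)
    have less: "cmod z < cmod w"
      using closest[OF Fw(1)] Fw(2) by blast
    have "Arg z \<noteq> Arg w"
    proof
      assume Arg: "Arg z = Arg w"
      \<comment> \<open>A point on the ray of \<open>z\<close> keeps the ray index, the side and the
        height; only the real part of the coordinate changes.\<close>
      define u where "u = Complex (Re t + k * ln (cmod w / cmod z)) (Im t)"
      have pos: "cmod w > 0" "cmod z > 0"
        using less z_nz(1) by auto
      have "exp (Re u / k) = exp (Re t / k) * exp (ln (cmod w / cmod z))"
        by (simp add: u_def add_divide_distrib exp_add)
      also have "\<dots> = cmod w"
        using pos by (simp add: z_def)
      finally have exp_u: "exp (Re u / k) = cmod w" .
      have "w = of_real (cmod w) * cis (Arg z)"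
        using rcis_cmod_Arg[of w] Arg by (simp add: rcis_def)
      also have "\<dots> = of_real (cmod w / cmod z) * (of_real (cmod z) * cis (Arg z))"
        using pos by simp
      also have "of_real (cmod z) * cis (Arg z) = pt m \<sigma> t"
        using rcis_cmod_Arg[of z] by (simp add: rcis_def z_def)
      also have "of_real (cmod w / cmod z) * pt m \<sigma> t = pt m \<sigma> u"
        using norm_pt[of m \<sigma> t, folded z_def] unfolding pt_def exp_u by (simp add: u_def)
      finally have w_pt: "w = pt m \<sigma> u" .
      have "regular t"
        using t by (simp add: level_def)
      then have "u \<in> strip"
        using regularD(1)[of t] by (simp add: strip_def u_def)
      moreover have "norm (R u) = \<rho>"
        using norm_F_pt[OF sigma, of m u] Fw(1) \<rho>_pos by (simp add: w_pt alpha norm_mult)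
      ultimately obtain V where V: "level \<rho> V u"
        using level_of_norm_R \<rho>_pos by blast
      obtain N where N: "of_int \<sigma> * V = of_int \<sigma> * \<beta> + 2 * h * of_int N" "[int p * m + N = q] (mod int k)"
        using F_pt_eq_alpha_iff[OF V sigma] Fw(1) w_pt by blast
      \<comment> \<open>With the same ray index N is a multiple of k, so the argument at
        \<open>u\<close> differs from \<beta> by a multiple of 2 * pi.\<close>
      have "[int p * m + N = int p * m + 0] (mod int k)"
        using N(2) m by (metis add.right_neutral cong_sym cong_trans)
      then have "[N = 0] (mod int k)"
        by (simp only: cong_add_lcancel)
      then obtain n where "N = int k * n"
        by (auto simp: cong_0_iff)
      then have "of_int \<sigma> * V = of_int \<sigma> * \<beta> + 2 * pi * of_int n"
        using N(1) by simp
      then have "V = \<beta> + 2 * pi * of_int (\<sigma> * n)"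
        using sigma by auto
      moreover have "V > \<beta>"
      proof (rule ccontr)
        assume "\<not> V > \<beta>"
        moreover have "V \<noteq> \<beta>"
        proof
          assume "V = \<beta>"
          then have "w = z"
            using near[of u m \<sigma>] V m w_pt by simp
          then show False
            using Fw(2) by simp
        qed
        ultimately have "Re u < Re t"
          using level_less[OF V t] by linarith
        then show False
          using less exp_u by (simp add: z_def divide_strict_right_mono)
             (metis divide_strict_right_mono exp_less_mono k_pos(1) less_asym of_nat_0_less_iff)
      qed
      ultimately have "of_int (\<sigma> * n) > (0::real)"
        by (simp add: zero_less_mult_iff)
      then have "\<sigma> * n \<ge> 1"
        by linarith
      then have "1 \<le> real_of_int (\<sigma> * n)"
        by (simp only: of_int_1_le_iff)
      then have "2 * pi * of_int (\<sigma> * n) \<ge> 2 * pi * 1"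
        by (rule mult_left_mono) simp
      then have V_ge: "V \<ge> \<beta> + 2 * pi"
        using \<open>V = \<beta> + 2 * pi * of_int (\<sigma> * n)\<close> by linarith
      \<comment> \<open>The point on the other side with argument 2 * h - \<beta> lies between: this
        value exceeds \<beta> and is below \<beta> + 2 * pi. Hence \<open>w\<close> is not among the
        succeeding points.\<close>
      have \<gamma>: "0 < 2 * h - \<beta>" "2 * h - \<beta> \<le> pi"
        using assms h_pos beta_nonneg pi_div_k(2) by linarith+
      obtain v where v: "level \<rho> (2 * h - \<beta>) v"
        using level_exists[OF \<rho>_pos \<gamma>] by blast
      obtain j where j: "[int p * j = q + \<sigma>] (mod int k)"
        using cong_solvable by blast
      have "Re t < Re v" "Re v < Re u"
        using level_less[OF t v] level_less[OF v V] assms \<gamma> V_ge beta_nonneg pi_gt_zero by linarith+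
      then have "exp (Re t / k) < exp (Re v / k)" "exp (Re v / k) < exp (Re u / k)"
        by (simp_all add: divide_strict_right_mono)
      then have "cmod z < cmod (pt j (- \<sigma>) v)" "cmod (pt j (- \<sigma>) v) < cmod w"
        using exp_u by (simp_all add: z_def)
      then show False
        using w_min[OF next_point[OF v j]] by fastforce
    qed
    then show ?thesis
      using less by simp
  qed
  moreover have "z \<in> sector k (2 * m - (if \<sigma> = 1 then 0 else 1))" if "0 < \<beta>"
    using pt_in_sector[of t m] t_cases sigma that by (auto simp: z_def)
  moreover have "0 < z * unit_root k (- 2 * m)" if "\<beta> = 0"
    using t_cases that rcis_positive_iff[of "exp (Re t / k)" 0] unfolding z_def pt_unit_root by auto
  ultimately show ?thesis
    unfolding nearest by (simp add: simple_point_def)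
qed

end

section \<open>Multisets of two nearest zeros\<close>

lemma size_2E:
  assumes "size M = 2"
  obtains a b where "M = {#a, b#}"
proof -
  obtain a N where "M = add_mset a N" "size N = 1"
    using assms size_eq_Suc_imp_eq_union[of M 1] by auto
  then show thesis
    using that size_1_singleton_mset[of N] by auto
qed

lemma nearest_zeros_pair:
  assumes ne: "z1 \<noteq> z2" and zero: "f z1 = 0" "f z2 = 0"
    and simple: "zorder f z1 = 1" "zorder f z2 = 1"
    and far: "\<And>w. f w = 0 \<Longrightarrow> w \<noteq> z1 \<Longrightarrow> w \<noteq> z2 \<Longrightarrow> cmod z1 < cmod w \<and> cmod z2 < cmod w"
  shows "nearest_zeros f 2 M \<longleftrightarrow> M = {#z1, z2#}"
proof
  assume "M = {#z1, z2#}"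
  then show "nearest_zeros f 2 M"
    using assms by (force simp: nearest_zeros_def)
next
  assume M: "nearest_zeros f 2 M"
  then obtain a b where ab: "M = {#a, b#}"
    using size_2E unfolding nearest_zeros_def by blast
  have zeros: "f a = 0" "f b = 0" and count: "int (count {#a, b#} a) \<le> zorder f a"
    and min: "\<And>z w. z \<in> {a, b} \<Longrightarrow> f w = 0 \<Longrightarrow> int (count {#a, b#} w) < zorder f w \<Longrightarrow> cmod z \<le> cmod w"
    using M unfolding ab nearest_zeros_def by auto
  have in_pair: "x \<in> {z1, z2}" if x: "x \<in> {a, b}" for x
  proof (rule ccontr)
    assume x_far: "x \<notin> {z1, z2}"
    then have "(z1 \<noteq> a \<and> z1 \<noteq> b) \<or> (z2 \<noteq> a \<and> z2 \<noteq> b)"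
      using x ne by auto
    then have "cmod x \<le> cmod z1 \<or> cmod x \<le> cmod z2"
      using min[OF x zero(1)] min[OF x zero(2)] simple by auto
    moreover have "f x = 0"
      using x zeros by auto
    ultimately show False
      using far[of x] x_far by auto
  qed
  have "a \<noteq> b"
    using count in_pair[of a] simple by auto
  then show "M = {#z1, z2#}"
    using in_pair[of a] in_pair[of b] ab by (auto simp: add_mset_commute)
qed

lemma nearest_zeros_double:
  assumes zero: "f z = 0" and double: "zorder f z = 2"
    and far: "\<And>w. f w = 0 \<Longrightarrow> w \<noteq> z \<Longrightarrow> cmod z < cmod w"
  shows "nearest_zeros f 2 M \<longleftrightarrow> M = {#z, z#}"
proof
  assume "M = {#z, z#}"
  then show "nearest_zeros f 2 M"
    using assms by (force simp: nearest_zeros_def)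
next
  assume M: "nearest_zeros f 2 M"
  then obtain a b where ab: "M = {#a, b#}"
    using size_2E unfolding nearest_zeros_def by blast
  have zeros: "f a = 0" "f b = 0"
    and min: "\<And>x. x \<in> {a, b} \<Longrightarrow> int (count {#a, b#} z) < zorder f z \<Longrightarrow> cmod x \<le> cmod z"
    using M zero unfolding ab nearest_zeros_def by auto
  have "x = z" if x: "x \<in> {a, b}" for x
  proof (rule ccontr)
    assume "x \<noteq> z"
    then have "cmod x \<le> cmod z"
      using min[OF x] x double by auto
    then show False
      using far[of x] \<open>x \<noteq> z\<close> x zeros by auto
  qed
  from this[of a] this[of b] show "M = {#z, z#}"
    using ab by simp
qed

lemma mset_pair_eq_iff: "{#a, b#} = {#x, y#} \<longleftrightarrow> a = x \<and> b = y \<or> a = y \<and> b = x"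
  by (auto simp: add_eq_conv_ex)

context alpha_setup
begin

text \<open>In units of pi / k the argument on the upper edge is the integer p + k * n, which equals
  1 only for p = 1 and n = 0. On the lower edge it is a multiple of pi, whereas 0 < h < pi.\<close>

lemma edge_level_cases:
  assumes "level \<rho> h t"
  shows "0 < Im t \<and> Im t < pi \<or> Im t = pi \<and> p = 1"
proof -
  have reg: "regular t" and V: "Im (logF t) = h"
    using assms by (auto simp: level_def)
  consider "Im t = 0" | "Im t = pi" | "0 < Im t" "Im t < pi"
    using regularD(1)[OF reg] by (force simp: strip_def)
  then show ?thesis
  proof cases
    case 1
    have "pi * real (card {\<nu>. d \<nu> * exp (Re t) > 1}) < pi * 1"
      using Im_logF_bottom[OF 1 reg] V pi_div_k(1) by simp
    then have "card {\<nu>. d \<nu> * exp (Re t) > 1} = 0"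
      unfolding mult_less_cancel_left_pos[OF pi_gt_zero] by linarith
    then show ?thesis
      using Im_logF_bottom[OF 1 reg] V h_pos by simp
  next
    case 2
    let ?n = "card {\<nu>. c \<nu> * exp (Re t) > 1}"
    have "pi * (\<eta> + real ?n) = pi * (1 / k)"
      using Im_logF_top[OF 2 reg] V by (simp add: algebra_simps)
    then have "\<eta> + real ?n = 1 / k"
      unfolding mult_left_cancel[OF pi_neq_zero] .
    then have "real p + real k * real ?n = 1"
      by (simp add: \<eta>_def field_simps)
    then have "p + k * ?n = 1"
      by (simp flip: of_nat_mult of_nat_add)
    then show ?thesis
      using 2 p_pos by auto
  qed auto
qed

text \<open>An interior level point is unique and has one image on each side, in different sectors.
  On the upper edge the \<open>near\<close> and \<open>mirror\<close> descriptions name the same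
  points of one ray, and \<open>top_levels\<close> decides their number and multiplicity.\<close>

lemma negative_case:
  assumes beta: "\<beta> = h" and sig: "\<sigma> = - 1"
  defines "f \<equiv> \<lambda>z. F z - \<alpha>"
  shows "(\<exists>!M. nearest_zeros f 2 M) \<and>
    (\<forall>z1 z2. nearest_zeros f 2 {#z1, z2#} \<longrightarrow>
      (cmod z1 = cmod z2 \<or> Arg z1 = Arg z2) \<and>
      (z1 = z2 \<longrightarrow> zorder f z1 = 2) \<and>
      (Arg z1 = Arg z2 \<longrightarrow>
        p = 1 \<and> 0 < z1 * unit_root k (- 2 * m + 1) \<and> 0 < z2 * unit_root k (- 2 * m + 1)) \<and>
      (z1 \<noteq> z2 \<and> cmod z1 = cmod z2 \<longrightarrow>
        (\<forall>m'. [int p * m' = q - 1] (mod int k) \<longrightarrow>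
          z1 \<in> sector k (2 * m - 1) \<and> z2 \<in> sector k (2 * m') \<or>
          z2 \<in> sector k (2 * m - 1) \<and> z1 \<in> sector k (2 * m'))))"
proof -
  obtain t where t: "level \<rho> h t"
    using near_level_exists beta by auto
  have F_alpha: "f z = 0 \<longleftrightarrow> F z = \<alpha>" for z
    by (simp add: f_def)
  have nz: "F z \<noteq> 0" if "F z = \<alpha>" for z
    using that alpha_nonzero by simp
  have cases: "level \<rho> h u \<and> (s = -1 \<and> [int p * j = q] (mod int k) \<or> s = 1 \<and> [int p * j = q - 1] (mod int k))
      \<or> (\<forall>u'. level \<rho> h u' \<longrightarrow> Re u' < Re u)"
    if "F (pt j s u) = \<alpha>" "level \<rho> V u" "s = 1 \<or> s = -1" for j s u V
    using that
  proof (cases rule: alpha_point_cases)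
    case far
    then have "h < V"
      using beta h_pos by linarith
    then show ?thesis
      using level_less that(2) by blast
  qed (use that beta sig h_pos in auto)
  consider "0 < Im t" "Im t < pi" | "Im t = pi" "p = 1"
    using edge_level_cases[OF t] by blast
  then show ?thesis
  proof cases
    case 1
    have unique: "u = t" if "level \<rho> h u" for u
      using level_unique[of u t] that t 1 by (auto simp: level_def same_edge_def complex_eq_iff)
    obtain m' where m': "[int p * m' = q - 1] (mod int k)"
      using cong_solvable by blast
    define z1 where "z1 = pt m (-1) t"
    define z2 where "z2 = pt m' 1 t"
    have F12: "F z1 = \<alpha>" "F z2 = \<alpha>"
      unfolding z1_def z2_def
      using near_point[of t m] next_point[of t m'] t m m' beta sig by auto
    have "sin (Im t) > 0"
      using 1 by (rule sin_gt_zero)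
    then have Im: "Im (z1 ^ k) < 0" "Im (z2 ^ k) > 0"
      by (simp_all add: z1_def z2_def pt_power mult_less_0_iff)
    then have "z1 \<noteq> z2"
      by auto
    have "Dl (z1 ^ k) \<noteq> 0" "Dl (z2 ^ k) \<noteq> 0"
      using Dl_off_axis[of "z1 ^ k"] Dl_off_axis[of "z2 ^ k"] Im
        F_nonzeroD[OF nz[OF F12(1)]] F_nonzeroD[OF nz[OF F12(2)]] by auto
    then have ord: "zorder f z1 = 1" "zorder f z2 = 1"
      unfolding f_def
      using zorder_simple[OF F12(1) alpha_nonzero] zorder_simple[OF F12(2) alpha_nonzero] by blast+
    have eq: "cmod z1 = cmod z2"
      by (simp add: z1_def z2_def)
    have far: "cmod z1 < cmod w \<and> cmod z2 < cmod w" if w: "f w = 0" "w \<noteq> z1" "w \<noteq> z2" for w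
    proof -
      have Fw: "F w = \<alpha>"
        using w(1) F_alpha by simp
      obtain j s u V where u: "w = pt j s u" "s = 1 \<or> s = -1" "level \<rho> V u"
        using alpha_point_level[OF Fw] .
      have "\<not> (level \<rho> h u \<and> (s = -1 \<and> [int p * j = q] (mod int k) \<or> s = 1 \<and> [int p * j = q - 1] (mod int k)))"
      proof
        assume *: "level \<rho> h u \<and> (s = -1 \<and> [int p * j = q] (mod int k) \<or> s = 1 \<and> [int p * j = q - 1] (mod int k))"
        then have "u = t"
          using unique by blast
        moreover have "pt j s t = z1 \<or> pt j s t = z2"
          using * pt_cong[OF cong_unique[OF _ m], of j] pt_cong[OF cong_unique[OF _ m'], of j]
          by (auto simp: z1_def z2_def)
        ultimately show False
          using w(2,3) u(1) by auto
      qed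
      then have "Re t < Re u"
        using cases[OF Fw[unfolded u(1)] u(3,2)] t by blast
      then show ?thesis
        by (simp add: u(1) z1_def z2_def divide_strict_right_mono)
    qed
    have nz_iff: "nearest_zeros f 2 M \<longleftrightarrow> M = {#z1, z2#}" for M
      by (rule nearest_zeros_pair[OF \<open>z1 \<noteq> z2\<close> _ _ ord far]) (simp_all add: F_alpha F12)
    have Arg: "Arg z1 \<noteq> Arg z2"
      using eq \<open>z1 \<noteq> z2\<close> rcis_cmod_Arg by metis
    have sect: "z1 \<in> sector k (2 * m - 1)" "z2 \<in> sector k (2 * m')"
      unfolding z1_def z2_def using pt_in_sector 1 by auto
    have sect': "z2 \<in> sector k (2 * n)" if "[int p * n = q - 1] (mod int k)" for n
    proof -
      have "pt n 1 t = z2"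
        unfolding z2_def by (rule pt_cong[OF cong_unique[OF that m']])
      then show ?thesis
        using pt_in_sector(1)[OF 1, of n] by simp
    qed
    show ?thesis
      unfolding nz_iff mset_pair_eq_iff using eq Arg sect sect' \<open>z1 \<noteq> z2\<close> by auto
  next
    case 2
    have h_eq: "h = \<eta> * pi"
      unfolding \<eta>_def using 2 by simp
    \<comment> \<open>An interior level point would coincide with \<open>t\<close>, which lies on
      the edge.\<close>
    have on_top: "u = Complex (Re u) pi" if u: "level \<rho> h u" for u
    proof -
      have "\<not> (0 < Im u \<and> Im u < pi)"
      proof
        assume *: "0 < Im u \<and> Im u < pi"
        then have "u = t"
          using level_unique[of u t] u t by (auto simp: level_def same_edge_def complex_eq_iff)
        then show False
          using * 2 by simp
      qed
      then have "Im u = pi"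
        using edge_level_cases[OF u] by blast
      then show ?thesis
        by (simp add: complex_eq_iff)
    qed
    define Z where "Z x = pt m (-1) (Complex x pi)" for x
    have F_Z: "F (Z x) = \<alpha>" if "level \<rho> h (Complex x pi)" for x
      unfolding Z_def using near_point[of "Complex x pi" m] that m beta sig by simp
    have Z_of: "pt j s u = Z (Re u)"
      if u: "level \<rho> h u" "s = -1 \<and> [int p * j = q] (mod int k) \<or> s = 1 \<and> [int p * j = q - 1] (mod int k)" for j s u
      using u(2)
    proof
      assume "s = -1 \<and> [int p * j = q] (mod int k)"
      then show ?thesis
        unfolding Z_def using pt_cong[OF cong_unique[OF _ m], of j] on_top[OF u(1)] by metis
    next
      assume s: "s = 1 \<and> [int p * j = q - 1] (mod int k)"
      \<comment> \<open>The upper edges of the sectors next to the rays j and j + 1 map to the same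
        ray between them. As p = 1, passing to j + 1 turns the congruence for q - 1 into the one for
        q.\<close>
      then have "[int p * (j + 1) = q] (mod int k)"
        using cong_add[of j "q - 1" "int k" 1 1] 2 by simp
      then have "pt (j + 1) (-1) u = pt m (-1) u"
        by (intro pt_cong cong_unique[OF _ m])
      moreover have "Im u = pi"
        using arg_cong[OF on_top[OF u(1)], of Im] by simp
      then have "pt j 1 u = pt (j + 1) (-1) u"
        by (simp add: pt_def add_divide_distrib diff_divide_distrib algebra_simps)
      ultimately show ?thesis
        unfolding Z_def using s on_top[OF u(1)] by metis
    qed
    have others: "(\<exists>x. level \<rho> h (Complex x pi) \<and> w = Z x) \<or>
        (\<forall>x. level \<rho> h (Complex x pi) \<longrightarrow> cmod (Z x) < cmod w)" if w: "f w = 0" for w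
    proof -
      have Fw: "F w = \<alpha>"
        using w F_alpha by simp
      obtain j s u V where u: "w = pt j s u" "s = 1 \<or> s = -1" "level \<rho> V u"
        using alpha_point_level[OF Fw] .
      show ?thesis
        using cases[OF Fw[unfolded u(1)] u(3,2)]
      proof
        assume *: "level \<rho> h u \<and> (s = -1 \<and> [int p * j = q] (mod int k) \<or> s = 1 \<and> [int p * j = q - 1] (mod int k))"
        then have "level \<rho> h (Complex (Re u) pi)"
          using on_top by metis
        then show ?thesis
          using Z_of * u(1) by blast
      next
        assume *: "\<forall>u'. level \<rho> h u' \<longrightarrow> Re u' < Re u"
        have "cmod (Z x) < cmod w" if "level \<rho> h (Complex x pi)" for x
          using *[rule_format, OF that] by (simp add: Z_def u(1) divide_strict_right_mono)
        then show ?thesis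
          by blast
      qed
    qed
    have Z_pow: "Z x ^ k = of_real (- exp x)" for x
      by (simp add: Z_def pt_power complex_eq_iff)
    have Z_pos: "0 < Z x * unit_root k (- 2 * m + 1)" for x
      using rcis_positive_iff[of "exp (x / k)" 0] unfolding Z_def pt_unit_root by simp
    have Z_Arg: "Arg (Z x) = Arg (Z y)" for x y
      by (simp add: Z_def pt_def Arg_times_of_real)
    have Z_norm: "cmod (Z x) = exp (x / k)" for x
      by (simp add: Z_def)
    have "level \<rho> (\<eta> * pi) (Complex (Re t) pi)"
      using t on_top[OF t] h_eq by simp
    from \<rho>_pos this show ?thesis
    proof (cases rule: top_levels)
      case (double x)
      then have L: "level \<rho> h (Complex y pi) \<longleftrightarrow> y = x" for y
        by (simp add: h_eq)
      then have "level \<rho> (\<eta> * pi) (Complex x pi)"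
        using h_eq by simp
      then have "\<forall>\<nu>. c \<nu> * exp x < 1"
        using level_top_iff[OF \<rho>_pos] by blast
      then have ord: "zorder f (Z x) = 2"
        unfolding f_def using F_Z[of x] L alpha_nonzero Z_pow[of x] double(2)
        by (intro zorder_double[of _ _ "exp x"]) auto
      have "cmod (Z x) < cmod w" if "f w = 0" "w \<noteq> Z x" for w
        using others[OF that(1)] that(2) by (auto simp: L)
      then have nz_iff: "nearest_zeros f 2 M \<longleftrightarrow> M = {#Z x, Z x#}" for M
        using F_Z[of x] L by (intro nearest_zeros_double ord) (auto simp: F_alpha)
      show ?thesis
        unfolding nz_iff mset_pair_eq_iff using ord Z_pos 2 by auto
    next
      case (simple x1 x2)
      then have L: "level \<rho> h (Complex y pi) \<longleftrightarrow> y = x1 \<or> y = x2" for y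
        by (simp add: h_eq)
      have FZ: "F (Z x1) = \<alpha>" "F (Z x2) = \<alpha>"
        using F_Z L by auto
      have ord: "zorder f (Z x1) = 1" "zorder f (Z x2) = 1"
        unfolding f_def using FZ alpha_nonzero Z_pow simple by (auto intro!: zorder_simple)
      have norm: "cmod (Z x1) \<noteq> cmod (Z x2)"
        using simple(1) by (simp add: Z_norm)
      then have "Z x1 \<noteq> Z x2"
        by auto
      have nz_iff: "nearest_zeros f 2 M \<longleftrightarrow> M = {#Z x1, Z x2#}" for M
      proof (rule nearest_zeros_pair[OF \<open>Z x1 \<noteq> Z x2\<close> _ _ ord])
        show "cmod (Z x1) < cmod w \<and> cmod (Z x2) < cmod w" if "f w = 0" "w \<noteq> Z x1" "w \<noteq> Z x2" for w
          using others[OF that(1)] that(2,3) by (auto simp: L)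
      qed (simp_all add: F_alpha FZ)
      show ?thesis
        unfolding nz_iff mset_pair_eq_iff using norm Z_pos Z_Arg 2 \<open>Z x1 \<noteq> Z x2\<close> by auto
    qed
  qed
qed

section \<open>The position of \<alpha> relative to the rays\<close>

lemma alpha_times_unit_root:
  "\<alpha> * unit_root k n = of_real \<rho> * cis (pi * of_int (2 * q + n) / k + of_int \<sigma> * \<beta>)"
  by (simp add: alpha unit_root_cis mult.assoc cis_mult add_divide_distrib algebra_simps)

text \<open>Here \<alpha> lies on the ray of e_{2q-1}, so the product has argument (2 * q - 1 + n) *
  pi / k.\<close>

lemma Im_alpha_eq_0_iff:
  assumes beta: "\<beta> = h" and sig: "\<sigma> = - 1"
  shows "Im (\<alpha> * unit_root k n) = 0 \<longleftrightarrow> int k dvd 2 * q - 1 + n"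
proof -
  have "pi * of_int (2 * q + n) / k + of_int \<sigma> * \<beta> = pi * of_int (2 * q - 1 + n) / k"
    by (simp add: beta sig field_simps)
  then have "Im (\<alpha> * unit_root k n) = 0 \<longleftrightarrow> sin (pi * of_int (2 * q - 1 + n) / k) = 0"
    using \<rho>_pos by (simp add: alpha_times_unit_root del: of_int_add of_int_diff)
  also have "\<dots> \<longleftrightarrow> (\<exists>i::int. pi * of_int (2 * q - 1 + n) = pi * of_int (int k * i))"
    unfolding sin_zero_iff_int2 by (intro ex_cong1) (simp add: field_simps)
  also have "\<dots> \<longleftrightarrow> int k dvd 2 * q - 1 + n"
    unfolding mult_left_cancel[OF pi_neq_zero] of_int_eq_iff by (auto simp: dvd_def)
  finally show ?thesis .
qed

text \<open>Adding the congruences for m, m' and s gives p * (m' + m + s) = 0 modulo k, and p can be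
  cancelled. Doubling turns this into a congruence modulo 2 * k, the period of the sectors.\<close>

lemma mirror_sector:
  assumes beta: "\<beta> = h" and sig: "\<sigma> = - 1"
    and m': "[int p * m' = q - 1] (mod int k)" and s: "Im (\<alpha> * unit_root k (int p * s)) = 0"
  shows "sector k (2 * m') = sector k (- 2 * m - 2 * s)"
proof -
  have "int k dvd 2 * q - 1 + int p * s"
    using s Im_alpha_eq_0_iff[OF beta sig] by simp
  then have "[q - 1 + q + int p * s = 0] (mod int k)"
    by (simp add: cong_0_iff algebra_simps)
  moreover have "[int p * m' + int p * m + int p * s = q - 1 + q + int p * s] (mod int k)"
    by (intro cong_add m' m cong_refl)
  ultimately have "[int p * (m' + m + s) = 0] (mod int k)"
    using cong_trans by (simp add: distrib_left) blast
  then have "int k dvd m' + m + s"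
    using coprime_p_k by (simp add: cong_0_iff coprime_dvd_mult_right_iff coprime_commute)
  then have "2 * int k dvd 2 * (m' + m + s)"
    by (intro mult_dvd_mono dvd_refl)
  then have "[2 * m' = - 2 * m - 2 * s] (mod 2 * int k)"
    by (simp add: cong_iff_dvd_diff algebra_simps)
  then show ?thesis
    by (rule sector_cong) simp
qed

lemma alpha_power_negative_iff: "\<alpha> ^ k < 0 \<longleftrightarrow> \<beta> = h"
proof -
  have "real k * (2 * pi * of_int q / k + of_int \<sigma> * \<beta>) = 2 * pi * of_int q + of_int \<sigma> * (k * \<beta>)"
    by (simp add: field_simps)
  then have "\<alpha> ^ k = of_real (\<rho> ^ k) * cis (of_int \<sigma> * (k * \<beta>))"
    unfolding alpha power_mult_distrib Complex.DeMoivre by (simp only: cis_add_2pi_int of_real_power)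
  moreover have abs: "\<bar>of_int \<sigma> * (k * \<beta>)\<bar> = k * \<beta>"
    using sigma beta_nonneg by (auto simp: abs_mult)
  moreover have "k * \<beta> \<le> pi"
    using beta_le by (simp add: field_simps)
  ultimately have "\<alpha> ^ k < 0 \<longleftrightarrow> k * \<beta> = pi"
    using rcis_negative_iff[of "\<rho> ^ k" "of_int \<sigma> * (k * \<beta>)"] \<rho>_pos by simp
  then show ?thesis
    by (auto simp: field_simps)
qed

lemma alpha_on_upper_ray_iff: "0 < \<alpha> * unit_root k (- 2 * q) \<longleftrightarrow> \<beta> = 0"
proof -
  have "\<bar>of_int \<sigma> * \<beta>\<bar> < 2 * pi"
    using sigma beta_nonneg beta_le pi_div_k(1) pi_gt_zero by (auto simp: abs_mult)
  then show ?thesis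
    using rcis_positive_iff[OF \<rho>_pos] sigma by (auto simp: alpha_times_unit_root)
qed

lemma alpha_on_lower_ray_iff: "0 < \<alpha> * unit_root k (- 2 * q + 1) \<longleftrightarrow> \<beta> = h \<and> \<sigma> = - 1"
proof -
  have "\<bar>of_int \<sigma> * \<beta>\<bar> \<le> h"
    using sigma beta_nonneg beta_le by (auto simp: abs_mult)
  then have "\<bar>h + of_int \<sigma> * \<beta>\<bar> < 2 * pi"
    using pi_div_k(1) pi_gt_zero by linarith
  then have "0 < \<alpha> * unit_root k (- 2 * q + 1) \<longleftrightarrow> h + of_int \<sigma> * \<beta> = 0"
    using rcis_positive_iff[OF \<rho>_pos, of "h + of_int \<sigma> * \<beta>"] by (simp add: alpha_times_unit_root)
  also have "\<dots> \<longleftrightarrow> \<beta> = h \<and> \<sigma> = - 1"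
  proof -
    have "h + \<beta> > 0"
      using h_pos beta_nonneg by linarith
    then show ?thesis
      using sigma by auto
  qed
  finally show ?thesis .
qed

end

section \<open>Finite and infinite products\<close>

text \<open>A finite product is treated as an infinite one whose remaining factors have coefficient 0.\<close>

definition factor_coeff :: "enat \<Rightarrow> (nat \<Rightarrow> real) \<Rightarrow> nat \<Rightarrow> real" where
  "factor_coeff \<omega> a \<nu> = (if enat \<nu> < \<omega> then 1 / a \<nu> else 0)"

lemma eprod_eq_gprod: "eprod \<omega> (\<lambda>\<nu>. 1 + w / of_real (a \<nu>)) = gprod (factor_coeff \<omega> a) w"
proof (cases \<omega>)
  case (enat n)
  have "gprod (factor_coeff \<omega> a) w = (\<Prod>\<nu>\<in>{..<n}. 1 + of_real (factor_coeff \<omega> a \<nu>) * w)"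
    unfolding gprod_def by (rule prodinf_finite) (auto simp: factor_coeff_def enat)
  also have "\<dots> = eprod \<omega> (\<lambda>\<nu>. 1 + w / of_real (a \<nu>))"
    by (simp add: eprod_def enat factor_coeff_def)
  finally show ?thesis
    by simp
next
  case infinity
  then show ?thesis
    by (simp add: eprod_def gprod_def factor_coeff_def)
qed

text \<open>At a point with |w| = 1 the distance of a factor from 1 is exactly its
  coefficient.\<close>

lemma nonneg_summable_factor_coeff:
  assumes pos: "\<And>\<nu>. enat \<nu> < \<omega> \<Longrightarrow> a \<nu> > 0"
    and conv: "abs_convergent_eprod \<omega> (\<lambda>\<nu>. 1 + w / of_real (a \<nu>))" and w: "norm w = 1"
  shows "nonneg_summable (factor_coeff \<omega> a)"
proof
  show "factor_coeff \<omega> a \<nu> \<ge> 0" for \<nu>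
    using pos[of \<nu>] by (auto simp: factor_coeff_def intro: less_imp_le)
  show "summable (factor_coeff \<omega> a)"
  proof (cases \<omega>)
    case (enat n)
    show ?thesis
      by (rule summable_finite[of "{..<n}"]) (auto simp: factor_coeff_def enat)
  next
    case infinity
    then have "summable (\<lambda>\<nu>. norm (1 + w / of_real (a \<nu>) - 1))"
      using conv by (simp add: abs_convergent_eprod_def abs_convergent_prod_conv_summable)
    moreover have "norm (1 + w / of_real (a \<nu>) - 1) = factor_coeff \<omega> a \<nu>" for \<nu>
      using pos[of \<nu>] w infinity by (simp add: factor_coeff_def norm_divide)
    ultimately show ?thesis
      by simp
  qed
qed

text \<open>For \<kappa> = 0 the angle \<beta> is measured from the closed side of the sector and
  lies in [0, pi / k). For \<kappa> = 1 it is measured backwards from the open side and lies in (0,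
  pi / k], so \<beta> = pi / k forces \<kappa> = 1.\<close>

lemma half_closed_sector_polar:
  assumes "\<alpha> \<in> half_closed_sector k (2 * q - \<kappa>)" "\<kappa> = 0 \<or> \<kappa> = 1" "k > 0"
  obtains \<beta> where "0 \<le> \<beta>" "\<beta> \<le> pi / k" "\<beta> = pi / k \<longrightarrow> \<kappa> = 1"
    "\<alpha> = of_real (cmod \<alpha>) * cis (2 * pi * of_int q / k + of_int (1 - 2 * \<kappa>) * \<beta>)"
    "\<alpha> \<in> sector k (2 * q - \<kappa>) \<longrightarrow> 0 < \<beta>"
proof -
  define s where "s = 2 * q - \<kappa>"
  define x where "x = Arg (\<alpha> * unit_root k (- s))"
  have x: "0 \<le> x" "x < pi / k"
    using assms(1) by (auto simp: half_closed_sector_def x_def s_def)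
  have "\<alpha> * unit_root k (- s) = of_real (cmod \<alpha>) * cis x"
    using rcis_cmod_Arg[of "\<alpha> * unit_root k (- s)"] by (simp add: rcis_def x_def norm_mult unit_root_cis)
  then have "\<alpha> * unit_root k (- s) * unit_root k s = of_real (cmod \<alpha>) * cis (x + pi * of_int s / k)"
    by (simp add: unit_root_cis cis_mult mult.assoc)
  moreover have "unit_root k (- s) * unit_root k s = 1"
    by (simp add: unit_root_cis cis_mult)
  ultimately have \<alpha>: "\<alpha> = of_real (cmod \<alpha>) * cis (x + pi * of_int s / k)"
    by (metis mult.assoc mult.right_neutral)
  show thesis
  proof (cases "\<kappa> = 0")
    case True
    show thesis
    proof (rule that)
      show "\<alpha> = of_real (cmod \<alpha>) * cis (2 * pi * of_int q / k + of_int (1 - 2 * \<kappa>) * x)"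
        using \<alpha> True by (simp add: s_def algebra_simps)
      show "\<alpha> \<in> sector k (2 * q - \<kappa>) \<longrightarrow> 0 < x"
        by (simp add: sector_def x_def s_def)
    qed (use x in auto)
  next
    case False
    then have "\<kappa> = 1"
      using assms(2) by simp
    show thesis
    proof (rule that)
      have "x + pi * of_int s / k = 2 * pi * of_int q / k + of_int (1 - 2 * \<kappa>) * (pi / k - x)"
        using \<open>\<kappa> = 1\<close> by (simp add: s_def diff_divide_distrib right_diff_distrib)
      then show "\<alpha> = of_real (cmod \<alpha>) * cis (2 * pi * of_int q / k + of_int (1 - 2 * \<kappa>) * (pi / k - x))"
        using \<alpha> by simp
    qed (use x \<open>\<kappa> = 1\<close> in auto)
  qed
qed

theorem theorem22:
  fixes k p :: nat and A :: real and \<omega>1 \<omega>2 :: enat and a b :: "nat \<Rightarrow> real"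
    and \<alpha> :: complex and q \<kappa> m :: int and F :: "complex \<Rightarrow> complex"
  assumes "k \<ge> 2" and "p > 0" and "gcd p k = 1"
    and "0 < \<omega>1" and "0 < \<omega>2" and "A \<ge> 0"
    and "\<And>\<nu>. enat \<nu> < \<omega>1 \<Longrightarrow> a \<nu> > 0"
    and "\<And>\<mu>. enat \<mu> < \<omega>2 \<Longrightarrow> b \<mu> > 0"
    and "\<And>z. abs_convergent_eprod \<omega>1 (\<lambda>\<nu>. 1 + z ^ k / of_real (a \<nu>))"
    and "\<And>z. abs_convergent_eprod \<omega>2 (\<lambda>\<mu>. 1 - z ^ k / of_real (b \<mu>))"
    and F: "F = Ffun k p A \<omega>1 a \<omega>2 b"
    and "\<exists>z. (\<forall>\<mu>. enat \<mu> < \<omega>2 \<longrightarrow> z ^ k \<noteq> of_real (b \<mu>)) \<and> F z \<noteq> z ^ p"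
    and "\<alpha> \<noteq> 0" and "alpha_set F \<alpha> \<noteq> {}"
    and "q \<in> {0..int k - 1}" and "\<kappa> \<in> {0, 1}"
    and "\<alpha> \<in> half_closed_sector k (2 * q - \<kappa>)"
    and "[int p * m = q] (mod int k)"
  shows
    "(\<not> \<alpha> ^ k < 0 \<longrightarrow>
        (\<exists>!z. z \<in> nearest_points (alpha_set F \<alpha>)) \<and>
        (\<forall>z \<in> nearest_points (alpha_set F \<alpha>).
           simple_point F z \<and>
           (\<forall>w \<in> succeeding_points (alpha_set F \<alpha>) z. Arg z \<noteq> Arg w \<and> cmod z \<noteq> cmod w) \<and>
           (\<alpha> \<in> sector k (2 * q - \<kappa>) \<longrightarrow> z \<in> sector k (2 * m - \<kappa>)) \<and>
           (0 < \<alpha> * unit_root k (- 2 * q) \<longrightarrow> 0 < z * unit_root k (- 2 * m))))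
     \<and> (\<alpha> ^ k < 0 \<longleftrightarrow> 0 < \<alpha> * unit_root k (- 2 * q + 1))
     \<and> (\<alpha> ^ k < 0 \<longrightarrow>
        (\<exists>!M. nearest_zeros (\<lambda>z. F z - \<alpha>) 2 M) \<and>
        (\<exists>m'. [int p * m' = q - 1] (mod int k)) \<and>
        (\<exists>s. Im (\<alpha> * unit_root k (int p * s)) = 0) \<and>
        (\<forall>m' s. [int p * m' = q - 1] (mod int k) \<and> Im (\<alpha> * unit_root k (int p * s)) = 0 \<longrightarrow>
           sector k (2 * m') = sector k (- 2 * m - 2 * s)) \<and>
        (\<forall>z1 z2. nearest_zeros (\<lambda>z. F z - \<alpha>) 2 {#z1, z2#} \<longrightarrow>
           (cmod z1 = cmod z2 \<or> Arg z1 = Arg z2) \<and>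
           (z1 = z2 \<longrightarrow> zorder (\<lambda>z. F z - \<alpha>) z1 = 2) \<and>
           (Arg z1 = Arg z2 \<longrightarrow>
              p = 1 \<and> 0 < z1 * unit_root k (- 2 * m + 1) \<and> 0 < z2 * unit_root k (- 2 * m + 1)) \<and>
           (z1 \<noteq> z2 \<and> cmod z1 = cmod z2 \<longrightarrow>
              (\<forall>m'. [int p * m' = q - 1] (mod int k) \<longrightarrow>
                 z1 \<in> sector k (2 * m - 1) \<and> z2 \<in> sector k (2 * m') \<or>
                 z2 \<in> sector k (2 * m - 1) \<and> z1 \<in> sector k (2 * m')))))"
proof -
  define c where "c = factor_coeff \<omega>1 a"
  define d where "d = factor_coeff \<omega>2 b"
  have "norm (1 ^ k :: complex) = 1"
    by simp
  with assms(7,9) have c: "nonneg_summable c"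
    unfolding c_def by (rule nonneg_summable_factor_coeff)
  \<comment> \<open>The denominator becomes a product of the numerator type evaluated at -
    w.\<close>
  have minus: "1 - w / of_real (b \<mu>) = 1 + (- w) / of_real (b \<mu>)" for w :: complex and \<mu>
    by simp
  have "norm (- (1 ^ k) :: complex) = 1"
    by simp
  with assms(8,10)[unfolded minus] have d: "nonneg_summable d"
    unfolding d_def by (rule nonneg_summable_factor_coeff)
  obtain \<beta> where \<beta>: "0 \<le> \<beta>" "\<beta> \<le> pi / k" "\<beta> = pi / k \<longrightarrow> \<kappa> = 1"
      "\<alpha> = of_real (cmod \<alpha>) * cis (2 * pi * of_int q / k + of_int (1 - 2 * \<kappa>) * \<beta>)"
      "\<alpha> \<in> sector k (2 * q - \<kappa>) \<longrightarrow> 0 < \<beta>"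
    using half_closed_sector_polar[OF assms(17)] assms(1,16) by auto
  interpret L: alpha_setup c d k p A \<alpha> q "1 - 2 * \<kappa>" m "cmod \<alpha>" \<beta>
  proof (intro alpha_setup.intro pf_function.intro alpha_setup_axioms.intro pf_function_axioms.intro c d)
    show "coprime p k"
      using assms(3) by (simp add: coprime_iff_gcd_eq_1)
    show "c 0 > 0" "d 0 > 0"
      using assms(4,5) assms(7)[of 0] assms(8)[of 0] by (auto simp: c_def d_def factor_coeff_def zero_enat_def)
    show "1 - 2 * \<kappa> = 1 \<or> 1 - 2 * \<kappa> = - 1"
      using assms(16) by auto
  qed (use assms \<beta> in auto)
  have F_eq: "F = L.F"
    by (rule ext) (simp only: F Ffun_def L.F_def minus eprod_eq_gprod flip: c_def d_def)
  have generic: "\<not> \<alpha> ^ k < 0 \<longleftrightarrow> \<beta> < pi / k"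
    using L.alpha_power_negative_iff \<beta>(2) by auto
  have negative: "\<alpha> ^ k < 0 \<longleftrightarrow> 0 < \<alpha> * unit_root k (- 2 * q + 1)"
    unfolding L.alpha_power_negative_iff L.alpha_on_lower_ray_iff using \<beta>(3) by auto
  have \<kappa>: "(if 1 - 2 * \<kappa> = 1 then 0 else 1) = \<kappa>"
    using assms(16) by auto
  show ?thesis
    unfolding F_eq
  proof (intro conjI impI negative)
    assume "\<not> \<alpha> ^ k < 0"
    note G = L.generic_case[unfolded \<kappa>, OF generic[THEN iffD1, OF this]]
    show "\<exists>!z. z \<in> nearest_points (alpha_set L.F \<alpha>)"
      using G by (rule conjunct1)
    show "\<forall>z\<in>nearest_points (alpha_set L.F \<alpha>). simple_point L.F z \<and>
        (\<forall>w\<in>succeeding_points (alpha_set L.F \<alpha>) z. Arg z \<noteq> Arg w \<and> cmod z \<noteq> cmod w) \<and>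
        (\<alpha> \<in> sector k (2 * q - \<kappa>) \<longrightarrow> z \<in> sector k (2 * m - \<kappa>)) \<and>
        (0 < \<alpha> * unit_root k (- 2 * q) \<longrightarrow> 0 < z * unit_root k (- 2 * m))"
      using conjunct2[OF G] \<beta>(5) L.alpha_on_upper_ray_iff by blast
  next
    assume "\<alpha> ^ k < 0"
    then have sub: "\<beta> = pi / k" "1 - 2 * \<kappa> = - 1"
      using L.alpha_power_negative_iff \<beta>(3) by auto
    note N = L.negative_case[OF sub]
    show "\<exists>!M. nearest_zeros (\<lambda>z. L.F z - \<alpha>) 2 M"
      using N by (rule conjunct1)
    show "\<exists>m'. [int p * m' = q - 1] (mod int k)"
      by (rule L.cong_solvable)
    \<comment> \<open>This congruence makes 2 * q - 1 + p * s divisible by k, which rotates \<alpha>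
      onto the real axis.\<close>
    obtain s where "[int p * s = 1 - 2 * q] (mod int k)"
      using L.cong_solvable by blast
    then have "int k dvd 2 * q - 1 + int p * s"
      by (simp add: cong_iff_dvd_diff algebra_simps)
    then show "\<exists>s. Im (\<alpha> * unit_root k (int p * s)) = 0"
      using L.Im_alpha_eq_0_iff[OF sub] by blast
    show "\<forall>m' s. [int p * m' = q - 1] (mod int k) \<and> Im (\<alpha> * unit_root k (int p * s)) = 0 \<longrightarrow>
        sector k (2 * m') = sector k (- 2 * m - 2 * s)"
      using L.mirror_sector[OF sub] by blast
  qed (rule conjunct2[OF L.negative_case], use L.alpha_power_negative_iff \<beta>(3) in auto)
qed

end
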